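(* Let $k\in\mathbb{R}$ and consider two homogeneous layers, i.e. $V(x,\omega)=V_\pm(\omega)$ for $\pm x>0$. Every eigenvalue in $\sigma_p(L_k)\setminus\Omega_0$ is isolated.
   Context: $V_+,V_-:\Omega\to\mathbb{C}$ are given functions on a set $\Omega\subset\mathbb{C}$ (independent of $x$); $V(x,\omega)=V_+(\omega)$ for $x>0$, $V(x,\omega)=V_-(\omega)$ for $x<0$; $\Omega_0=\{\omega\in\Omega:\omega=0\text{ or }V_+(\omega)=0\text{ or }V_-(\omega)=0\}$. $A=\begin{pmatrix}0&0&\mathrm{i}k\\0&0&-\partial_x\\-\mathrm{i}k&\partial_x&0\end{pmatrix}$ with domain $D(A)=\{u\in L^2(\mathbb{R},\mathbb{C}^3):u_2,u_3\in H^1(\mathbb{R},\mathbb{C})\}$, $B(x,\omega)=\mathrm{diag}(\mathrm{i}V(x,\omega),\mathrm{i}V(x,\omega),\mathrm{i}\omega)$, $L_k(\omega)=A-B(\cdot,\omega):D(A)\to L^2(\mathbb{R},\mathbb{C}^3)$, $\omega\in\Omega$. $L_k$ denotes the pencil $\omega\mapsto L_k(\omega)$. $\sigma_p(L_k)=\{\omega\in\Omega:\exists u\in D(A)\setminus\{0\},\ L_k(\omega)u=0\}$. An eigenvalue $\omega\in\sigma_p(L_k)$ is called isolated if, with $\omega$ fixed, the eigenvalue $\lambda=0$ of the standard eigenvalue problem $L_k(\omega)u=\lambda u$ is isolated from the rest of the spectrum of the operator $L_k(\omega)$, i.e. there is $r>0$ with $\lambda\in\rho(L_k(\omega))$ for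 all $0<|\lambda|<r$. *)

theory Defs
  imports "HOL-Analysis.Analysis"
begin

section \<open>The Hilbert spaces \<open>L\<^sup>2(\<real>, E)\<close>\<close>

definition sq_integrable :: "(real \<Rightarrow> 'a::euclidean_space) \<Rightarrow> bool" where
  "sq_integrable f \<longleftrightarrow> f \<in> borel_measurable lborel \<and> integrable lborel (\<lambda>x. (norm (f x))\<^sup>2)"

lemma sq_integrable_bound:
  fixes f :: "real \<Rightarrow> 'a::euclidean_space" and g :: "real \<Rightarrow> 'b::euclidean_space"
    and h :: "real \<Rightarrow> 'c::euclidean_space"
  assumes "sq_integrable f" "sq_integrable g" "h \<in> borel_measurable lborel"
    and bd: "\<And>x. norm (h x) \<le> C * (norm (f x) + norm (g x))"
  shows "sq_integrable h"
proof -
  have "integrable lborel (\<lambda>x. C\<^sup>2 * (2 * (norm (f x))\<^sup>2 + 2 * (norm (g x))\<^sup>2))"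
    using assms unfolding sq_integrable_def by auto
  moreover have "(norm (h x))\<^sup>2 \<le> C\<^sup>2 * (2 * (norm (f x))\<^sup>2 + 2 * (norm (g x))\<^sup>2)" for x
  proof -
    have "(norm (h x))\<^sup>2 \<le> (C * (norm (f x) + norm (g x)))\<^sup>2"
      by (intro power_mono bd) auto
    also have "\<dots> = C\<^sup>2 * (norm (f x) + norm (g x))\<^sup>2"
      by (simp add: power_mult_distrib)
    also have "\<dots> \<le> C\<^sup>2 * (2 * (norm (f x))\<^sup>2 + 2 * (norm (g x))\<^sup>2)"
      using sum_squares_bound[of "norm (f x)" "norm (g x)"]
      by (intro mult_left_mono) (auto simp: power2_sum)
    finally show ?thesis .
  qed
  ultimately have "integrable lborel (\<lambda>x. (norm (h x))\<^sup>2)"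
    using assms(3) by (elim Bochner_Integration.integrable_bound) (auto simp: abs_of_nonneg)
  then show ?thesis using assms(3) by (simp add: sq_integrable_def)
qed

lemma sq_integrable_zero: "sq_integrable (\<lambda>x. 0)"
  by (simp add: sq_integrable_def)

lemma sq_integrable_add:
  "sq_integrable f \<Longrightarrow> sq_integrable g \<Longrightarrow> sq_integrable (\<lambda>x. f x + g x)"
  by (rule sq_integrable_bound[of f g _ 1])
     (auto simp: sq_integrable_def norm_triangle_ineq)

lemma sq_integrable_diff:
  "sq_integrable f \<Longrightarrow> sq_integrable g \<Longrightarrow> sq_integrable (\<lambda>x. f x - g x)"
  by (rule sq_integrable_bound[of f g _ 1])
     (auto simp: sq_integrable_def norm_triangle_ineq4)

lemma sq_integrable_bounded_linear:
  fixes T :: "'a::euclidean_space \<Rightarrow> 'b::euclidean_space"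
  assumes T: "bounded_linear T" and f: "sq_integrable f"
  shows "sq_integrable (\<lambda>x. T (f x))"
proof -
  obtain C where C: "\<And>v. norm (T v) \<le> norm v * C" "C > 0"
    using bounded_linear.pos_bounded[OF T] by blast
  have "(\<lambda>x. T (f x)) \<in> borel_measurable lborel"
    using f borel_measurable_continuous_on[OF linear_continuous_on[OF T], of f lborel]
    by (simp add: sq_integrable_def)
  then show ?thesis
    using C by (intro sq_integrable_bound[OF f sq_integrable_zero, of _ C])
      (auto simp: mult.commute)
qed

lemma sq_integrable_If:
  assumes "sq_integrable f" "sq_integrable g"
  shows "sq_integrable (\<lambda>x. if 0 < x then f x else g x)"
proof (rule sq_integrable_bound[OF assms, of _ 1])
  show "(\<lambda>x. if 0 < x then f x else g x) \<in> borel_measurable lborel"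
    using assms unfolding sq_integrable_def by (intro measurable_If) auto
qed auto

lemma integrable_inner_L2:
  assumes "sq_integrable f" "sq_integrable g"
  shows "integrable lborel (\<lambda>x. inner (f x) (g x))"
proof (rule Bochner_Integration.integrable_bound)
  show "integrable lborel (\<lambda>x. (norm (f x))\<^sup>2 + (norm (g x))\<^sup>2)"
    using assms by (auto simp: sq_integrable_def)
  show "(\<lambda>x. inner (f x) (g x)) \<in> borel_measurable lborel"
    using assms by (auto simp: sq_integrable_def)
  have "\<bar>inner a b\<bar> \<le> (norm a)\<^sup>2 + (norm b)\<^sup>2" for a b :: 'a
  proof -
    have "norm a * norm b * 2 \<le> (norm a)\<^sup>2 + (norm b)\<^sup>2"
      using sum_squares_bound[of "norm a" "norm b"] by (simp add: ac_simps)
    moreover have "0 \<le> norm a * norm b" by simp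
    ultimately show ?thesis using Cauchy_Schwarz_ineq2[of a b] by linarith
  qed
  then show "AE x in lborel. norm (inner (f x) (g x)) \<le> norm ((norm (f x))\<^sup>2 + (norm (g x))\<^sup>2)"
    by (intro AE_I2) (simp add: abs_of_nonneg)
qed

quotient_type (overloaded) 'a L2 = "real \<Rightarrow> 'a::euclidean_space" /
  partial: "\<lambda>f g. sq_integrable f \<and> sq_integrable g \<and> (AE x in lborel. f x = g x)"
  morphisms rep_L2 abs_L2
proof (rule part_equivpI)
  show "\<exists>f::real \<Rightarrow> 'a. sq_integrable f \<and> sq_integrable f \<and> (AE x in lborel. f x = f x)"
    using sq_integrable_zero by (intro exI[of _ "\<lambda>x. 0"]) auto
  show "symp (\<lambda>f g::real \<Rightarrow> 'a. sq_integrable f \<and> sq_integrable g \<and> (AE x in lborel. f x = g x))"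
    by (auto simp: symp_def elim: eventually_mono)
  show "transp (\<lambda>f g::real \<Rightarrow> 'a. sq_integrable f \<and> sq_integrable g \<and> (AE x in lborel. f x = g x))"
    by (auto simp: transp_def elim: eventually_elim2)
qed

text \<open>For complex-valued functions this inner product is the real part of the Hermitian one;
  it induces the usual \<open>L\<^sup>2\<close> norm.\<close>

instantiation L2 :: (euclidean_space) real_inner
begin

lift_definition zero_L2 :: "'a L2" is "\<lambda>x. 0"
  by (simp add: sq_integrable_zero)

lift_definition plus_L2 :: "'a L2 \<Rightarrow> 'a L2 \<Rightarrow> 'a L2" is "\<lambda>f g x. f x + g x"
  by (auto intro: sq_integrable_add elim: eventually_elim2)

lift_definition minus_L2 :: "'a L2 \<Rightarrow> 'a L2 \<Rightarrow> 'a L2" is "\<lambda>f g x. f x - g x"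
  by (auto intro: sq_integrable_diff elim: eventually_elim2)

lift_definition uminus_L2 :: "'a L2 \<Rightarrow> 'a L2" is "\<lambda>f x. - f x"
  by (auto intro: sq_integrable_bounded_linear[OF bounded_linear_minus[OF bounded_linear_ident]]
      elim: eventually_mono)

lift_definition scaleR_L2 :: "real \<Rightarrow> 'a L2 \<Rightarrow> 'a L2" is "\<lambda>c f x. c *\<^sub>R f x"
  by (auto intro: sq_integrable_bounded_linear[OF bounded_linear_scaleR_right]
      elim: eventually_mono)

lift_definition inner_L2 :: "'a L2 \<Rightarrow> 'a L2 \<Rightarrow> real" is "\<lambda>f g. LINT x|lborel. inner (f x) (g x)"
  by (rule integral_cong_AE) (auto simp: sq_integrable_def elim: eventually_elim2)

definition norm_L2 :: "'a L2 \<Rightarrow> real" where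
  "norm_L2 f = sqrt (inner f f)"

definition dist_L2 :: "'a L2 \<Rightarrow> 'a L2 \<Rightarrow> real" where
  "dist_L2 f g = norm (f - g)"

definition sgn_L2 :: "'a L2 \<Rightarrow> 'a L2" where
  "sgn_L2 f = inverse (norm f) *\<^sub>R f"

definition uniformity_L2 :: "('a L2 \<times> 'a L2) filter" where
  "uniformity_L2 = (INF e\<in>{0<..}. principal {(f, g). dist f g < e})"

definition open_L2 :: "'a L2 set \<Rightarrow> bool" where
  "open_L2 U \<longleftrightarrow> (\<forall>f\<in>U. \<forall>\<^sub>F (f', g) in uniformity. f' = f \<longrightarrow> g \<in> U)"

instance
proof
  fix f g h :: "'a L2" and a b :: real
  show "f + g + h = f + (g + h)"
    by transfer (auto intro!: sq_integrable_add simp: ac_simps)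
  show "f + g = g + f"
    by transfer (auto intro!: sq_integrable_add simp: ac_simps)
  show "0 + f = f" by transfer auto
  show "- f + f = 0" by transfer (auto simp: sq_integrable_zero)
  show "f - g = f + - g" by transfer (auto intro: sq_integrable_diff)
  show "a *\<^sub>R (f + g) = a *\<^sub>R f + a *\<^sub>R g"
    by transfer (auto simp: scaleR_add_right intro!: sq_integrable_add
        sq_integrable_bounded_linear[OF bounded_linear_scaleR_right])
  show "(a + b) *\<^sub>R f = a *\<^sub>R f + b *\<^sub>R f"
    by transfer (auto simp: scaleR_add_left intro!: sq_integrable_add
        sq_integrable_bounded_linear[OF bounded_linear_scaleR_right])
  show "a *\<^sub>R b *\<^sub>R f = (a * b) *\<^sub>R f"
    by transfer (auto intro: sq_integrable_bounded_linear[OF bounded_linear_scaleR_right])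
  show "1 *\<^sub>R f = f" by transfer auto
  show "dist f g = norm (f - g)" by (rule dist_L2_def)
  show "sgn f = inverse (norm f) *\<^sub>R f" by (rule sgn_L2_def)
  show "uniformity = (INF e\<in>{0<..}. principal {(f, g :: 'a L2). dist f g < e})"
    by (rule uniformity_L2_def)
  show "open U \<longleftrightarrow> (\<forall>f\<in>U. \<forall>\<^sub>F (f', g) in uniformity. f' = f \<longrightarrow> g \<in> U)" for U :: "'a L2 set"
    by (rule open_L2_def)
  show "inner f g = inner g f" by transfer (simp add: inner_commute)
  show "inner (f + g) h = inner f h + inner g h"
    by transfer (simp add: inner_add_left integrable_inner_L2)
  show "inner (a *\<^sub>R f) g = a * inner f g"
    by transfer simp
  show "0 \<le> inner f f"
    by transfer (simp add: Bochner_Integration.integral_nonneg)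
  show "inner f f = 0 \<longleftrightarrow> f = 0"
  proof transfer
    fix f :: "real \<Rightarrow> 'a"
    assume f: "sq_integrable f \<and> sq_integrable f \<and> (AE x in lborel. f x = f x)"
    then have "(LINT x|lborel. inner (f x) (f x)) = 0 \<longleftrightarrow> (AE x in lborel. inner (f x) (f x) = 0)"
      by (intro integral_nonneg_eq_0_iff_AE integrable_inner_L2) auto
    with f show "(LINT x|lborel. inner (f x) (f x)) = 0 \<longleftrightarrow>
        sq_integrable f \<and> sq_integrable (\<lambda>x. 0::'a) \<and> (AE x in lborel. f x = 0)"
      by (simp add: sq_integrable_zero)
  qed
  show "norm f = sqrt (inner f f)" by (rule norm_L2_def)
qed

end

lemma bounded_linear_cmult_vec: "bounded_linear (\<lambda>v::complex^'n. c *s v)"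
  by (intro linear_conv_bounded_linear[THEN iffD1] linearI)
     (auto simp: vec_eq_iff algebra_simps)

lemma bounded_linear_cmatrix: "bounded_linear (\<lambda>v::complex^'n. (M::complex^'n^'m) *v v)"
  by (intro linear_conv_bounded_linear[THEN iffD1] linearI)
     (auto simp: vec_eq_iff matrix_vector_mult_def sum.distrib scaleR_sum_right algebra_simps)

text \<open>The type class structure of \<open>L2\<close> is real, so multiplication by complex scalars is
  introduced separately, for values in \<open>\<complex>\<close> and in \<open>\<complex>\<^sup>n\<close>.\<close>

lift_definition cmul :: "complex \<Rightarrow> complex L2 \<Rightarrow> complex L2" (infixr "*\<^sub>1" 75)
  is "\<lambda>c f x. c * f x"
  by (auto intro: sq_integrable_bounded_linear[OF bounded_linear_mult_right] elim: eventually_mono)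

lift_definition cmul_vec :: "complex \<Rightarrow> (complex^'n) L2 \<Rightarrow> (complex^'n) L2" (infixr "*\<^sub>n" 75)
  is "\<lambda>c f x. c *s f x"
  by (auto intro: sq_integrable_bounded_linear[OF bounded_linear_cmult_vec] elim: eventually_mono)

lift_definition component :: "(complex^'n) L2 \<Rightarrow> 'n \<Rightarrow> complex L2" (infixl "$\<^sub>L" 90)
  is "\<lambda>f i x. f x $ i"
  by (auto intro: sq_integrable_bounded_linear[OF bounded_linear_vec_nth] elim: eventually_mono)

lemma sq_integrable_vector3:
  fixes f g h :: "real \<Rightarrow> complex"
  assumes "sq_integrable f" "sq_integrable g" "sq_integrable h"
  shows "sq_integrable (\<lambda>x. vector [f x, g x, h x] :: complex^3)"
proof -
  have ax: "bounded_linear (axis i :: complex \<Rightarrow> complex^3)" for i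
    by (intro linear_conv_bounded_linear[THEN iffD1] linearI) (auto simp: vec_eq_iff axis_def)
  have "(vector [a, b, c] :: complex^3) = axis 1 a + axis 2 b + axis 3 c" for a b c
    by (simp add: vec_eq_iff forall_3 axis_def)
  then show ?thesis
    using assms by (simp add: sq_integrable_add sq_integrable_bounded_linear[OF ax])
qed

lift_definition vec3_L2 :: "complex L2 \<Rightarrow> complex L2 \<Rightarrow> complex L2 \<Rightarrow> (complex^3) L2"
  is "\<lambda>f g h x. vector [f x, g x, h x]"
  by (auto intro: sq_integrable_vector3)

section \<open>Weak derivatives and \<open>H\<^sup>1(\<real>, \<complex>)\<close>\<close>

definition test_function :: "(real \<Rightarrow> real) \<Rightarrow> bool" where
  "test_function \<phi> \<longleftrightarrow>
     (\<forall>n x. (deriv ^^ n) \<phi> field_differentiable at x) \<and> compact (closure {x. \<phi> x \<noteq> 0})"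

lift_definition is_weak_deriv :: "complex L2 \<Rightarrow> complex L2 \<Rightarrow> bool"
  is "\<lambda>u g. \<forall>\<phi>. test_function \<phi> \<longrightarrow>
        (LINT x|lborel. u x * of_real (deriv \<phi> x)) = - (LINT x|lborel. g x * of_real (\<phi> x))"
proof -
  fix u v g h :: "real \<Rightarrow> complex"
  assume uv: "sq_integrable u \<and> sq_integrable v \<and> (AE x in lborel. u x = v x)"
    and gh: "sq_integrable g \<and> sq_integrable h \<and> (AE x in lborel. g x = h x)"
  have "(LINT x|lborel. u x * of_real (deriv \<phi> x)) = (LINT x|lborel. v x * of_real (deriv \<phi> x))"
    "(LINT x|lborel. g x * of_real (\<phi> x)) = (LINT x|lborel. h x * of_real (\<phi> x))"
    if \<phi>: "test_function \<phi>" for \<phi>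
  proof -
    have [measurable]: "(deriv ^^ n) \<phi> \<in> borel_measurable lborel" for n
      using \<phi> unfolding test_function_def
      by (auto intro!: borel_measurable_continuous_onI continuous_at_imp_continuous_on
          field_differentiable_imp_continuous_at)
    have [measurable]: "\<phi> \<in> borel_measurable borel" "deriv \<phi> \<in> borel_measurable borel"
      using \<open>(deriv ^^ 0) \<phi> \<in> _\<close> \<open>(deriv ^^ 1) \<phi> \<in> _\<close> by simp_all
    have [measurable]: "u \<in> borel_measurable borel" "v \<in> borel_measurable borel"
      "g \<in> borel_measurable borel" "h \<in> borel_measurable borel"
      using uv gh by (simp_all add: sq_integrable_def)
    show "(LINT x|lborel. u x * of_real (deriv \<phi> x)) = (LINT x|lborel. v x * of_real (deriv \<phi> x))"
      using uv by (intro integral_cong_AE) (measurable, auto elim: eventually_mono)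
    show "(LINT x|lborel. g x * of_real (\<phi> x)) = (LINT x|lborel. h x * of_real (\<phi> x))"
      using gh by (intro integral_cong_AE) (measurable, auto elim: eventually_mono)
  qed
  then show "(\<forall>\<phi>. test_function \<phi> \<longrightarrow>
        (LINT x|lborel. u x * of_real (deriv \<phi> x)) = - (LINT x|lborel. g x * of_real (\<phi> x))) =
      (\<forall>\<phi>. test_function \<phi> \<longrightarrow>
        (LINT x|lborel. v x * of_real (deriv \<phi> x)) = - (LINT x|lborel. h x * of_real (\<phi> x)))"
    by simp
qed

definition H1 :: "complex L2 set" where
  "H1 = {u. \<exists>g. is_weak_deriv u g}"

text \<open>The weak derivative is unique as an element of \<open>L\<^sup>2\<close>; the value is only used on \<open>H1\<close>.\<close>

definition weak_deriv :: "complex L2 \<Rightarrow> complex L2" where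
  "weak_deriv u = (THE g. is_weak_deriv u g)"

section \<open>Resolvent set of an operator in \<open>L\<^sup>2(\<real>, \<complex>\<^sup>n)\<close>\<close>

text \<open>The operator \<open>T\<close> has domain \<open>D\<close> (its values outside \<open>D\<close> are irrelevant). For a
  complex-linear \<open>T\<close> the inverse is automatically complex linear, so real
  \<^const>\<open>bounded_linear\<close> expresses that it is a bounded operator.\<close>

definition resolvent_set ::
    "(complex^'n) L2 set \<Rightarrow> ((complex^'n) L2 \<Rightarrow> (complex^'n) L2) \<Rightarrow> complex set" where
  "resolvent_set D T = {z. bij_betw (\<lambda>u. T u - z *\<^sub>n u) D UNIV \<and>
                          bounded_linear (inv_into D (\<lambda>u. T u - z *\<^sub>n u))}"

section \<open>The operator pencil\<close>

definition dom_A :: "(complex^3) L2 set" where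
  "dom_A = {u. u $\<^sub>L 2 \<in> H1 \<and> u $\<^sub>L 3 \<in> H1}"

definition op_A :: "real \<Rightarrow> (complex^3) L2 \<Rightarrow> (complex^3) L2" where
  "op_A k u = vec3_L2
     ((\<i> * of_real k) *\<^sub>1 (u $\<^sub>L 3))
     (- weak_deriv (u $\<^sub>L 3))
     (- (\<i> * of_real k) *\<^sub>1 (u $\<^sub>L 1) + weak_deriv (u $\<^sub>L 2))"

text \<open>The two-layer potential \<open>V(x, \<omega>)\<close>; its value at the null set \<open>{0}\<close> is immaterial.\<close>

definition V_layers :: "(complex \<Rightarrow> complex) \<Rightarrow> (complex \<Rightarrow> complex) \<Rightarrow> real \<Rightarrow> complex \<Rightarrow> complex" where
  "V_layers Vp Vm x \<omega> = (if 0 < x then Vp \<omega> else Vm \<omega>)"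

definition mat_B :: "(complex \<Rightarrow> complex) \<Rightarrow> (complex \<Rightarrow> complex) \<Rightarrow> real \<Rightarrow> complex \<Rightarrow> complex^3^3" where
  "mat_B Vp Vm x \<omega> = vector
     [vector [\<i> * V_layers Vp Vm x \<omega>, 0, 0],
      vector [0, \<i> * V_layers Vp Vm x \<omega>, 0],
      vector [0, 0, \<i> * \<omega>]]"

lift_definition op_B ::
    "(complex \<Rightarrow> complex) \<Rightarrow> (complex \<Rightarrow> complex) \<Rightarrow> complex \<Rightarrow> (complex^3) L2 \<Rightarrow> (complex^3) L2"
  is "\<lambda>Vp Vm \<omega> u x. mat_B Vp Vm x \<omega> *v u x"
proof -
  fix Vp Vm :: "complex \<Rightarrow> complex" and \<omega> :: complex and u v :: "real \<Rightarrow> complex^3"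
  assume *: "sq_integrable u \<and> sq_integrable v \<and> (AE x in lborel. u x = v x)"
  have "sq_integrable (\<lambda>x. mat_B Vp Vm x \<omega> *v w x)" if w: "sq_integrable w" for w
  proof -
    have "(\<lambda>x. mat_B Vp Vm x \<omega> *v w x) =
        (\<lambda>x. if 0 < x then mat_B Vp Vm 1 \<omega> *v w x else mat_B Vp Vm 0 \<omega> *v w x)"
      by (auto simp: mat_B_def V_layers_def)
    then show ?thesis
      by (simp only:) (intro sq_integrable_If sq_integrable_bounded_linear[OF bounded_linear_cmatrix] w)
  qed
  with * show "sq_integrable (\<lambda>x. mat_B Vp Vm x \<omega> *v u x) \<and>
      sq_integrable (\<lambda>x. mat_B Vp Vm x \<omega> *v v x) \<and>
      (AE x in lborel. mat_B Vp Vm x \<omega> *v u x = mat_B Vp Vm x \<omega> *v v x)"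
    by (auto elim: eventually_mono)
qed

text \<open>The pencil has domain \<^const>\<open>dom_A\<close> for every \<open>\<omega>\<close>.\<close>

definition op_L ::
    "(complex \<Rightarrow> complex) \<Rightarrow> (complex \<Rightarrow> complex) \<Rightarrow> real \<Rightarrow> complex \<Rightarrow> (complex^3) L2 \<Rightarrow> (complex^3) L2" where
  "op_L Vp Vm k \<omega> u = op_A k u - op_B Vp Vm \<omega> u"

definition pencil_point_spectrum ::
    "complex set \<Rightarrow> (complex \<Rightarrow> complex) \<Rightarrow> (complex \<Rightarrow> complex) \<Rightarrow> real \<Rightarrow> complex set" where
  "pencil_point_spectrum \<Omega> Vp Vm k = {\<omega> \<in> \<Omega>. \<exists>u \<in> dom_A - {0}. op_L Vp Vm k \<omega> u = 0}"

definition Omega0 :: "complex set \<Rightarrow> (complex \<Rightarrow> complex) \<Rightarrow> (complex \<Rightarrow> complex) \<Rightarrow> complex set" where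
  "Omega0 \<Omega> Vp Vm = {\<omega> \<in> \<Omega>. \<omega> = 0 \<or> Vp \<omega> = 0 \<or> Vm \<omega> = 0}"

definition isolated_eigenvalue ::
    "complex set \<Rightarrow> (complex \<Rightarrow> complex) \<Rightarrow> (complex \<Rightarrow> complex) \<Rightarrow> real \<Rightarrow> complex \<Rightarrow> bool" where
  "isolated_eigenvalue \<Omega> Vp Vm k \<omega> \<longleftrightarrow>
     \<omega> \<in> pencil_point_spectrum \<Omega> Vp Vm k \<and>
     (\<exists>r>0. \<forall>z. 0 < cmod z \<and> cmod z < r \<longrightarrow> z \<in> resolvent_set dom_A (op_L Vp Vm k \<omega>))"

end

theory Submission
  imports Defs
begin

text \<open>
  For \<open>\<omega>\<close> fixed and \<open>\<plusminus>x > 0\<close> the equation \<open>L\<^sub>k(\<omega>) u - z u = f\<close> determines \<open>u\<^sub>1\<close> algebraically and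
  leaves a first-order system for \<open>(u\<^sub>2, u\<^sub>3)\<close> with the exponents \<open>\<plusminus>\<mu>\<close>, where
  \<open>\<mu>\<^sup>2 = k\<^sup>2 - a (\<i>\<omega> + z)\<close> and \<open>a = \<i>V + z\<close>. An eigenfunction at \<open>z = 0\<close> cannot vanish on either half
  line, by uniqueness for the system, so both exponents have \<open>Re \<mu> > 0\<close> there, and this persists for
  small \<open>z\<close>. Then the inhomogeneous system is solvable in \<open>L\<^sup>2\<close> on both sides, and \<open>z\<close> is in the
  resolvent set as soon as the two decaying solutions are linearly independent at \<open>x = 0\<close>. Their
  determinant can vanish only at finitely many \<open>z\<close>.
\<close>

section \<open>Test functions\<close>

text \<open>The domain is described by weak derivatives of classes of functions, whereas decay,
  matching and linear independence at x = 0 concern point values. The bridge is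
  \<open>is_weak_deriv_iff_AC\<close>, which gives every component in H^1 an absolutely continuous
  representative. Its proof needs a supply of test functions, built explicitly from exp(-1/x). The
  half lines are coupled only through the values of the second and third component at 0, and a
  solution with zero values there vanishes on both sides. This is why one eigenfunction controls the
  exponents of both layers. Staying away from \<open>Omega0\<close> makes a = iV nonzero at z = 0,
  so that the first component can be eliminated near z = 0. At z = 0 itself the determinant does
  vanish, so only a punctured disc can be expected. For fixed \<omega> the potential enters through
  two numbers, and all coefficients are polynomials in z up to the two square roots. Squaring
  removes the roots, and a nonzero polynomial bounds the zero set.\<close>

definition flat_exp :: "nat \<Rightarrow> real \<Rightarrow> real" where
  "flat_exp k x = (if 0 < x then exp (- 1 / x) / x ^ k else 0)"

lemma tendsto_flat_exp_0: "(flat_exp k \<longlongrightarrow> 0) (at 0)"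
proof -
  have "((\<lambda>x. inverse x ^ k / exp (inverse x)) \<longlongrightarrow> (0::real)) (at_right 0)"
    by (rule filterlim_compose[OF tendsto_power_div_exp_0 filterlim_inverse_at_top_right])
  then have r: "(flat_exp k \<longlongrightarrow> 0) (at_right 0)"
    by (rule Lim_transform_eventually)
       (auto simp: eventually_at_right_field flat_exp_def exp_minus field_simps power_inverse
          intro!: exI[of _ 1])
  have "((\<lambda>x. 0) \<longlongrightarrow> (0::real)) (at_left (0::real))" by simp
  then have l: "(flat_exp k \<longlongrightarrow> 0) (at_left 0)"
    by (rule Lim_transform_eventually)
       (auto simp: eventually_at_left_field flat_exp_def intro!: exI[of _ "-1"])
  show ?thesis using l r by (simp add: filterlim_split_at)
qed

text \<open>The powers of 1/x are carried along so that linear combinations of the family are closed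
  under differentiation. At the origin the difference quotient of \<open>flat_exp k\<close> is
  exactly \<open>flat_exp (k + 1)\<close>, so the derivative there is the limit in
  \<open>tendsto_flat_exp_0\<close>.\<close>

lemma DERIV_flat_exp:
  "(flat_exp k has_real_derivative (flat_exp (k + 2) x - k * flat_exp (k + 1) x)) (at x)"
proof -
  consider "x > 0" | "x < 0" | "x = 0" by linarith
  then show ?thesis
  proof cases
    case 1
    let ?f = "\<lambda>x. exp (- 1 / x) * inverse (x ^ k)"
    have "(?f has_real_derivative
        (exp (- 1 / x) / x ^ (k + 2) - k * (exp (- 1 / x) / x ^ (k + 1)))) (at x)"
      using 1 by (auto intro!: derivative_eq_intros simp: field_simps power2_eq_square)
        (cases k; simp add: field_simps)
    moreover have "?f y = flat_exp k y" if "y \<in> {0<..}" for y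
      using that by (simp add: flat_exp_def divide_inverse)
    ultimately show ?thesis
      using 1 has_field_derivative_transform_within_open[of ?f _ x "{0<..}" "flat_exp k"]
      by (simp add: flat_exp_def)
  next
    case 2
    have "flat_exp k y = 0" if "y \<in> {..<0}" for y
      using that by (simp add: flat_exp_def)
    then show ?thesis
      using 2 has_field_derivative_transform_within_open[of "\<lambda>x. 0" 0 x "{..<0}" "flat_exp k"]
      by (simp add: flat_exp_def)
  next
    case 3
    have "(\<lambda>h. (flat_exp k (0 + h) - flat_exp k 0) / h) = flat_exp (k + 1)"
      by (auto simp: flat_exp_def fun_eq_iff field_simps)
    then show ?thesis
      using 3 tendsto_flat_exp_0[of "k + 1"] by (simp add: DERIV_def flat_exp_def)
  qed
qed

text \<open>An algebra closed under \<^const>\<open>deriv\<close>, so that its members are smooth by coinduction.\<close>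

inductive_set flat_algebra :: "(real \<Rightarrow> real) set" where
  const: "(\<lambda>x. c) \<in> flat_algebra"
| base: "(\<lambda>x. flat_exp k (s * x + t)) \<in> flat_algebra"
| add: "f \<in> flat_algebra \<Longrightarrow> g \<in> flat_algebra \<Longrightarrow> (\<lambda>x. f x + g x) \<in> flat_algebra"
| mult: "f \<in> flat_algebra \<Longrightarrow> g \<in> flat_algebra \<Longrightarrow> (\<lambda>x. f x * g x) \<in> flat_algebra"

lemma flat_algebra_DERIV:
  assumes "f \<in> flat_algebra"
  shows "\<exists>f'\<in>flat_algebra. \<forall>x. (f has_real_derivative f' x) (at x)"
  using assms
proof induction
  case (const c)
  show ?case
    by (rule bexI[OF _ flat_algebra.const[of 0]]) simp
next
  case (base k s t)
  have D: "((\<lambda>x. flat_exp k (s * x + t)) has_real_derivative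
      s * (flat_exp (k + 2) (s * x + t) + (- real k) * flat_exp (k + 1) (s * x + t))) (at x)" for x
    by (rule DERIV_chain2[OF DERIV_flat_exp, THEN DERIV_cong])
       (auto intro!: derivative_eq_intros simp: algebra_simps)
  have M: "(\<lambda>x. s * (flat_exp (k + 2) (s * x + t) + (- real k) * flat_exp (k + 1) (s * x + t))) \<in> flat_algebra"
    by (rule flat_algebra.mult[OF flat_algebra.const flat_algebra.add[OF flat_algebra.base
          flat_algebra.mult[OF flat_algebra.const flat_algebra.base]]])
  show ?case using M D by (intro bexI[where x = "\<lambda>x. s * (flat_exp (k + 2) (s * x + t) + (- real k) * flat_exp (k + 1) (s * x + t))"] allI)
next
  case (add f g)
  then obtain f' g' where f': "f' \<in> flat_algebra" "\<And>x. (f has_real_derivative f' x) (at x)"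
    and g': "g' \<in> flat_algebra" "\<And>x. (g has_real_derivative g' x) (at x)" by blast
  have "\<forall>x. ((\<lambda>x. f x + g x) has_real_derivative f' x + g' x) (at x)"
    using f'(2) g'(2) by (intro allI DERIV_add)
  moreover have "(\<lambda>x. f' x + g' x) \<in> flat_algebra"
    by (rule flat_algebra.add[OF f'(1) g'(1)])
  ultimately show ?case
    by - (rule bexI[where x = "\<lambda>x. f' x + g' x"])
next
  case (mult f g)
  then obtain f' g' where f': "f' \<in> flat_algebra" "\<And>x. (f has_real_derivative f' x) (at x)"
    and g': "g' \<in> flat_algebra" "\<And>x. (g has_real_derivative g' x) (at x)" by blast
  have "\<forall>x. ((\<lambda>x. f x * g x) has_real_derivative f' x * g x + g' x * f x) (at x)"
    using f'(2) g'(2) by (intro allI DERIV_mult)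
  moreover have "(\<lambda>x. f' x * g x + g' x * f x) \<in> flat_algebra"
    by (rule flat_algebra.add[OF flat_algebra.mult[OF f'(1) mult.hyps(2)] flat_algebra.mult[OF g'(1) mult.hyps(1)]])
  ultimately show ?case
    by - (rule bexI[where x = "\<lambda>x. f' x * g x + g' x * f x"])
qed

lemma flat_algebra_smooth:
  assumes "f \<in> flat_algebra"
  shows "(deriv ^^ n) f field_differentiable at x"
proof -
  have "deriv g \<in> flat_algebra" if g: "g \<in> flat_algebra" for g
  proof -
    obtain g' where "g' \<in> flat_algebra" "\<forall>x. (g has_real_derivative g' x) (at x)"
      using flat_algebra_DERIV[OF g] by blast
    moreover from this have "deriv g = g'" by (auto simp: fun_eq_iff intro: DERIV_imp_deriv)
    ultimately show ?thesis by simp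
  qed
  then have "(deriv ^^ n) f \<in> flat_algebra"
    using assms by (induction n) auto
  from flat_algebra_DERIV[OF this] show ?thesis
    by (auto simp: field_differentiable_def)
qed

section \<open>Smooth bumps supported in an interval\<close>

definition bump :: "real \<Rightarrow> real \<Rightarrow> nat \<Rightarrow> real \<Rightarrow> real" where
  "bump a b n x = flat_exp 0 (n * (x - a)) * flat_exp 0 (n * (b - x))"

lemma flat_exp_0_bounds: "0 \<le> flat_exp 0 x" "flat_exp 0 x \<le> 1"
  by (auto simp: flat_exp_def)

lemma bump_bounds: "0 \<le> bump a b n x" "bump a b n x \<le> 1"
  using flat_exp_0_bounds by (auto simp: bump_def intro: mult_le_one)

lemma bump_eq_0: "x \<notin> {a<..<b} \<Longrightarrow> bump a b n x = 0"
  by (auto simp: bump_def flat_exp_def zero_less_mult_iff)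

lemma test_function_bump: "test_function (bump a b n)"
proof -
  have "bump a b n = (\<lambda>x::real. flat_exp 0 (real n * x + (- real n * a)) * flat_exp 0 ((- real n) * x + real n * b))"
    by (auto simp: bump_def fun_eq_iff algebra_simps)
  then have "bump a b n \<in> flat_algebra"
    by (simp only:) (rule flat_algebra.mult[OF flat_algebra.base flat_algebra.base])
  moreover have "bounded {x. bump a b n x \<noteq> 0}"
  proof (rule bounded_subset)
    show "bounded {a..b}" by simp
    show "{x. bump a b n x \<noteq> 0} \<subseteq> {a..b}"
    proof
      fix x assume "x \<in> {x. bump a b n x \<noteq> 0}"
      then have "x \<in> {a<..<b}" using bump_eq_0[of x a b n] by blast
      then show "x \<in> {a..b}" by simp
    qed
  qed
  ultimately show ?thesis
    by (auto simp: test_function_def flat_algebra_smooth)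
qed

text \<open>For positive n the support is always [a, b]. Enlarging n only steepens the flanks, since
  exp(-1/(n d)) tends to 1 for each distance d > 0 from an endpoint.\<close>

lemma bump_tendsto_indicator: "(\<lambda>n. bump a b n x) \<longlonglongrightarrow> indicator {a<..<b} x"
proof (cases "x \<in> {a<..<b}")
  case True
  have *: "(\<lambda>n. flat_exp 0 (real n * d)) \<longlonglongrightarrow> 1" if "d > 0" for d
  proof -
    have "(\<lambda>n. exp (- (1 / d) * (1 / real n))) \<longlonglongrightarrow> exp (- (1 / d) * 0)"
      by (intro tendsto_intros lim_1_over_n)
    then have "(\<lambda>n. exp (- (1 / d) * (1 / real n))) \<longlonglongrightarrow> 1" by simp
    then show ?thesis
      by (rule Lim_transform_eventually)
         (use that in \<open>auto simp: flat_exp_def field_simps eventually_sequentially intro!: exI[of _ 1]\<close>)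
  qed
  show ?thesis
    unfolding bump_def using True tendsto_mult[OF *[of "x - a"] *[of "b - x"]] by simp
qed (simp add: bump_eq_0)

section \<open>Support, linear combinations and primitives of test functions\<close>

lemma test_function_bounded_support:
  assumes "test_function \<phi>"
  obtains R where "R > 0" "\<And>x. R \<le> \<bar>x\<bar> \<Longrightarrow> \<phi> x = 0"
proof -
  have "bounded {x. \<phi> x \<noteq> 0}"
    using assms by (simp add: test_function_def)
  then obtain B where B: "\<And>x. \<phi> x \<noteq> 0 \<Longrightarrow> \<bar>x\<bar> \<le> B"
    by (auto simp: bounded_iff)
  show ?thesis
    by (rule that[of "\<bar>B\<bar> + 1"]) (use B in \<open>auto, force\<close>)
qed

lemma test_function_DERIV:
  assumes "test_function \<phi>"
  shows "(\<phi> has_real_derivative deriv \<phi> x) (at x)"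
proof -
  have "(deriv ^^ 0) \<phi> field_differentiable at x"
    using assms unfolding test_function_def by blast
  then show ?thesis by (simp add: field_differentiable_derivI)
qed

lemma test_function_continuous:
  assumes "test_function \<phi>"
  shows "continuous_on S \<phi>" "continuous_on S (deriv \<phi>)"
proof -
  have "(deriv ^^ n) \<phi> field_differentiable at x" for n x
    using assms unfolding test_function_def by blast
  from this[of 0] this[of 1] show "continuous_on S \<phi>" "continuous_on S (deriv \<phi>)"
    by (auto intro!: continuous_at_imp_continuous_on field_differentiable_imp_continuous_at)
qed

lemma test_function_deriv_eq_0:
  assumes "test_function \<phi>" "\<And>x. R \<le> \<bar>x\<bar> \<Longrightarrow> \<phi> x = 0" "R < \<bar>x\<bar>"
  shows "deriv \<phi> x = 0"
proof -
  have "open {y::real. R < \<bar>y\<bar>}" by (intro open_Collect_less continuous_intros)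
  moreover have "0 = \<phi> y" if "y \<in> {y. R < \<bar>y\<bar>}" for y
    using assms(2)[of y] that by simp
  ultimately have "(\<phi> has_real_derivative 0) (at x)"
    using assms(3) has_field_derivative_transform_within_open[of "\<lambda>x. 0" 0 x "{y. R < \<bar>y\<bar>}" \<phi>]
    by simp
  then show ?thesis by (rule DERIV_imp_deriv)
qed

lemma test_function_linear:
  assumes "test_function \<phi>" "test_function \<psi>"
  shows "test_function (\<lambda>x. \<phi> x - c * \<psi> x)"
proof -
  have fd: "(deriv ^^ n) \<phi> field_differentiable at x" "(deriv ^^ n) \<psi> field_differentiable at x" for n x
    using assms by (simp_all add: test_function_def)
  have eq: "(deriv ^^ n) (\<lambda>x. \<phi> x - c * \<psi> x) = (\<lambda>x. (deriv ^^ n) \<phi> x - c * (deriv ^^ n) \<psi> x)" for n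
  proof (induction n)
    case (Suc n)
    have D: "((\<lambda>x. (deriv ^^ n) \<phi> x - c * (deriv ^^ n) \<psi> x) has_real_derivative
        deriv ((deriv ^^ n) \<phi>) x - c * deriv ((deriv ^^ n) \<psi>) x) (at x)" for x
      using fd[of n x, THEN field_differentiable_derivI] by (auto intro!: derivative_eq_intros)
    show ?case
      unfolding funpow.simps o_apply Suc by (rule ext) (rule DERIV_imp_deriv[OF D])
  qed simp
  have "bounded ({x. \<phi> x \<noteq> 0} \<union> {x. \<psi> x \<noteq> 0})"
    using assms by (simp add: test_function_def)
  then have "bounded {x. \<phi> x - c * \<psi> x \<noteq> 0}"
    by (rule bounded_subset) auto
  moreover have "(deriv ^^ n) (\<lambda>x. \<phi> x - c * \<psi> x) field_differentiable at x" for n x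
    unfolding eq using fd by (intro derivative_intros)
  ultimately show ?thesis by (simp add: test_function_def)
qed

lemma integrable_test_function:
  assumes "test_function \<phi>"
  shows "integrable lborel \<phi>"
proof -
  obtain R where R: "R > 0" "\<And>x. R \<le> \<bar>x\<bar> \<Longrightarrow> \<phi> x = 0"
    using test_function_bounded_support[OF assms] by blast
  have "set_integrable lborel {-R..R} \<phi>"
    by (intro borel_integrable_atLeastAtMost') (rule test_function_continuous[OF assms])
  moreover have "indicator {-R..R} x *\<^sub>R \<phi> x = \<phi> x" for x
    using R(2)[of x] by (cases "R \<le> \<bar>x\<bar>") (auto simp: indicator_def)
  ultimately show ?thesis by (simp only: set_integrable_def)
qed

text \<open>The vanishing integral is what brings the primitive started at -R back to 0 beyond R, so
  that it has compact support again.\<close>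

lemma test_function_primitive:
  assumes \<phi>: "test_function \<phi>" and zero: "(LINT x|lborel. \<phi> x) = 0"
  obtains \<Phi> where "test_function \<Phi>" "deriv \<Phi> = \<phi>"
proof -
  obtain R where R: "R > 0" "\<And>x. R \<le> \<bar>x\<bar> \<Longrightarrow> \<phi> x = 0"
    using test_function_bounded_support[OF \<phi>] by blast
  define \<Phi> where "\<Phi> x = (LBINT t=-R..x. \<phi> t)" for x
  have D: "(\<Phi> has_real_derivative \<phi> x) (at x)" for x
  proof -
    \<comment> \<open>A and B leave room on both sides of x, so the derivative within [A, B] is
      two-sided, while -R also stays inside.\<close>
    define A B where "A = min (-R) x - 1" and "B = max (-R) x + 1"
    have "((\<lambda>u. LBINT t=-R..u. \<phi> t) has_vector_derivative \<phi> x) (at x within {A..B})"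
      by (rule interval_integral_FTC2[of A])
         (auto simp: A_def B_def test_function_continuous[OF \<phi>])
    moreover have "at x within {A..B} = at x"
      by (rule at_within_interior) (auto simp: A_def B_def)
    ultimately show ?thesis
      by (simp add: \<Phi>_def[abs_def] has_real_derivative_iff_has_vector_derivative)
  qed
  then have d: "deriv \<Phi> = \<phi>"
    by (auto simp: fun_eq_iff intro: DERIV_imp_deriv)
  have "\<Phi> x = 0" if x: "\<not> \<bar>x\<bar> \<le> R" for x
  proof (cases "x > R")
    case True
    have "\<Phi> x = (LINT t:{-R..x}|lborel. \<phi> t)"
      using True R(1) unfolding \<Phi>_def by (subst interval_integral_Icc) auto
    also have "\<dots> = (LINT t|lborel. \<phi> t)"
      unfolding set_lebesgue_integral_def
    proof (intro Bochner_Integration.integral_cong refl)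
      fix t show "indicator {-R..x} t *\<^sub>R \<phi> t = \<phi> t"
        using R(2)[of t] True by (cases "R \<le> \<bar>t\<bar>") (auto simp: indicator_def)
    qed
    finally show ?thesis using zero by simp
  next
    case False
    then have "\<Phi> x = - (LINT t:{x..-R}|lborel. \<phi> t)"
      using x unfolding \<Phi>_def
      by (subst interval_integral_endpoints_reverse, subst interval_integral_Icc) auto
    also have "(LINT t:{x..-R}|lborel. \<phi> t) = 0"
      unfolding set_lebesgue_integral_def
      using R by (intro integral_eq_zero_AE AE_I2) (auto simp: indicator_def)
    finally show ?thesis by simp
  qed
  then have "bounded {x. \<Phi> x \<noteq> 0}"
    by (auto simp: bounded_iff)
  moreover have "(deriv ^^ n) \<Phi> field_differentiable at x" for n x
  proof (cases n)
    case 0 then show ?thesis using D by (auto simp: field_differentiable_def)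
  next
    case (Suc m)
    then have "(deriv ^^ n) \<Phi> = (deriv ^^ m) \<phi>"
      by (simp add: funpow_Suc_right d del: funpow.simps)
    then show ?thesis using \<phi> unfolding test_function_def by simp
  qed
  ultimately show ?thesis using that[of \<Phi>] d by (simp add: test_function_def)
qed

section \<open>The fundamental lemma of the calculus of variations\<close>

text \<open>Multiplication by an exponential integrating factor leads out of L^2; local
  integrability survives every continuous factor.\<close>

definition loc_integrable :: "(real \<Rightarrow> 'a::euclidean_space) \<Rightarrow> bool" where
  "loc_integrable f \<longleftrightarrow> f \<in> borel_measurable borel \<and> (\<forall>a b. set_integrable lborel {a..b} f)"

lemma loc_integrable_set_integrable:
  "loc_integrable h \<Longrightarrow> set_integrable lborel {a<..<b} h"
  by (auto intro: set_integrable_subset[of _ "{a..b}"] simp: loc_integrable_def)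

text \<open>On a bounded interval the positive and negative parts of h are densities of two finite
  measures. The hypothesis makes these agree on all rays, hence everywhere, so the densities agree
  almost everywhere. At each point one of the two parts is zero, so both are.\<close>

lemma AE_zero_if_interval_integrals_zero_real:
  fixes h :: "real \<Rightarrow> real"
  assumes h: "loc_integrable h" and zero: "\<And>a b. a < b \<Longrightarrow> (LINT x:{a<..<b}|lborel. h x) = 0"
  shows "AE x in lborel. h x = 0"
proof -
  have [measurable]: "h \<in> borel_measurable borel" using h by (simp add: loc_integrable_def)
  have "AE x in lborel. x \<in> {- real N<..<real N} \<longrightarrow> h x = 0" for N :: nat
  proof -
    let ?I = "{- real N<..<real N}"
    define p m where "p x = max 0 (h x) * indicator ?I x" and "m x = max 0 (- h x) * indicator ?I x" for x
    have [measurable]: "p \<in> borel_measurable borel" "m \<in> borel_measurable borel"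
      unfolding p_def m_def by measurable
    have "set_integrable lborel ?I h"
      using h by (rule loc_integrable_set_integrable)
    then have hI: "integrable lborel (\<lambda>x. indicator ?I x * h x)"
      by (simp add: set_integrable_def)
    have ip: "integrable lborel p" "integrable lborel m"
      by (rule Bochner_Integration.integrable_bound[OF hI];
          auto simp: p_def m_def indicator_def)+
    have nn: "p x \<ge> 0" "m x \<ge> 0" for x by (auto simp: p_def m_def)
    have em: "emeasure (density lborel (\<lambda>x. ennreal (f x))) {y<..} = ennreal (LINT x|lborel. f x * indicator {y<..} x)"
      if f: "integrable lborel f" "\<And>x. f x \<ge> 0" "f \<in> borel_measurable borel" for f :: "real \<Rightarrow> real" and y
    proof -
      have "emeasure (density lborel (\<lambda>x. ennreal (f x))) {y<..} = (\<integral>\<^sup>+x. ennreal (f x * indicator {y<..} x) \<partial>lborel)"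
        using f by (subst emeasure_density) (auto intro!: nn_integral_cong simp: indicator_def)
      also have "\<dots> = ennreal (LINT x|lborel. f x * indicator {y<..} x)"
        using f by (intro nn_integral_eq_integral integrable_real_mult_indicator) auto
      finally show ?thesis .
    qed
    have "density lborel (\<lambda>x. ennreal (p x)) = density lborel (\<lambda>x. ennreal (m x))"
    proof (rule measure_eqI_lessThan)
      fix y :: real
      show "emeasure (density lborel (\<lambda>x. ennreal (p x))) {y<..} < \<infinity>"
        using em[OF ip(1)] nn by simp
      have "(LINT x|lborel. p x * indicator {y<..} x) - (LINT x|lborel. m x * indicator {y<..} x)
          = (LINT x|lborel. p x * indicator {y<..} x - m x * indicator {y<..} x)"
        using ip by (intro Bochner_Integration.integral_diff[symmetric] integrable_real_mult_indicator) auto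
      \<comment> \<open>Cutting at N turns the ray into a bounded interval covered by the
        hypothesis, or into the empty set.\<close>
      also have "\<dots> = (LINT x:{max y (- real N)<..<real N}|lborel. h x)"
        unfolding set_lebesgue_integral_def
        by (intro Bochner_Integration.integral_cong) (auto simp: p_def m_def indicator_def)
      also have "\<dots> = 0"
        using zero[of "max y (- real N)" "real N"]
        by (cases "max y (- real N) < real N") (auto simp: set_lebesgue_integral_def)
      finally show "emeasure (density lborel (\<lambda>x. ennreal (p x))) {y<..} =
          emeasure (density lborel (\<lambda>x. ennreal (m x))) {y<..}"
        using em[OF ip(1)] em[OF ip(2)] nn by simp
    qed auto
    moreover have "(\<integral>\<^sup>+x. ennreal (p x) \<partial>lborel) \<noteq> \<infinity>"
      using ip nn by (subst nn_integral_eq_integral) auto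
    ultimately have "AE x in lborel. ennreal (p x) = ennreal (m x)"
      by (subst (asm) finite_density_unique) auto
    then show ?thesis
      by eventually_elim (use nn in \<open>auto simp: p_def m_def max_def split: if_splits\<close>)
  qed
  then have "AE x in lborel. \<forall>N::nat. x \<in> {- real N<..<real N} \<longrightarrow> h x = 0"
    unfolding AE_all_countable by blast
  then show ?thesis
  proof eventually_elim
    case (elim x)
    obtain N :: nat where "\<bar>x\<bar> < real N" using reals_Archimedean2 by blast
    then show ?case using elim[rule_format, of N] by (auto simp: abs_less_iff)
  qed
qed

lemma AE_zero_if_interval_integrals_zero:
  fixes h :: "real \<Rightarrow> complex"
  assumes h: "loc_integrable h" and zero: "\<And>a b. a < b \<Longrightarrow> (LINT x:{a<..<b}|lborel. h x) = 0"
  shows "AE x in lborel. h x = 0"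
proof -
  have hi: "set_integrable lborel {a<..<b} h" for a b
    using h by (rule loc_integrable_set_integrable)
  have *: "loc_integrable (\<lambda>x. T (h x))"
    "(LINT x:{a<..<b}|lborel. T (h x)) = T (LINT x:{a<..<b}|lborel. h x)"
    if T: "bounded_linear T" "T \<in> borel_measurable borel" for T :: "complex \<Rightarrow> real" and a b
  proof -
    have s: "T (c *\<^sub>R v) = c * T v" for c v
      using T(1) by (simp add: linear_simps)
    have "integrable lborel (\<lambda>x. T (indicator {a..b} x *\<^sub>R h x))" for a b
      using h by (intro integrable_bounded_linear[OF T(1)])
        (simp add: loc_integrable_def set_integrable_def)
    then show "loc_integrable (\<lambda>x. T (h x))"
      using h measurable_compose[OF _ T(2), of h borel]
      by (simp add: loc_integrable_def set_integrable_def s)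
    show "(LINT x:{a<..<b}|lborel. T (h x)) = T (LINT x:{a<..<b}|lborel. h x)"
      using hi[of a b] integral_bounded_linear[OF T(1), of lborel "\<lambda>x. indicator {a<..<b} x *\<^sub>R h x"]
      by (simp add: set_lebesgue_integral_def set_integrable_def s)
  qed
  have "AE x in lborel. Re (h x) = 0" "AE x in lborel. Im (h x) = 0"
    by (rule AE_zero_if_interval_integrals_zero_real;
        simp add: * bounded_linear_Re bounded_linear_Im zero)+
  then show ?thesis by eventually_elim (simp add: complex_eq_iff)
qed

text \<open>The bumps converge to the indicator of (a, b) and stay below it, so dominated
  convergence turns vanishing against test functions into vanishing integrals over
  intervals.\<close>

lemma fundamental_lemma:
  fixes h :: "real \<Rightarrow> complex"
  assumes h: "loc_integrable h"
    and zero: "\<And>\<phi>. test_function \<phi> \<Longrightarrow> (LINT x|lborel. h x * of_real (\<phi> x)) = 0"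
  shows "AE x in lborel. h x = 0"
proof (rule AE_zero_if_interval_integrals_zero[OF h])
  fix a b :: real assume "a < b"
  have [measurable]: "h \<in> borel_measurable borel" using h by (simp add: loc_integrable_def)
  have [measurable]: "bump a b n \<in> borel_measurable borel" for n
    by (intro borel_measurable_continuous_onI test_function_continuous test_function_bump)
  have i: "integrable lborel (\<lambda>x. indicator {a<..<b} x *\<^sub>R h x)"
    using loc_integrable_set_integrable[OF h] by (simp add: set_integrable_def)
  have "(\<lambda>n. LINT x|lborel. h x * of_real (bump a b n x)) \<longlonglongrightarrow> (LINT x|lborel. h x * of_real (indicator {a<..<b} x))"
  proof (rule integral_dominated_convergence[where w = "\<lambda>x. norm (indicator {a<..<b} x *\<^sub>R h x)"])
    show "AE x in lborel. (\<lambda>n. h x * of_real (bump a b n x)) \<longlonglongrightarrow> h x * of_real (indicator {a<..<b} x)"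
      by (intro AE_I2 tendsto_intros bump_tendsto_indicator)
    show "AE x in lborel. norm (h x * of_real (bump a b n x)) \<le> norm (indicator {a<..<b} x *\<^sub>R h x)" for n
    proof (rule AE_I2)
      fix x
      show "norm (h x * of_real (bump a b n x)) \<le> norm (indicator {a<..<b} x *\<^sub>R h x)"
        using bump_bounds[of a b n x] bump_eq_0[of x a b n]
        by (cases "x \<in> {a<..<b}") (auto simp: norm_mult intro!: mult_left_le)
    qed
    show "integrable lborel (\<lambda>x. norm (indicator {a<..<b} x *\<^sub>R h x))"
      using i by (rule integrable_norm)
  qed measurable
  then have "(LINT x|lborel. h x * of_real (indicator {a<..<b} x)) = 0"
    by (simp add: zero test_function_bump LIMSEQ_const_iff)
  then show "(LINT x:{a<..<b}|lborel. h x) = 0"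
    by (simp add: set_lebesgue_integral_def scaleR_conv_of_real mult.commute)
qed

lemma loc_integrable_mult:
  fixes h e :: "real \<Rightarrow> complex"
  assumes h: "loc_integrable h" and e: "continuous_on UNIV e"
  shows "loc_integrable (\<lambda>x. e x * h x)"
proof -
  have [measurable]: "h \<in> borel_measurable borel" using h by (simp add: loc_integrable_def)
  have [measurable]: "e \<in> borel_measurable borel" using e by (rule borel_measurable_continuous_onI)
  have "set_integrable lborel {a..b} (\<lambda>x. e x * h x)" for a b
  proof -
    have "compact (e ` {a..b})"
      using e by (intro compact_continuous_image) (auto intro: continuous_on_subset)
    then have "bounded (e ` {a..b})" by (rule compact_imp_bounded)
    then obtain C where C: "\<forall>x\<in>{a..b}. norm (e x) \<le> C"
      unfolding bounded_iff by blast
    have "integrable lborel (\<lambda>x. C *\<^sub>R (indicator {a..b} x *\<^sub>R h x))"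
      using h by (intro integrable_scaleR_right) (simp add: loc_integrable_def set_integrable_def)
    then have "integrable lborel (\<lambda>x. indicator {a..b} x *\<^sub>R (e x * h x))"
    proof (rule Bochner_Integration.integrable_bound)
      show "AE x in lborel. norm (indicator {a..b} x *\<^sub>R (e x * h x)) \<le>
          norm (C *\<^sub>R (indicator {a..b} x *\<^sub>R h x))"
      proof (rule AE_I2)
        fix x show "norm (indicator {a..b} x *\<^sub>R (e x * h x)) \<le>
            norm (C *\<^sub>R (indicator {a..b} x *\<^sub>R h x))"
        proof (cases "x \<in> {a..b}")
          case True
          then have "norm (e x) * norm (h x) \<le> \<bar>C\<bar> * norm (h x)"
            using C by (intro mult_right_mono) force+
          then show ?thesis using True by (simp add: norm_mult)
        qed simp
      qed
    qed measurable
    then show ?thesis by (simp only: set_integrable_def)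
  qed
  then show ?thesis by (simp add: loc_integrable_def)
qed

lemma loc_integrable_mult_test:
  fixes h :: "real \<Rightarrow> complex"
  assumes h: "loc_integrable h" and \<phi>: "continuous_on UNIV \<phi>" "\<And>x. R < \<bar>x\<bar> \<Longrightarrow> \<phi> x = 0"
  shows "integrable lborel (\<lambda>x. h x * of_real (\<phi> x))"
proof -
  have "loc_integrable (\<lambda>x. of_real (\<phi> x) * h x)"
    using \<phi>(1) by (intro loc_integrable_mult[OF h] continuous_intros)
  then have "integrable lborel (\<lambda>x. indicator {-R..R} x *\<^sub>R (of_real (\<phi> x) * h x))"
    by (simp only: loc_integrable_def set_integrable_def)
  moreover have "indicator {-R..R} x *\<^sub>R (of_real (\<phi> x) * h x) = h x * of_real (\<phi> x)" for x
    using \<phi>(2)[of x] by (cases "R < \<bar>x\<bar>") (auto simp: indicator_def)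
  ultimately show ?thesis by (simp only:)
qed

text \<open>Modulo a multiple of one fixed \<psi> with nonzero integral, every test function \<eta>
  is the derivative of a test function, because subtracting the right multiple of \<psi> makes the
  integral zero. Hence the hypothesis on derivatives becomes the hypothesis of the fundamental lemma
  for h - c.\<close>

lemma du_Bois_Reymond:
  fixes h :: "real \<Rightarrow> complex"
  assumes h: "loc_integrable h"
    and zero: "\<And>\<phi>. test_function \<phi> \<Longrightarrow> (LINT x|lborel. h x * of_real (deriv \<phi> x)) = 0"
  obtains c where "AE x in lborel. h x = c"
proof -
  define \<psi> where "\<psi> = bump 0 2 1"
  define I where "I = (LINT x|lborel. \<psi> x)"
  have \<psi>: "test_function \<psi>" by (simp add: \<psi>_def test_function_bump)
  have "I \<noteq> 0"
  proof
    assume "I = 0"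
    then have "AE x in lborel. \<psi> x = 0"
      using integral_nonneg_eq_0_iff_AE[OF integrable_test_function[OF \<psi>]]
      by (simp add: I_def \<psi>_def bump_bounds)
    then have "AE x in lborel. x \<notin> {0<..<2::real}"
      by eventually_elim (auto simp: \<psi>_def bump_def flat_exp_def)
    then have "emeasure lborel {0<..<2::real} = 0"
      by (subst (asm) AE_iff_measurable[OF _ refl]) (auto simp: greaterThanLessThan_def greaterThan_def lessThan_def Int_def)
    then show False by simp
  qed
  \<comment> \<open>The only candidate: a constant function c tested against \<psi> gives
    \<open>c * I\<close>.\<close>
  define c where "c = (LINT x|lborel. h x * of_real (\<psi> x)) / of_real I"
  have supp: "integrable lborel (\<lambda>x. f x * of_real (\<eta> x))" if tf: "test_function \<eta>" and lf: "loc_integrable f" for f :: "real \<Rightarrow> complex" and \<eta>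
  proof -
    obtain R where "R > 0" "\<And>x. R \<le> \<bar>x\<bar> \<Longrightarrow> \<eta> x = 0"
      using test_function_bounded_support[OF tf] by blast
    then show ?thesis
      using tf lf by (intro loc_integrable_mult_test[of _ _ R] test_function_continuous) auto
  qed
  have "set_integrable lborel {a..b} (\<lambda>x. c)" for a b :: real
    by (intro borel_integrable_atLeastAtMost') simp
  then have lc: "loc_integrable (\<lambda>x. h x - c)"
    using h by (auto simp: loc_integrable_def)
  have "AE x in lborel. h x - c = 0"
  proof (rule fundamental_lemma[OF lc])
    fix \<eta> assume \<eta>: "test_function \<eta>"
    define J where "J = (LINT x|lborel. \<eta> x)"
    define \<theta> where "\<theta> x = \<eta> x - J / I * \<psi> x" for x
    have "test_function \<theta>"
      unfolding \<theta>_def by (intro test_function_linear \<eta> \<psi>)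
    moreover have "(LINT x|lborel. \<theta> x) = 0"
      using \<open>I \<noteq> 0\<close> integrable_test_function[OF \<eta>] integrable_test_function[OF \<psi>]
      by (simp add: \<theta>_def I_def[symmetric] J_def[symmetric])
    ultimately obtain \<Theta> where \<Theta>: "test_function \<Theta>" "deriv \<Theta> = \<theta>"
      using test_function_primitive by blast
    have "0 = (LINT x|lborel. h x * of_real (\<theta> x))"
      using zero[OF \<Theta>(1)] \<Theta>(2) by simp
    also have "\<dots> = (LINT x|lborel. h x * of_real (\<eta> x) - of_real (J / I) * (h x * of_real (\<psi> x)))"
      by (simp add: \<theta>_def algebra_simps)
    also have "\<dots> = (LINT x|lborel. h x * of_real (\<eta> x)) - of_real (J / I) * (LINT x|lborel. h x * of_real (\<psi> x))"
      using supp[OF \<eta> h] supp[OF \<psi> h] by simp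
    also have "\<dots> = (LINT x|lborel. h x * of_real (\<eta> x)) - c * of_real J"
      using \<open>I \<noteq> 0\<close> by (simp add: c_def)
    also have "c * of_real J = (LINT x|lborel. c * of_real (\<eta> x))"
      by (simp add: J_def)
    also have "(LINT x|lborel. h x * of_real (\<eta> x)) - \<dots> = (LINT x|lborel. h x * of_real (\<eta> x) - c * of_real (\<eta> x))"
      using supp[OF \<eta> h] integrable_test_function[OF \<eta>] by simp
    finally show "(LINT x|lborel. (h x - c) * of_real (\<eta> x)) = 0"
      by (simp add: algebra_simps)
  qed
  then show ?thesis using that by simp
qed

section \<open>Absolutely continuous functions and weak derivatives\<close>

text \<open>The integrated form of y' = g almost everywhere. It does not see null sets in g, as
  suits weak derivatives, and pieces can be glued at a common endpoint. The integral is the gauge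
  integral, which does not yield absolute integrability; \<open>loc_integrable g\<close> is assumed
  separately where that matters.\<close>

definition AC_on :: "real set \<Rightarrow> (real \<Rightarrow> complex) \<Rightarrow> (real \<Rightarrow> complex) \<Rightarrow> bool" where
  "AC_on S y g \<longleftrightarrow> (\<forall>a\<in>S. \<forall>b\<in>S. a \<le> b \<longrightarrow> (g has_integral (y b - y a)) {a..b})"

lemma AC_onD: "AC_on S y g \<Longrightarrow> a \<in> S \<Longrightarrow> b \<in> S \<Longrightarrow> a \<le> b \<Longrightarrow> (g has_integral (y b - y a)) {a..b}"
  by (simp add: AC_on_def)

lemma AC_on_subset: "AC_on S y g \<Longrightarrow> T \<subseteq> S \<Longrightarrow> AC_on T y g"
  by (auto simp: AC_on_def)

lemma AC_on_add:
  assumes "AC_on S y g" "AC_on S z h"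
  shows "AC_on S (\<lambda>x. y x + z x) (\<lambda>x. g x + h x)"
  unfolding AC_on_def
proof (intro ballI impI)
  fix a b assume "a \<in> S" "b \<in> S" "a \<le> b"
  from has_integral_add[OF AC_onD[OF assms(1) this] AC_onD[OF assms(2) this]]
  show "((\<lambda>x. g x + h x) has_integral (y b + z b - (y a + z a))) {a..b}"
    by (simp add: add_diff_add)
qed

lemma AC_on_cmult:
  assumes "AC_on S y g"
  shows "AC_on S (\<lambda>x. c * y x) (\<lambda>x. c * g x)"
  unfolding AC_on_def
proof (intro ballI impI)
  fix a b assume "a \<in> S" "b \<in> S" "a \<le> b"
  from has_integral_mult_right[OF AC_onD[OF assms this], of c]
  show "((\<lambda>x. c * g x) has_integral (c * y b - c * y a)) {a..b}"
    by (simp add: right_diff_distrib)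
qed

lemma AC_on_lincomb:
  "AC_on S y g \<Longrightarrow> AC_on S z h \<Longrightarrow> AC_on S (\<lambda>x. c * y x + d * z x) (\<lambda>x. c * g x + d * h x)"
  by (intro AC_on_add AC_on_cmult)

lemma AC_on_cong_AE:
  assumes "AC_on S y g" "is_interval S" "AE x in lborel. x \<in> S \<longrightarrow> g x = h x"
  shows "AC_on S y h"
  unfolding AC_on_def
proof (intro ballI impI)
  fix a b assume ab: "a \<in> S" "b \<in> S" "a \<le> b"
  have "{a..b} \<subseteq> S"
    using assms(2) ab unfolding is_interval_1 by (meson atLeastAtMost_iff subsetI)
  then have "AE x\<in>{a..b} in lborel. g x = h x"
    using assms(3) by (auto elim!: eventually_mono)
  then show "(h has_integral (y b - y a)) {a..b}"
    using has_integral_AE AC_onD[OF assms(1) ab] by blast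
qed

lemma AC_on_cong:
  assumes "AC_on S y g" "is_interval S" "\<And>x. x \<in> S \<Longrightarrow> y x = z x" "\<And>x. x \<in> S \<Longrightarrow> g x = h x"
  shows "AC_on S z h"
proof -
  have "AC_on S y h"
    by (rule AC_on_cong_AE[OF assms(1,2)]) (simp add: assms(4))
  then show ?thesis using assms(3) by (simp add: AC_on_def)
qed

text \<open>Both halves speak of one and the same y, so the matching of the two values at 0 is built
  into the hypotheses.\<close>

lemma AC_on_glue:
  assumes "AC_on {0..} y g" "AC_on {..0} y g"
  shows "AC_on UNIV y g"
  unfolding AC_on_def
proof (intro ballI impI)
  fix a b :: real assume "a \<le> b"
  consider "a \<ge> 0" | "b \<le> 0" | "a \<le> 0" "0 \<le> b" using \<open>a \<le> b\<close> by linarith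
  then show "(g has_integral (y b - y a)) {a..b}"
  proof cases
    case 1
    then show ?thesis using \<open>a \<le> b\<close> by (intro AC_onD[OF assms(1)]) simp_all
  next
    case 2
    then show ?thesis using \<open>a \<le> b\<close> by (intro AC_onD[OF assms(2)]) simp_all
  next
    case 3
    have "(g has_integral (y 0 - y a) + (y b - y 0)) {a..b}"
      using 3 by (intro has_integral_combine[where c = 0] AC_onD[OF assms(1)] AC_onD[OF assms(2)]) auto
    then show ?thesis by simp
  qed
qed

lemma AC_on_reflect:
  assumes "AC_on S y g"
  shows "AC_on (uminus ` S) (\<lambda>x. y (- x)) (\<lambda>x. - g (- x))"
  unfolding AC_on_def
proof (intro ballI impI)
  fix a b assume "a \<in> uminus ` S" "b \<in> uminus ` S" "a \<le> b"
  then have "(g has_integral (y (- a) - y (- b))) {- b..- a}"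
    by (intro AC_onD[OF assms]) auto
  then have "((\<lambda>x. g (- x)) has_integral (y (- a) - y (- b))) {a..b}"
    using has_integral_reflect_real[of g "y (- a) - y (- b)" "- a" "- b"] by simp
  from has_integral_neg[OF this]
  show "((\<lambda>x. - g (- x)) has_integral (y (- b) - y (- a))) {a..b}" by simp
qed

lemma AC_on_UNIV_continuous:
  assumes "AC_on UNIV y g"
  shows "continuous_on UNIV y"
proof (intro continuous_at_imp_continuous_on ballI)
  fix x :: real
  have "continuous_on {x - 1..x + 1} (\<lambda>t. y (x - 1) + integral {x - 1..t} g)"
    using AC_onD[OF assms, of "x - 1" "x + 1"]
    by (intro continuous_intros indefinite_integral_continuous_1) (auto simp: integrable_on_def)
  moreover have "y (x - 1) + integral {x - 1..t} g = y t" if "t \<in> {x - 1..x + 1}" for t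
    using AC_onD[OF assms, of "x - 1" t] that by (simp add: integral_unique)
  ultimately have "continuous_on {x - 1..x + 1} y"
    by (rule continuous_on_eq)
  then have "continuous_on {x - 1<..<x + 1} y"
    by (rule continuous_on_subset) auto
  then show "isCont y x"
    by (simp add: continuous_on_eq_continuous_at)
qed

section \<open>The product rule for absolutely continuous functions\<close>

lemma has_integral_norm_le:
  fixes f :: "'n::euclidean_space \<Rightarrow> 'a::euclidean_space"
  assumes "(f has_integral i) S" "(g has_integral j) S" "\<And>x. x \<in> S \<Longrightarrow> norm (f x) \<le> g x"
  shows "norm i \<le> j"
  using integral_norm_bound_integral[of f S g] assms
  by (auto simp: integrable_on_def integral_unique)

text \<open>Cut [a, b] into n equal pieces. Each piece contributes at most (b - a)/n times an
  increment of G, and these increments telescope, so the total is of order 1/n.\<close>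

lemma zero_increment_if_superadditive_bound:
  fixes f :: "real \<Rightarrow> 'a::real_normed_vector" and G :: "real \<Rightarrow> real"
  assumes "a \<le> b"
    and bound: "\<And>s t. a \<le> s \<Longrightarrow> s \<le> t \<Longrightarrow> t \<le> b \<Longrightarrow> norm (f t - f s) \<le> (t - s) * (G t - G s)"
  shows "f b = f a"
proof -
  have *: "norm (f b - f a) \<le> (b - a) * (G b - G a) * (1 / real n)" if "n > 0" for n :: nat
  proof -
    define p where "p i = a + (b - a) * (real i / real n)" for i
    have p: "p 0 = a" "p n = b" using that by (auto simp: p_def)
    have step: "p (Suc i) - p i = (b - a) / real n" for i
      by (simp add: p_def add_divide_distrib diff_divide_distrib algebra_simps)
    have le: "p i \<le> p (Suc i)" for i 
      using step[of i] divide_nonneg_nonneg[of "b - a" "real n"] \<open>a \<le> b\<close> by linarith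
    have "norm (f b - f a) = norm (\<Sum>i<n. f (p (Suc i)) - f (p i))"
      by (simp add: sum_lessThan_telescope[of "\<lambda>i. f (p i)" n] p)
    also have "\<dots> \<le> (\<Sum>i<n. (p (Suc i) - p i) * (G (p (Suc i)) - G (p i)))"
    proof (rule sum_norm_le)
      fix i assume "i \<in> {..<n}"
      then have i: "real (Suc i) \<le> real n" by simp
      have "a \<le> p i" using \<open>a \<le> b\<close> by (simp add: p_def)
      moreover have "p (Suc i) \<le> b"
      proof -
        have "(b - a) * (real (Suc i) / real n) \<le> (b - a) * 1"
          using i that \<open>a \<le> b\<close> by (intro mult_left_mono) auto
        then show ?thesis by (simp add: p_def)
      qed
      ultimately show "norm (f (p (Suc i)) - f (p i)) \<le> (p (Suc i) - p i) * (G (p (Suc i)) - G (p i))"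
        using le by (intro bound)
    qed
    also have "\<dots> = (b - a) / real n * (\<Sum>i<n. G (p (Suc i)) - G (p i))"
      by (simp only: step sum_distrib_left)
    also have "\<dots> = (b - a) * (G b - G a) * (1 / real n)"
      by (simp add: sum_lessThan_telescope[of "\<lambda>i. G (p i)" n] p)
    finally show ?thesis .
  qed
  have "(\<lambda>n. (b - a) * (G b - G a) * (1 / real n)) \<longlonglongrightarrow> (b - a) * (G b - G a) * 0"
    by (intro tendsto_intros lim_1_over_n)
  then have "norm (f b - f a) \<le> (b - a) * (G b - G a) * 0"
    by (rule LIMSEQ_le_const) (use * in \<open>auto intro!: exI[of _ 1]\<close>)
  then show ?thesis by simp
qed

lemma loc_integrable_has_integral:
  fixes g :: "real \<Rightarrow> 'a::euclidean_space"
  assumes "loc_integrable g"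
  shows "g absolutely_integrable_on {a..b}"
    "(g has_integral (LINT x:{a..b}|lborel. g x)) {a..b}"
proof -
  have i: "set_integrable lborel {a..b} g" using assms by (simp add: loc_integrable_def)
  then show "g absolutely_integrable_on {a..b}"
    by (simp add: set_integrable_def integrable_completion borel_measurable_integrable)
  show "(g has_integral (LINT x:{a..b}|lborel. g x)) {a..b}"
    using set_borel_integral_eq_integral[OF i] by (simp add: has_integral_integral)
qed

text \<open>On \<open>[s, t]\<close> the defect of the product rule is
  \<open>\<integral> e'(r) (y(t) - y(r)) + (e(s) - e(r)) g(r) dr\<close>, of order \<open>(t - s) \<integral> |g|\<close>; hence it vanishes.\<close>

lemma AC_on_mult:
  assumes y: "AC_on S y g" and S: "is_interval S" and g: "loc_integrable g"
    and e: "\<And>x. (e has_vector_derivative e' x) (at x)" and e': "continuous_on UNIV e'"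
  shows "AC_on S (\<lambda>x. e x * y x) (\<lambda>x. e' x * y x + e x * g x)"
  unfolding AC_on_def
proof (intro ballI impI)
  fix a b assume ab: "a \<in> S" "b \<in> S" "a \<le> b"
  have sub: "{a..b} \<subseteq> S"
    using S ab unfolding is_interval_1 by (meson atLeastAtMost_iff subsetI)
  define k where "k x = e' x * y x + e x * g x" for x
  have ce: "continuous_on UNIV e"
    using e by (auto intro!: continuous_at_imp_continuous_on has_vector_derivative_continuous)
  have yab: "(g has_integral (y t - y s)) {s..t}" if "a \<le> s" "s \<le> t" "t \<le> b" for s t
    using that sub by (intro AC_onD[OF y]) auto
  have gi: "g integrable_on {a..b}" using yab[of a b] ab by (auto simp: integrable_on_def)
  have "continuous_on {a..b} (\<lambda>t. y a + integral {a..t} g)"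
    by (intro continuous_intros indefinite_integral_continuous_1 gi)
  moreover have "y a + integral {a..t} g = y t" if "t \<in> {a..b}" for t
    using yab[of a t] that by (simp add: integral_unique)
  ultimately have cy: "continuous_on {a..b} y" by (rule continuous_on_eq)
  have "(\<lambda>x. e x * g x) integrable_on {a..b}"
    using loc_integrable_has_integral(2)[OF loc_integrable_mult[OF g ce]] by (auto simp: integrable_on_def)
  moreover have "(\<lambda>x. e' x * y x) integrable_on {a..b}"
    by (intro integrable_continuous_interval continuous_intros cy continuous_on_subset[OF e']) auto
  ultimately have ki: "k integrable_on {a..b}"
    unfolding k_def by (intro integrable_add)
  have absg: "(\<lambda>x. norm (g x)) integrable_on {a..b}"
    using loc_integrable_has_integral(1)[OF g] by (simp add: absolutely_integrable_on_def)
  define G where "G t = integral {a..t} (\<lambda>x. norm (g x))" for t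
  have G: "((\<lambda>x. norm (g x)) has_integral (G t - G s)) {s..t}" if st: "a \<le> s" "s \<le> t" "t \<le> b" for s t
  proof -
    have i: "(\<lambda>x. norm (g x)) integrable_on {c..d}" if "a \<le> c" "d \<le> b" for c d
      using that by (intro integrable_on_subinterval[OF absg]) auto
    have "integral {a..s} (\<lambda>x. norm (g x)) + integral {s..t} (\<lambda>x. norm (g x)) = integral {a..t} (\<lambda>x. norm (g x))"
      using st by (intro Henstock_Kurzweil_Integration.integral_combine i) auto
    then have "integral {s..t} (\<lambda>x. norm (g x)) = G t - G s" by (simp add: G_def)
    then show ?thesis using i[of s t] st by (simp add: has_integral_integrable_integral)
  qed
  have "compact (e' ` {a..b})"
    using e' by (intro compact_continuous_image) (auto intro: continuous_on_subset)
  then have "bounded (e' ` {a..b})" by (rule compact_imp_bounded)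
  then obtain M where M: "\<And>x. x \<in> {a..b} \<Longrightarrow> norm (e' x) \<le> M"
    unfolding bounded_iff by blast
  have M0: "0 \<le> M" by (rule order_trans[OF norm_ge_zero M[of a]]) (simp add: ab)
  define z where "z t = e t * y t - integral {a..t} k" for t
  \<comment> \<open>M bounds |e'|. Each of the two terms of the defect is at most M (t - s) times
    the increment of G, whence the factor 2 M.\<close>
  have "z b = z a"
  proof (rule zero_increment_if_superadditive_bound[OF ab(3), where G = "\<lambda>t. 2 * M * G t"])
    fix s t assume st: "a \<le> s" "s \<le> t" "t \<le> b"
    have i1: "(e' has_integral (e d - e c)) {c..d}" if "c \<le> d" for c d
      using that by (intro fundamental_theorem_of_calculus) (auto intro: has_vector_derivative_at_within e)
    have "(k has_integral integral {s..t} k) {s..t}"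
      using integrable_on_subinterval[OF ki, of s t] st by (simp add: has_integral_integral)
    \<comment> \<open>Freezing y at t and e at s gives an integrand whose integral is known exactly:
      it equals \<open>e t * y t - e s * y s\<close>.\<close>
    moreover have "((\<lambda>r. e' r * y t + e s * g r) has_integral ((e t - e s) * y t + e s * (y t - y s))) {s..t}"
      using st by (intro has_integral_add has_integral_mult_left has_integral_mult_right i1 yab)
    ultimately have d: "((\<lambda>r. (e' r * y t + e s * g r) - k r) has_integral
        (((e t - e s) * y t + e s * (y t - y s)) - integral {s..t} k)) {s..t}"
      by (rule has_integral_diff[rotated])
    have dominant: "((\<lambda>r. M * (G t - G s) + M * (t - s) * norm (g r)) has_integral
        (M * (G t - G s) * (t - s) + M * (t - s) * (G t - G s))) {s..t}"
      using has_integral_const_real[of "M * (G t - G s)" s t] st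
      by (intro has_integral_add has_integral_mult_right G) (auto simp: mult.commute)
    have pt: "norm ((e' r * y t + e s * g r) - k r) \<le> M * (G t - G s) + M * (t - s) * norm (g r)"
      if r: "r \<in> {s..t}" for r
    proof -
      have "(e' r * y t + e s * g r) - k r = e' r * (y t - y r) + (e s - e r) * g r"
        by (simp add: k_def algebra_simps)
      moreover have "norm (e' r * (y t - y r)) \<le> M * (G t - G s)"
      proof -
        have "norm (y t - y r) \<le> G t - G r"
          using r st by (intro has_integral_norm_le[OF yab G]) auto
        also have "\<dots> \<le> G t - G s"
          using has_integral_nonneg[OF G[of s r]] r st by simp
        finally show ?thesis
          unfolding norm_mult using M[of r] r st M0 by (intro mult_mono) auto
      qed
      moreover have "norm (e s - e r) \<le> M * (r - s)"
        using has_integral_bound_real[OF M0 finite.emptyI i1[of s r]] M r st by (auto simp: norm_minus_commute)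
      then have "norm (e s - e r) \<le> M * (t - s)"
        using mult_left_mono[OF _ M0, of "r - s" "t - s"] r by auto
      then have "norm ((e s - e r) * g r) \<le> M * (t - s) * norm (g r)"
        unfolding norm_mult by (intro mult_right_mono) auto
      ultimately show ?thesis
        by (metis add_mono norm_triangle_le)
    qed
    have "integral {a..s} k + integral {s..t} k = integral {a..t} k"
      using st by (intro Henstock_Kurzweil_Integration.integral_combine integrable_on_subinterval[OF ki]) auto
    then have "z t - z s = ((e t - e s) * y t + e s * (y t - y s)) - integral {s..t} k"
      by (simp add: z_def algebra_simps)
    also have "norm \<dots> \<le> M * (G t - G s) * (t - s) + M * (t - s) * (G t - G s)"
      by (rule has_integral_norm_le[OF d dominant pt])
    finally show "norm (z t - z s) \<le> (t - s) * (2 * M * G t - 2 * M * G s)"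
      by (simp add: algebra_simps)
  qed
  then have "integral {a..b} k = e b * y b - e a * y a"
    by (simp add: z_def algebra_simps)
  then show "((\<lambda>x. e' x * y x + e x * g x) has_integral (e b * y b - e a * y a)) {a..b}"
    using ki by (simp add: k_def[symmetric] has_integral_integrable_integral)
qed

lemma AC_on_exp_mult:
  fixes l :: complex
  assumes "AC_on S y g" "is_interval S" "loc_integrable g"
  shows "AC_on S (\<lambda>x. exp (l * of_real x) * y x) (\<lambda>x. exp (l * of_real x) * (l * y x + g x))"
proof -
  have "((\<lambda>x. exp (l * of_real x)) has_vector_derivative l * exp (l * of_real x)) (at x)" for x :: real
    by (rule has_vector_derivative_real_field) (auto intro!: derivative_eq_intros)
  then have "AC_on S (\<lambda>x. exp (l * of_real x) * y x)
      (\<lambda>x. l * exp (l * of_real x) * y x + exp (l * of_real x) * g x)"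
    by (intro AC_on_mult[OF assms]) (auto intro!: continuous_intros)
  then show ?thesis by (simp add: algebra_simps)
qed

section \<open>Weak derivatives and absolutely continuous representatives\<close>

lemma sq_integrable_loc_integrable:
  assumes f: "sq_integrable f"
  shows "loc_integrable f"
proof -
  have [measurable]: "f \<in> borel_measurable borel" using f by (simp add: sq_integrable_def)
  have "set_integrable lborel {a..b} f" for a b
    unfolding set_integrable_def
  proof (rule Bochner_Integration.integrable_bound)
    show "integrable lborel (\<lambda>x. indicator {a..b} x + (norm (f x))\<^sup>2 :: real)"
      using f by (intro Bochner_Integration.integrable_add integrable_real_indicator)
        (auto simp: sq_integrable_def emeasure_lborel_Icc_eq)
    show "AE x in lborel. norm (indicator {a..b} x *\<^sub>R f x) \<le> norm (indicator {a..b} x + (norm (f x))\<^sup>2 :: real)"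
    proof (rule AE_I2)
      fix x
      have "norm (f x) \<le> 1 + (norm (f x))\<^sup>2"
        using sum_squares_bound[of "norm (f x)" 1] norm_ge_zero[of "f x"]
        by (simp add: power2_eq_square) (use norm_ge_zero[of "f x"] in linarith)
      then show "norm (indicator {a..b} x *\<^sub>R f x) \<le> norm (indicator {a..b} x + (norm (f x))\<^sup>2 :: real)"
        by (auto simp: indicator_def)
    qed
  qed measurable
  then show ?thesis by (simp add: loc_integrable_def)
qed

lemma continuous_loc_integrable:
  fixes f :: "real \<Rightarrow> 'a::euclidean_space"
  assumes "continuous_on UNIV f"
  shows "loc_integrable f"
  using assms unfolding loc_integrable_def
  by (auto intro!: borel_measurable_continuous_onI borel_integrable_atLeastAtMost'
      intro: continuous_on_subset)

text \<open>The product rule for \<phi> y is integrated over an interval outside which \<phi> and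
  its derivative vanish, so there are no boundary terms.\<close>

lemma AC_on_UNIV_by_parts:
  assumes y: "AC_on UNIV y g" and g: "loc_integrable g" and \<phi>: "test_function \<phi>"
  shows "(LINT x|lborel. y x * of_real (deriv \<phi> x)) = - (LINT x|lborel. g x * of_real (\<phi> x))"
proof -
  obtain R0 where R0: "R0 > 0" "\<And>x. R0 \<le> \<bar>x\<bar> \<Longrightarrow> \<phi> x = 0"
    using test_function_bounded_support[OF \<phi>] by blast
  \<comment> \<open>The derivative is known to vanish only where R0 < |x|; the larger radius covers
    its closed condition as well.\<close>
  define R where "R = R0 + 1"
  have R: "R > 0" "\<And>x. R \<le> \<bar>x\<bar> \<Longrightarrow> \<phi> x = 0" "\<And>x. R \<le> \<bar>x\<bar> \<Longrightarrow> deriv \<phi> x = 0"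
    using R0 test_function_deriv_eq_0[OF \<phi> R0(2)] by (auto simp: R_def)
  have yl: "loc_integrable y"
    by (rule continuous_loc_integrable[OF AC_on_UNIV_continuous[OF y]])
  have i: "integrable lborel (\<lambda>x. y x * of_real (deriv \<phi> x))" "integrable lborel (\<lambda>x. g x * of_real (\<phi> x))"
    using R by (auto intro!: loc_integrable_mult_test[of _ _ R] yl g test_function_continuous[OF \<phi>])
  have "((\<lambda>x. of_real (\<phi> x) :: complex) has_vector_derivative of_real (deriv \<phi> x)) (at x)" for x
    using test_function_DERIV[OF \<phi>, of x]
    by (intro has_vector_derivative_of_real) (simp add: has_real_derivative_iff_has_vector_derivative)
  then have "AC_on UNIV (\<lambda>x. of_real (\<phi> x) * y x) (\<lambda>x. of_real (deriv \<phi> x) * y x + of_real (\<phi> x) * g x)"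
    by (intro AC_on_mult[OF y _ g] continuous_intros test_function_continuous[OF \<phi>]) auto
  from AC_onD[OF this, of "-R" R]
  have "((\<lambda>x. of_real (deriv \<phi> x) * y x + of_real (\<phi> x) * g x) has_integral 0) {-R..R}"
    using R by simp
  then have "((\<lambda>x. of_real (deriv \<phi> x) * y x + of_real (\<phi> x) * g x) has_integral 0) UNIV"
  proof (rule has_integral_on_superset)
    fix x assume "x \<notin> {-R..R}"
    then have "R \<le> \<bar>x\<bar>" by auto
    then show "of_real (deriv \<phi> x) * y x + of_real (\<phi> x) * g x = 0" using R by simp
  qed simp
  moreover have "((\<lambda>x. y x * of_real (deriv \<phi> x) + g x * of_real (\<phi> x)) has_integral
      (LINT x|lborel. y x * of_real (deriv \<phi> x)) + (LINT x|lborel. g x * of_real (\<phi> x))) UNIV"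
    by (intro has_integral_add has_integral_integral_lborel i)
  ultimately have "(LINT x|lborel. y x * of_real (deriv \<phi> x)) + (LINT x|lborel. g x * of_real (\<phi> x)) = 0"
    by (simp add: mult.commute has_integral_unique)
  then show ?thesis by (simp add: eq_neg_iff_add_eq_0)
qed

lemma AC_on_UNIV_primitive:
  assumes "loc_integrable g"
  obtains y where "AC_on UNIV y g"
proof -
  \<comment> \<open>At most one of the two intervals is nondegenerate, so the difference is the
    oriented integral from 0 to x.\<close>
  define y where "y x = integral {0..x} g - integral {x..0} g" for x
  have i: "g integrable_on {a..b}" for a b
    using loc_integrable_has_integral(2)[OF assms] by (auto simp: integrable_on_def)
  have "AC_on {0..} y g"
    unfolding AC_on_def
  proof (intro ballI impI)
    fix a b :: real assume "a \<in> {0..}" "b \<in> {0..}" "a \<le> b"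
    then have "integral {0..a} g + integral {a..b} g = integral {0..b} g"
      by (intro Henstock_Kurzweil_Integration.integral_combine i) auto
    moreover have "integral {c..0} g = 0" if "c \<ge> 0" for c
      using that by (cases "c = 0") auto
    ultimately have "integral {a..b} g = y b - y a"
      using \<open>a \<in> _\<close> \<open>b \<in> _\<close> by (simp add: y_def algebra_simps)
    then show "(g has_integral (y b - y a)) {a..b}"
      using i by (simp add: has_integral_integrable_integral)
  qed
  moreover have "AC_on {..0} y g"
    unfolding AC_on_def
  proof (intro ballI impI)
    fix a b :: real assume "a \<in> {..0}" "b \<in> {..0}" "a \<le> b"
    then have "integral {a..b} g + integral {b..0} g = integral {a..0} g"
      by (intro Henstock_Kurzweil_Integration.integral_combine i) auto
    moreover have "integral {0..c} g = 0" if "c \<le> 0" for c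
      using that by (cases "c = 0") auto
    ultimately have "integral {a..b} g = y b - y a"
      using \<open>a \<in> _\<close> \<open>b \<in> _\<close> by (simp add: y_def algebra_simps)
    then show "(g has_integral (y b - y a)) {a..b}"
      using i by (simp add: has_integral_integrable_integral)
  qed
  ultimately show ?thesis using that AC_on_glue by blast
qed

lemma is_weak_deriv_abs:
  assumes "sq_integrable u" "sq_integrable g"
  shows "is_weak_deriv (abs_L2 u) (abs_L2 g) \<longleftrightarrow>
    (\<forall>\<phi>. test_function \<phi> \<longrightarrow>
        (LINT x|lborel. u x * of_real (deriv \<phi> x)) = - (LINT x|lborel. g x * of_real (\<phi> x)))"
  using assms by (simp add: is_weak_deriv.abs_eq)

lemma loc_integrable_diff:
  fixes f g :: "real \<Rightarrow> 'a::euclidean_space"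
  assumes "loc_integrable f" "loc_integrable g"
  shows "loc_integrable (\<lambda>x. f x - g x)"
  using assms by (auto simp: loc_integrable_def)

text \<open>If g is a weak derivative of u and y is a primitive of g, then u - y has weak derivative
  zero and is constant by du Bois-Reymond. The converse is integration by parts. This equivalence is
  what makes values of H^1 functions at x = 0 meaningful.\<close>

lemma is_weak_deriv_iff_AC:
  assumes u: "sq_integrable u" and g: "sq_integrable g"
  shows "is_weak_deriv (abs_L2 u) (abs_L2 g) \<longleftrightarrow> (\<exists>y. AC_on UNIV y g \<and> (AE x in lborel. u x = y x))"
proof
  assume w: "is_weak_deriv (abs_L2 u) (abs_L2 g)"
  have gl: "loc_integrable g" and ul: "loc_integrable u"
    using u g by (auto intro: sq_integrable_loc_integrable)
  obtain y where y: "AC_on UNIV y g" using AC_on_UNIV_primitive[OF gl] by blast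
  have yl: "loc_integrable y"
    by (rule continuous_loc_integrable[OF AC_on_UNIV_continuous[OF y]])
  obtain c where c: "AE x in lborel. u x - y x = c"
  proof (rule du_Bois_Reymond[OF loc_integrable_diff[OF ul yl]])
    fix \<phi> assume \<phi>: "test_function \<phi>"
    obtain R where R: "R > 0" "\<And>x. R \<le> \<bar>x\<bar> \<Longrightarrow> \<phi> x = 0"
      using test_function_bounded_support[OF \<phi>] by blast
    have i: "integrable lborel (\<lambda>x. h x * of_real (deriv \<phi> x))" if "loc_integrable h" for h :: "real \<Rightarrow> complex"
      using R by (intro loc_integrable_mult_test[of _ _ R] that test_function_continuous[OF \<phi>]
          test_function_deriv_eq_0[OF \<phi>, of R]) auto
    have "(LINT x|lborel. (u x - y x) * of_real (deriv \<phi> x)) =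
        (LINT x|lborel. u x * of_real (deriv \<phi> x)) - (LINT x|lborel. y x * of_real (deriv \<phi> x))"
      using i[OF ul] i[OF yl] by (simp add: left_diff_distrib)
    also have "\<dots> = 0"
      using w \<phi> AC_on_UNIV_by_parts[OF y gl \<phi>] by (simp add: is_weak_deriv_abs[OF u g])
    finally show "(LINT x|lborel. (u x - y x) * of_real (deriv \<phi> x)) = 0" .
  qed blast
  have "AC_on UNIV (\<lambda>x. y x + c) g"
    using y by (simp add: AC_on_def)
  moreover have "AE x in lborel. u x = y x + c"
    using c by eventually_elim (simp add: algebra_simps)
  ultimately show "\<exists>y. AC_on UNIV y g \<and> (AE x in lborel. u x = y x)" by blast
next
  assume "\<exists>y. AC_on UNIV y g \<and> (AE x in lborel. u x = y x)"
  then obtain y where y: "AC_on UNIV y g" "AE x in lborel. u x = y x" by blast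
  show "is_weak_deriv (abs_L2 u) (abs_L2 g)"
    unfolding is_weak_deriv_abs[OF u g]
  proof (intro allI impI)
    fix \<phi> assume \<phi>: "test_function \<phi>"
    have [measurable]: "u \<in> borel_measurable borel" using u by (simp add: sq_integrable_def)
    have [measurable]: "y \<in> borel_measurable borel" "deriv \<phi> \<in> borel_measurable borel"
      by (auto intro!: borel_measurable_continuous_onI AC_on_UNIV_continuous[OF y(1)]
          test_function_continuous[OF \<phi>])
    have "(LINT x|lborel. u x * of_real (deriv \<phi> x)) = (LINT x|lborel. y x * of_real (deriv \<phi> x))"
      using y(2) by (intro integral_cong_AE) (measurable, auto elim: eventually_mono)
    then show "(LINT x|lborel. u x * of_real (deriv \<phi> x)) = - (LINT x|lborel. g x * of_real (\<phi> x))"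
      using AC_on_UNIV_by_parts[OF y(1) _ \<phi>] sq_integrable_loc_integrable[OF g] by simp
  qed
qed

lemma abs_L2_eq_iff:
  assumes "sq_integrable f" "sq_integrable g"
  shows "abs_L2 f = abs_L2 g \<longleftrightarrow> (AE x in lborel. f x = g x)"
  using Quotient3_rel[OF Quotient3_L2, of f g] assms by auto

lemma abs_L2_cases:
  obtains f where "sq_integrable f" "u = abs_L2 f"
proof -
  have "\<exists>f. sq_integrable f \<and> u = abs_L2 f"
    by (induction u rule: L2.abs_induct) blast
  then show ?thesis using that by blast
qed

text \<open>Two weak derivatives have the same pairing with every test function, so the fundamental
  lemma identifies them. This legitimises the description operator in
  \<open>weak_deriv\<close>.\<close>

lemma is_weak_deriv_unique:
  assumes "is_weak_deriv u g" "is_weak_deriv u h"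
  shows "g = h"
proof -
  obtain u' where u: "sq_integrable u'" "u = abs_L2 u'" by (rule abs_L2_cases)
  obtain g' where g: "sq_integrable g'" "g = abs_L2 g'" by (rule abs_L2_cases)
  obtain h' where h: "sq_integrable h'" "h = abs_L2 h'" by (rule abs_L2_cases)
  note sq = u(1) g(1) h(1) and eq = u(2) g(2) h(2)
  have l: "loc_integrable g'" "loc_integrable h'"
    using sq by (auto intro: sq_integrable_loc_integrable)
  have "AE x in lborel. g' x - h' x = 0"
  proof (rule fundamental_lemma[OF loc_integrable_diff[OF l]])
    fix \<phi> assume \<phi>: "test_function \<phi>"
    obtain R where R: "R > 0" "\<And>x. R \<le> \<bar>x\<bar> \<Longrightarrow> \<phi> x = 0"
      using test_function_bounded_support[OF \<phi>] by blast
    have i: "integrable lborel (\<lambda>x. h x * of_real (\<phi> x))" if "loc_integrable h" for h :: "real \<Rightarrow> complex"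
      using R by (intro loc_integrable_mult_test[of _ _ R] that test_function_continuous[OF \<phi>]) auto
    have "(LINT x|lborel. g' x * of_real (\<phi> x)) = (LINT x|lborel. h' x * of_real (\<phi> x))"
      using assms(1)[unfolded eq is_weak_deriv_abs[OF sq(1,2)], rule_format, OF \<phi>]
        assms(2)[unfolded eq is_weak_deriv_abs[OF sq(1,3)], rule_format, OF \<phi>]
      by simp
    then show "(LINT x|lborel. (g' x - h' x) * of_real (\<phi> x)) = 0"
      using i[OF l(1)] i[OF l(2)] by (simp add: left_diff_distrib)
  qed
  then show ?thesis using sq by (simp add: eq abs_L2_eq_iff)
qed

lemma weak_deriv_eq: "is_weak_deriv u g \<Longrightarrow> weak_deriv u = g"
  unfolding weak_deriv_def by (rule the_equality) (auto intro: is_weak_deriv_unique)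

section \<open>Square integrable solutions on a half line\<close>

text \<open>The integrating factor exp(-l x) makes the product constant on the half line. Continuity
  of y on the whole line supplies the local integrability of \<open>l * y\<close>.\<close>

lemma AC_on_half_line_exp:
  assumes y: "AC_on {0..} y (\<lambda>x. l * y x)" and c: "continuous_on UNIV y" and "0 \<le> x"
  shows "y x = exp (l * of_real x) * y 0"
proof -
  have "loc_integrable (\<lambda>x. l * y x)"
    by (intro continuous_loc_integrable continuous_intros c)
  from AC_on_exp_mult[OF y _ this, of "- l"]
  have "AC_on {0..} (\<lambda>x. exp (- l * of_real x) * y x) (\<lambda>x. 0)"
    by (simp add: is_interval_ci)
  from AC_onD[OF this, of 0 x] have "exp (- l * of_real x) * y x = y 0"
    using \<open>0 \<le> x\<close> by simp
  then have "exp (l * of_real x) * y 0 = (exp (l * of_real x) * exp (- l * of_real x)) * y x"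
    by simp
  then show ?thesis by (simp flip: exp_add)
qed

lemma not_sq_integrable_if_bounded_below:
  assumes f: "sq_integrable f" and "c > 0" and bd: "\<And>x. 0 \<le> x \<Longrightarrow> c \<le> norm (f x)"
  shows False
proof -
  have i: "integrable lborel (\<lambda>x. (norm (f x))\<^sup>2)" using f by (simp add: sq_integrable_def)
  have "c\<^sup>2 * real n \<le> (LINT x|lborel. (norm (f x))\<^sup>2)" for n :: nat
  proof -
    have "(LINT x|lborel. c\<^sup>2 * indicator {0..real n} x) \<le> (LINT x|lborel. (norm (f x))\<^sup>2)"
    proof (rule integral_mono[OF _ i])
      show "integrable lborel (\<lambda>x. c\<^sup>2 * indicator {0..real n} x :: real)"
        by (intro integrable_mult_right integrable_real_indicator) (auto simp: emeasure_lborel_Icc_eq)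
      show "c\<^sup>2 * indicator {0..real n} x \<le> (norm (f x))\<^sup>2" for x
        using bd[of x] \<open>c > 0\<close> by (auto simp: indicator_def intro: power_mono)
    qed
    then show ?thesis by simp
  qed
  moreover obtain n :: nat where "(LINT x|lborel. (norm (f x))\<^sup>2) / c\<^sup>2 < real n"
    using reals_Archimedean2 by blast
  ultimately show False using \<open>c > 0\<close> by (simp add: field_simps not_le[symmetric])
qed

text \<open>With Re l nonnegative the modulus never falls below its value at 0. The borderline Re l
  = 0 is included: an oscillating exponential is not square integrable either.\<close>

lemma sq_integrable_exp_solution_zero:
  assumes y: "AC_on {0..} y (\<lambda>x. l * y x)" and c: "continuous_on UNIV y"
    and sq: "sq_integrable y" and "0 \<le> Re l"
  shows "y 0 = 0"
proof (rule ccontr)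
  assume "y 0 \<noteq> 0"
  then have "norm (y 0) > 0" by simp
  moreover have "norm (y 0) \<le> norm (y x)" if "0 \<le> x" for x
  proof -
    have "1 * norm (y 0) \<le> exp (Re l * x) * norm (y 0)"
      using that \<open>0 \<le> Re l\<close> by (intro mult_right_mono) auto
    then show ?thesis
      using AC_on_half_line_exp[OF y c that] by (simp add: norm_mult)
  qed
  ultimately show False using not_sq_integrable_if_bounded_below[OF sq] by blast
qed

text \<open>Eliminating v gives w'' = \<mu>^2 w. Only the square of \<mu> enters, so \<mu> may be
  replaced by -\<mu>, which is \<open>flip\<close>.\<close>

locale half_line_solution =
  fixes a \<mu> :: complex and v w :: "real \<Rightarrow> complex"
  assumes a: "a \<noteq> 0" and sq: "sq_integrable v" "sq_integrable w"
    and cont: "continuous_on UNIV v" "continuous_on UNIV w"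
    and v: "AC_on {0..} v (\<lambda>x. - (\<mu>\<^sup>2 / a) * w x)" and w: "AC_on {0..} w (\<lambda>x. - a * v x)"
begin

lemma flip: "half_line_solution a (- \<mu>) v w"
  using half_line_solution_axioms by (simp add: half_line_solution_def)

text \<open>A left eigenvector of the system: this combination satisfies a scalar equation with
  exponent \<mu>. The eigenvector for -\<mu> is the same statement applied to
  \<open>flip\<close>.\<close>

lemma growing: "AC_on {0..} (\<lambda>x. a * v x + (- \<mu>) * w x) (\<lambda>x. \<mu> * (a * v x + (- \<mu>) * w x))"
  by (rule AC_on_cong[OF AC_on_lincomb[OF v w, of a "- \<mu>"] is_interval_ci])
     (use a in \<open>simp_all add: algebra_simps power2_eq_square\<close>)

lemma sq_growing: "sq_integrable (\<lambda>x. a * v x + (- \<mu>) * w x)"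
  by (intro sq_integrable_add sq_integrable_bounded_linear[OF bounded_linear_mult_right] sq)

lemma cont_growing: "continuous_on UNIV (\<lambda>x. a * v x + (- \<mu>) * w x)"
  by (intro continuous_intros cont)

text \<open>Square integrability kills the growing coordinate. What remains is the line of initial
  values (v, w) spanned by (\<mu>, a).\<close>

lemma decay:
  assumes "0 \<le> Re \<mu>"
  shows "a * v 0 = \<mu> * w 0"
  using sq_integrable_exp_solution_zero[OF growing cont_growing sq_growing assms] by simp

text \<open>Both eigencoordinates vanish, and their sum is 2 a v. Recovering w from w' = - a v
  instead of dividing by \<mu> keeps the argument valid when \<mu> = 0 and the two coordinates
  coincide.\<close>

lemma zero_if_vanishes_at_0:
  assumes "v 0 = 0" "w 0 = 0" "0 \<le> x"
  shows "v x = 0" "w x = 0"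
proof -
  have q: "a * v t = \<mu> * w t" "a * v t = - \<mu> * w t" if "0 \<le> t" for t
    using AC_on_half_line_exp[OF growing cont_growing that] assms
      AC_on_half_line_exp[OF half_line_solution.growing[OF flip] half_line_solution.cont_growing[OF flip] that]
    by simp_all
  have vt: "v t = 0" if "0 \<le> t" for t
  proof -
    have "a * v t + a * v t = \<mu> * w t + - \<mu> * w t"
      using q[OF that] by (intro arg_cong2[where f = "(+)"])
    then show ?thesis using a by simp
  qed
  then show "v x = 0" using assms by simp
  have "AC_on {0..} w (\<lambda>x. 0)"
    by (rule AC_on_cong[OF w is_interval_ci]) (simp_all add: vt)
  from AC_onD[OF this, of 0 x] show "w x = 0"
    using assms by simp
qed

text \<open>Neither exponent decays, so both eigencoordinates vanish at 0. For \<mu> = 0 they give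
  only v(0) = 0; then v' = 0 makes v vanish on the half line, w is constant there, and a square
  integrable constant is zero.\<close>

lemma zero_if_Re_eq_0:
  assumes "Re \<mu> = 0"
  shows "v 0 = 0" "w 0 = 0"
proof -
  have q: "a * v 0 = \<mu> * w 0" "a * v 0 = - \<mu> * w 0"
    using decay half_line_solution.decay[OF flip] assms by simp_all
  have "a * v 0 + a * v 0 = \<mu> * w 0 + - \<mu> * w 0"
    using q by (intro arg_cong2[where f = "(+)"])
  then show v0: "v 0 = 0" using a by simp
  show "w 0 = 0"
  proof (cases "\<mu> = 0")
    case False
    then show ?thesis using q v0 by simp
  next
    case True
    have "AC_on {0..} v (\<lambda>x. 0 * v x)"
      by (rule AC_on_cong[OF v is_interval_ci]) (simp_all add: True)
    then have "v x = 0" if "0 \<le> x" for x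
      using AC_on_half_line_exp[where l = 0, OF _ cont(1) that] v0 by simp
    then have "AC_on {0..} w (\<lambda>x. 0 * w x)"
      by (intro AC_on_cong[OF w is_interval_ci]) simp_all
    then show ?thesis
      using sq_integrable_exp_solution_zero[where l = 0, OF _ cont(2) sq(2)] by simp
  qed
qed

end

section \<open>The inhomogeneous first-order equation\<close>

lemma norm_abs_L2: "sq_integrable f \<Longrightarrow> (norm (abs_L2 f))\<^sup>2 = (LINT x|lborel. (norm (f x))\<^sup>2)"
  by (simp add: power2_norm_eq_inner inner_L2.abs_eq)

text \<open>The two marginals of the causal exponential kernel, as needed for a Schur test in
  \<open>solve_decaying\<close>.\<close>

lemma decay_kernel_integral:
  fixes \<alpha> :: real assumes "\<alpha> > 0"
  shows "(\<integral>\<^sup>+x. ennreal (indicator {..x} t * exp (- \<alpha> * (x - t))) \<partial>lborel) = ennreal (1 / \<alpha>)"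
    and "(\<integral>\<^sup>+t. ennreal (indicator {..x} t * exp (- \<alpha> * (x - t))) \<partial>lborel) = ennreal (1 / \<alpha>)"
proof -
  have *: "(\<integral>\<^sup>+x. ennreal (indicator {..x} t * exp (- \<alpha> * (x - t))) \<partial>lborel) = ennreal (1 / \<alpha>)" for t :: real
  proof -
    have "(\<integral>\<^sup>+x. ennreal (indicator {..x} t * exp (- \<alpha> * (x - t))) \<partial>lborel) =
        (\<integral>\<^sup>+x. ennreal (exp (- \<alpha> * (x - t))) * indicator {t..} x \<partial>lborel)"
      by (intro nn_integral_cong) (auto simp: indicator_def)
    also have "\<dots> = ennreal (0 - (- exp (- \<alpha> * (t - t)) / \<alpha>))"
    proof (rule nn_integral_FTC_atLeast[where F = "\<lambda>x. - exp (- \<alpha> * (x - t)) / \<alpha>"])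
      show "((\<lambda>x. - exp (- \<alpha> * (x - t)) / \<alpha>) has_real_derivative exp (- \<alpha> * (x - t))) (at x)" for x
        using assms by (auto intro!: derivative_eq_intros)
      have "filterlim (\<lambda>x. - \<alpha> * (x - t)) at_bot at_top"
        using assms filterlim_tendsto_pos_mult_at_top[OF tendsto_const[of \<alpha>] assms
            filterlim_tendsto_add_at_top[OF tendsto_const[of "- t"] filterlim_ident]]
        by (simp add: filterlim_uminus_at_bot)
      from filterlim_compose[OF exp_at_bot this]
      have "((\<lambda>x. - exp (- \<alpha> * (x - t)) / \<alpha>) \<longlongrightarrow> - 0 / \<alpha>) at_top"
        using assms by (intro tendsto_intros) simp_all
      then show "((\<lambda>x. - exp (- \<alpha> * (x - t)) / \<alpha>) \<longlongrightarrow> 0) at_top" by simp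
    qed auto
    finally show ?thesis by simp
  qed
  show "(\<integral>\<^sup>+x. ennreal (indicator {..x} t * exp (- \<alpha> * (x - t))) \<partial>lborel) = ennreal (1 / \<alpha>)"
    by (rule *)
  \<comment> \<open>The map (x, t) to (-t, -x) preserves the kernel and exchanges its
    marginals.\<close>
  have "(\<integral>\<^sup>+t. ennreal (indicator {..x} t * exp (- \<alpha> * (x - t))) \<partial>lborel) =
      (\<integral>\<^sup>+s. ennreal (indicator {..x} (0 + (-1) * s) * exp (- \<alpha> * (x - (0 + (-1) * s)))) \<partial>lborel)"
    by (subst nn_integral_real_affine[where c = "-1" and t = 0]) auto
  also have "\<dots> = (\<integral>\<^sup>+s. ennreal (indicator {..s} (- x) * exp (- \<alpha> * (s - (- x)))) \<partial>lborel)"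
    by (intro nn_integral_cong) (auto simp: indicator_def algebra_simps)
  finally show "(\<integral>\<^sup>+t. ennreal (indicator {..x} t * exp (- \<alpha> * (x - t))) \<partial>lborel) = ennreal (1 / \<alpha>)"
    by (simp only: *)
qed

text \<open>The solution is the integral of exp(-\<mu> (x - t)) f(t) over t \<le> x. Writing the
  modulus k of the kernel as a product of two square roots, Cauchy-Schwarz bounds |y(x)|^2 by
  1/\<alpha> times B(x), the integral of k |f|^2. Integrating over x with the other marginal gives
  the L^2 bound, and k \<le> 1 gives the bound at 0.\<close>

lemma solve_decaying:
  assumes \<alpha>: "Re \<mu> > 0" and f: "sq_integrable f"
  obtains y where "sq_integrable y" "AC_on UNIV y (\<lambda>x. - \<mu> * y x + f x)"
    "norm (abs_L2 y) \<le> 1 / Re \<mu> * norm (abs_L2 f)"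
    "norm (y 0) \<le> sqrt (1 / Re \<mu>) * norm (abs_L2 f)"
proof -
  define \<alpha> where "\<alpha> = Re \<mu>"
  have "\<alpha> > 0" using \<alpha> by (simp add: \<alpha>_def)
  have [measurable]: "f \<in> borel_measurable borel" using f by (simp add: sq_integrable_def)
  define k where "k x t = indicator {..x} t * exp (- \<alpha> * (x - t))" for x t :: real
  have k_eq: "k x t = (if t \<le> x then exp (- \<alpha> * (x - t)) else 0)" for x t
    by (simp add: k_def)
  have [measurable]: "(\<lambda>(x, t). k x t) \<in> borel_measurable (borel \<Otimes>\<^sub>M borel)"
    unfolding k_eq by measurable
  have [measurable]: "k x \<in> borel_measurable borel" for x
    unfolding k_eq[abs_def] by measurable
  have k0: "0 \<le> k x t" "k x t \<le> 1" for x t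
    using \<open>\<alpha> > 0\<close> by (auto simp: k_eq)
  note kint = decay_kernel_integral[OF \<open>\<alpha> > 0\<close>, folded k_def]
  have f2: "(\<integral>\<^sup>+t. ennreal ((norm (f t))\<^sup>2) \<partial>lborel) = ennreal ((norm (abs_L2 f))\<^sup>2)"
    using f by (simp add: norm_abs_L2 nn_integral_eq_integral sq_integrable_def)
  define B where "B x = (\<integral>\<^sup>+t. ennreal (k x t * (norm (f t))\<^sup>2) \<partial>lborel)" for x
  have B_le: "B x \<le> ennreal ((norm (abs_L2 f))\<^sup>2)" for x
    unfolding B_def f2[symmetric]
    by (intro nn_integral_mono ennreal_leI mult_left_le_one_le k0) auto
  have CS: "(\<integral>\<^sup>+t. ennreal (k x t * norm (f t)) \<partial>lborel)\<^sup>2 \<le> ennreal (1 / \<alpha>) * B x" for x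
  proof -
    have "(\<integral>\<^sup>+t. ennreal (k x t * norm (f t)) \<partial>lborel) =
        (\<integral>\<^sup>+t. ennreal (sqrt (k x t)) * ennreal (sqrt (k x t) * norm (f t)) \<partial>lborel)"
      using k0 by (intro nn_integral_cong) (simp flip: ennreal_mult' mult.assoc)
    also have "(\<dots>)\<^sup>2 \<le> (\<integral>\<^sup>+t. (ennreal (sqrt (k x t)))\<^sup>2 \<partial>lborel) *
        (\<integral>\<^sup>+t. (ennreal (sqrt (k x t) * norm (f t)))\<^sup>2 \<partial>lborel)"
      by (rule Cauchy_Schwarz_nn_integral) measurable
    also have "(\<integral>\<^sup>+t. (ennreal (sqrt (k x t)))\<^sup>2 \<partial>lborel) = ennreal (1 / \<alpha>)"
      using k0 by (simp add: ennreal_power kint)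
    also have "(\<integral>\<^sup>+t. (ennreal (sqrt (k x t) * norm (f t)))\<^sup>2 \<partial>lborel) = B x"
      using k0 by (simp add: B_def ennreal_power power_mult_distrib)
    finally show ?thesis .
  qed
  \<comment> \<open>Pulling exp(-\<mu> x) out of the kernel leaves a genuine primitive of H, to
    which the product rule applies. H itself need not be in L^2, but it is integrable on every left
    ray.\<close>
  define H where "H t = exp (\<mu> * of_real t) * f t" for t
  have Hl: "loc_integrable H"
    unfolding H_def by (intro loc_integrable_mult sq_integrable_loc_integrable f continuous_intros)
  have [measurable]: "H \<in> borel_measurable borel" using Hl by (simp add: loc_integrable_def)
  have Hn: "exp (- \<alpha> * x) * norm (indicator {..x} t *\<^sub>R H t) = k x t * norm (f t)" for x t
    by (auto simp: k_eq H_def norm_mult \<alpha>_def algebra_simps simp flip: exp_add)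
  have kf: "integrable lborel (\<lambda>t. k x t * norm (f t))" for x
  proof -
    have "(\<integral>\<^sup>+t. ennreal (k x t * norm (f t)) \<partial>lborel) < \<infinity>"
    proof (rule ccontr)
      assume "\<not> ?thesis"
      then have "(\<integral>\<^sup>+t. ennreal (k x t * norm (f t)) \<partial>lborel)\<^sup>2 = \<infinity>"
        by (simp add: power2_eq_square less_top[symmetric] ennreal_top_mult)
      moreover have "ennreal (1 / \<alpha>) * B x \<le> ennreal (1 / \<alpha>) * ennreal ((norm (abs_L2 f))\<^sup>2)"
        by (intro mult_left_mono B_le) simp
      then have "ennreal (1 / \<alpha>) * B x < \<infinity>"
        by (rule order_le_less_trans) (simp add: ennreal_mult_less_top)
      ultimately show False using CS[of x] by simp
    qed
    then show ?thesis
      using k0 by (intro integrableI_bounded) (simp_all add: abs_mult)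
  qed
  have Hi: "integrable lborel (\<lambda>t. indicator {..x} t *\<^sub>R H t)" for x
  proof -
    from kf[of x] have "integrable lborel (\<lambda>t. exp (\<alpha> * x) * (exp (- \<alpha> * x) * norm (indicator {..x} t *\<^sub>R H t)))"
      unfolding Hn by (rule integrable_mult_right)
    then have "integrable lborel (\<lambda>t. norm (indicator {..x} t *\<^sub>R H t))"
      by (simp add: exp_minus mult.assoc[symmetric] del: norm_scaleR)
    then show ?thesis
      by (subst (asm) integrable_norm_iff) measurable
  qed
  define F where "F x = (LINT t|lborel. indicator {..x} t *\<^sub>R H t)" for x
  define y where "y x = exp (- \<mu> * of_real x) * F x" for x
  have "AC_on UNIV F H"
    unfolding AC_on_def
  proof (intro ballI impI)
    fix a b :: real assume "a \<le> b"
    have "F b - F a = (LINT t|lborel. indicator {..b} t *\<^sub>R H t - indicator {..a} t *\<^sub>R H t)"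
      unfolding F_def by (rule Bochner_Integration.integral_diff[symmetric]) (rule Hi)+
    also have "\<dots> = (LINT t:{a..b}|lborel. H t)"
      unfolding set_lebesgue_integral_def
    proof (rule integral_cong_AE)
      show "AE t in lborel. indicator {..b} t *\<^sub>R H t - indicator {..a} t *\<^sub>R H t = indicator {a..b} t *\<^sub>R H t"
        using AE_lborel_singleton[of a]
        by eventually_elim (use \<open>a \<le> b\<close> in \<open>auto simp: indicator_def\<close>)
    qed measurable
    finally show "(H has_integral (F b - F a)) {a..b}"
      using loc_integrable_has_integral(2)[OF Hl] by simp
  qed
  from AC_on_exp_mult[OF this is_interval_univ Hl, of "- \<mu>"]
  have AC: "AC_on UNIV y (\<lambda>x. - \<mu> * y x + f x)"
    by (rule AC_on_cong) (auto simp: y_def H_def algebra_simps simp flip: exp_add)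
  have [measurable]: "y \<in> borel_measurable borel"
    by (intro borel_measurable_continuous_onI AC_on_UNIV_continuous[OF AC])
  have ynorm: "ennreal ((norm (y x))\<^sup>2) \<le> ennreal (1 / \<alpha>) * B x" for x
  proof -
    have "norm (y x) \<le> exp (- \<alpha> * x) * (LINT t|lborel. norm (indicator {..x} t *\<^sub>R H t))"
      unfolding y_def F_def norm_mult by (intro mult_mono integral_norm_bound) (auto simp: \<alpha>_def)
    also have "\<dots> = (LINT t|lborel. k x t * norm (f t))"
      unfolding Hn[symmetric] by simp
    finally have "ennreal (norm (y x)) \<le> ennreal (LINT t|lborel. k x t * norm (f t))"
      by (rule ennreal_leI)
    also have "\<dots> \<le> (\<integral>\<^sup>+t. ennreal (k x t * norm (f t)) \<partial>lborel)"
      using k0 by (subst nn_integral_eq_integral[OF kf]) simp_all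
    finally have "(ennreal (norm (y x)))\<^sup>2 \<le> (\<integral>\<^sup>+t. ennreal (k x t * norm (f t)) \<partial>lborel)\<^sup>2"
      by (rule power_mono) simp
    with CS[of x] show ?thesis by (simp add: ennreal_power)
  qed
  have "(\<integral>\<^sup>+x. ennreal ((norm (y x))\<^sup>2) \<partial>lborel) \<le> (\<integral>\<^sup>+x. ennreal (1 / \<alpha>) * B x \<partial>lborel)"
    by (intro nn_integral_mono ynorm)
  also have "\<dots> = ennreal (1 / \<alpha>) * (\<integral>\<^sup>+x. B x \<partial>lborel)"
    unfolding B_def by (rule nn_integral_cmult) measurable
  also have "(\<integral>\<^sup>+x. B x \<partial>lborel) = (\<integral>\<^sup>+t. (\<integral>\<^sup>+x. ennreal (k x t * (norm (f t))\<^sup>2) \<partial>lborel) \<partial>lborel)"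
    unfolding B_def by (rule lborel_pair.Fubini') measurable
  also have "\<dots> = (\<integral>\<^sup>+t. ennreal (1 / \<alpha>) * ennreal ((norm (f t))\<^sup>2) \<partial>lborel)"
  proof (intro nn_integral_cong)
    fix t
    have "(\<lambda>x. k x t) \<in> borel_measurable borel" unfolding k_eq by measurable
    then show "(\<integral>\<^sup>+x. ennreal (k x t * (norm (f t))\<^sup>2) \<partial>lborel) = ennreal (1 / \<alpha>) * ennreal ((norm (f t))\<^sup>2)"
      using k0 by (simp add: ennreal_mult nn_integral_multc kint)
  qed
  also have "\<dots> = ennreal (1 / \<alpha>) * ennreal ((norm (abs_L2 f))\<^sup>2)"
    by (simp add: nn_integral_cmult f2)
  finally have yint: "(\<integral>\<^sup>+x. ennreal ((norm (y x))\<^sup>2) \<partial>lborel) \<le> ennreal ((1 / \<alpha> * norm (abs_L2 f))\<^sup>2)"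
    using \<open>\<alpha> > 0\<close> by (simp add: power_mult_distrib power2_eq_square mult.assoc flip: ennreal_mult')
  have iy: "integrable lborel (\<lambda>x. (norm (y x))\<^sup>2)"
    by (rule integrableI_bounded) (use yint in \<open>auto intro: order_le_less_trans\<close>)
  then have sqy: "sq_integrable y" by (simp add: sq_integrable_def)
  have "(norm (abs_L2 y))\<^sup>2 \<le> (1 / \<alpha> * norm (abs_L2 f))\<^sup>2"
    using yint iy by (simp add: nn_integral_eq_integral norm_abs_L2[OF sqy])
  then have n1: "norm (abs_L2 y) \<le> 1 / \<alpha> * norm (abs_L2 f)"
    by (rule power2_le_imp_le) (use \<open>\<alpha> > 0\<close> in simp)
  have "ennreal ((norm (y 0))\<^sup>2) \<le> ennreal (1 / \<alpha>) * ennreal ((norm (abs_L2 f))\<^sup>2)"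
    using ynorm[of 0] mult_left_mono[OF B_le[of 0], of "ennreal (1 / \<alpha>)"] by simp
  then have "(norm (y 0))\<^sup>2 \<le> (sqrt (1 / \<alpha>) * norm (abs_L2 f))\<^sup>2"
    using \<open>\<alpha> > 0\<close> by (simp add: power_mult_distrib flip: ennreal_mult')
  then have "norm (y 0) \<le> sqrt (1 / \<alpha>) * norm (abs_L2 f)"
    by (rule power2_le_imp_le) (use \<open>\<alpha> > 0\<close> in simp)
  then show ?thesis using that sqy AC n1 by (simp add: \<alpha>_def)
qed

lemma sq_integrable_reflect:
  assumes "sq_integrable f"
  shows "sq_integrable (\<lambda>x. f (- x))" "norm (abs_L2 (\<lambda>x. f (- x))) = norm (abs_L2 f)"
proof -
  have [measurable]: "f \<in> borel_measurable borel" using assms by (simp add: sq_integrable_def)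
  have "integrable lborel (\<lambda>x. (norm (f (0 + (-1) * x)))\<^sup>2)"
    using assms by (intro lborel_integrable_real_affine) (simp_all add: sq_integrable_def)
  then show sq: "sq_integrable (\<lambda>x. f (- x))" by (simp add: sq_integrable_def)
  have "(norm (abs_L2 (\<lambda>x. f (- x))))\<^sup>2 = (norm (abs_L2 f))\<^sup>2"
    using lborel_integral_real_affine[of "-1" "\<lambda>x. (norm (f x))\<^sup>2" 0]
    by (simp add: norm_abs_L2 sq assms)
  then show "norm (abs_L2 (\<lambda>x. f (- x))) = norm (abs_L2 f)" by simp
qed

lemma sq_integrable_uminus:
  "sq_integrable f \<Longrightarrow> sq_integrable (\<lambda>x. - f x)"
  by (rule sq_integrable_bounded_linear[OF bounded_linear_minus[OF bounded_linear_ident]])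

lemma norm_abs_L2_uminus: "sq_integrable f \<Longrightarrow> norm (abs_L2 (\<lambda>x. - f x)) = norm (abs_L2 f)"
  using uminus_L2.abs_eq[of f] by (metis (no_types, lifting) AE_I2 norm_minus_cancel)

text \<open>The square integrable solution now integrates over the future t \<ge> x. Reflection at 0
  changes the sign of the derivative and thereby reduces it to the decaying case with source
  -f(-x).\<close>

lemma solve_growing:
  assumes \<alpha>: "Re \<mu> > 0" and f: "sq_integrable f"
  obtains y where "sq_integrable y" "AC_on UNIV y (\<lambda>x. \<mu> * y x + f x)"
    "norm (abs_L2 y) \<le> 1 / Re \<mu> * norm (abs_L2 f)"
    "norm (y 0) \<le> sqrt (1 / Re \<mu>) * norm (abs_L2 f)"
proof -
  have g: "sq_integrable (\<lambda>x. - f (- x))" "norm (abs_L2 (\<lambda>x. - f (- x))) = norm (abs_L2 f)"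
    using f by (simp_all add: sq_integrable_reflect sq_integrable_uminus norm_abs_L2_uminus)
  obtain y where y: "sq_integrable y" "AC_on UNIV y (\<lambda>x. - \<mu> * y x + - f (- x))"
    "norm (abs_L2 y) \<le> 1 / Re \<mu> * norm (abs_L2 f)"
    "norm (y 0) \<le> sqrt (1 / Re \<mu>) * norm (abs_L2 f)"
    using solve_decaying[OF \<alpha> g(1)] unfolding g(2) by blast
  have "AC_on UNIV (\<lambda>x. y (- x)) (\<lambda>x. \<mu> * y (- x) + f x)"
    using AC_on_reflect[OF y(2)] by (simp add: algebra_simps)
  then show ?thesis
    using that[of "\<lambda>x. y (- x)"] y sq_integrable_reflect[OF y(1)] by simp
qed

section \<open>Representatives of elements of \<open>L\<^sup>2\<close>\<close>

text \<open>The functions take values in different Euclidean spaces. Passing to their pointwise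
  norms puts them into one L^2 space, where the triangle inequality is available.\<close>

lemma norm_abs_L2_le_sum:
  fixes f :: "real \<Rightarrow> 'a::euclidean_space" and g :: "real \<Rightarrow> 'b::euclidean_space"
    and j :: "real \<Rightarrow> 'c::euclidean_space" and h :: "real \<Rightarrow> 'd::euclidean_space"
  assumes sq: "sq_integrable f" "sq_integrable g" "sq_integrable j" "sq_integrable h"
    and nn: "0 \<le> a" "0 \<le> b" "0 \<le> c"
    and bd: "\<And>x. norm (h x) \<le> a * norm (f x) + b * norm (g x) + c * norm (j x)"
  shows "norm (abs_L2 h) \<le> a * norm (abs_L2 f) + b * norm (abs_L2 g) + c * norm (abs_L2 j)"
proof -
  have n: "sq_integrable (\<lambda>x. norm (f' x))" "norm (abs_L2 (\<lambda>x. norm (f' x))) = norm (abs_L2 f')"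
    if "sq_integrable f'" for f' :: "real \<Rightarrow> 'e::euclidean_space"
  proof -
    show s: "sq_integrable (\<lambda>x. norm (f' x))"
      using that by (auto simp: sq_integrable_def)
    have "(norm (abs_L2 (\<lambda>x. norm (f' x))))\<^sup>2 = (norm (abs_L2 f'))\<^sup>2"
      using that s by (simp add: norm_abs_L2)
    then show "norm (abs_L2 (\<lambda>x. norm (f' x))) = norm (abs_L2 f')" by simp
  qed
  define F G J where "F = (\<lambda>x. norm (f x))" and "G = (\<lambda>x. norm (g x))" and "J = (\<lambda>x. norm (j x))"
  have FGJ: "sq_integrable F" "sq_integrable G" "sq_integrable J"
    using n(1) sq by (auto simp: F_def G_def J_def)
  define H where "H x = a *\<^sub>R F x + b *\<^sub>R G x + c *\<^sub>R J x" for x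
  have s: "sq_integrable (\<lambda>x. a *\<^sub>R F x)" "sq_integrable (\<lambda>x. b *\<^sub>R G x)" "sq_integrable (\<lambda>x. c *\<^sub>R J x)"
    by (rule sq_integrable_bounded_linear[OF bounded_linear_scaleR_right] FGJ)+
  have H: "sq_integrable H"
    unfolding H_def by (intro sq_integrable_add s)
  have "(norm (abs_L2 h))\<^sup>2 \<le> (norm (abs_L2 H))\<^sup>2"
  proof -
    have "(norm (h x))\<^sup>2 \<le> (norm (H x))\<^sup>2" for x
      using bd[of x] by (intro power_mono) (auto simp: H_def F_def G_def J_def)
    then show ?thesis
      using sq(4) H by (simp add: norm_abs_L2) (auto intro!: integral_mono simp: sq_integrable_def)
  qed
  then have "norm (abs_L2 h) \<le> norm (abs_L2 H)"
    by (rule power2_le_imp_le) simp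
  also have "abs_L2 H = a *\<^sub>R abs_L2 F + b *\<^sub>R abs_L2 G + c *\<^sub>R abs_L2 J"
    using FGJ s by (simp add: scaleR_L2.abs_eq plus_L2.abs_eq sq_integrable_add H_def[abs_def])
  also have "norm \<dots> \<le> norm (a *\<^sub>R abs_L2 F) + norm (b *\<^sub>R abs_L2 G) + norm (c *\<^sub>R abs_L2 J)"
    by (intro norm_triangle_mono norm_triangle_ineq order_refl)
  also have "\<dots> = a * norm (abs_L2 f) + b * norm (abs_L2 g) + c * norm (abs_L2 j)"
    using nn sq by (simp add: F_def G_def J_def n)
  finally show ?thesis .
qed

lemma norm_abs_L2_le_sum2:
  fixes f :: "real \<Rightarrow> 'a::euclidean_space" and g :: "real \<Rightarrow> 'b::euclidean_space"
    and h :: "real \<Rightarrow> 'd::euclidean_space"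
  assumes "sq_integrable f" "sq_integrable g" "sq_integrable h" "0 \<le> a" "0 \<le> b"
    "\<And>x. norm (h x) \<le> a * norm (f x) + b * norm (g x)"
  shows "norm (abs_L2 h) \<le> a * norm (abs_L2 f) + b * norm (abs_L2 g)"
  using norm_abs_L2_le_sum[of f g g h a b 0] assms by simp

lemma sq_integrable_cmult:
  fixes f :: "real \<Rightarrow> complex"
  shows "sq_integrable f \<Longrightarrow> sq_integrable (\<lambda>x. c * f x)"
  by (rule sq_integrable_bounded_linear[OF bounded_linear_mult_right])

lemma sq_integrable_nth:
  fixes f :: "real \<Rightarrow> complex^'n"
  shows "sq_integrable f \<Longrightarrow> sq_integrable (\<lambda>x. f x $ i)"
  by (rule sq_integrable_bounded_linear[OF bounded_linear_vec_nth])

lemma sq_integrable_cong_AE: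
  assumes "sq_integrable f" "g \<in> borel_measurable borel" "AE x in lborel. f x = g x"
  shows "sq_integrable g"
proof -
  have "integrable lborel (\<lambda>x. (norm (f x))\<^sup>2) = integrable lborel (\<lambda>x. (norm (g x))\<^sup>2)"
    using assms by (intro integrable_cong_AE) (auto simp: sq_integrable_def elim: eventually_mono)
  then show ?thesis using assms by (simp add: sq_integrable_def)
qed

lemma abs_L2_arith:
  "sq_integrable f \<Longrightarrow> c *\<^sub>1 abs_L2 f = abs_L2 (\<lambda>x. c * f x)"
  "sq_integrable f \<Longrightarrow> - abs_L2 f = abs_L2 (\<lambda>x. - f x)"
  "sq_integrable f \<Longrightarrow> sq_integrable g \<Longrightarrow> abs_L2 f + abs_L2 g = abs_L2 (\<lambda>x. f x + g x)"
  "sq_integrable f \<Longrightarrow> sq_integrable g \<Longrightarrow> sq_integrable h \<Longrightarrow>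
    vec3_L2 (abs_L2 f) (abs_L2 g) (abs_L2 h) = abs_L2 (\<lambda>x. vector [f x, g x, h x])"
  by (simp_all add: cmul.abs_eq uminus_L2.abs_eq plus_L2.abs_eq vec3_L2.abs_eq)

lemma zero_L2_abs: "0 = abs_L2 (\<lambda>x. 0)"
  by (simp add: zero_L2_def)

lemma is_weak_deriv_lincomb:
  fixes c :: complex
  assumes sq: "sq_integrable u" "sq_integrable g" "sq_integrable v" "sq_integrable h"
    and w: "is_weak_deriv (abs_L2 u) (abs_L2 g)" "is_weak_deriv (abs_L2 v) (abs_L2 h)"
  shows "is_weak_deriv (abs_L2 (\<lambda>x. c * u x + v x)) (abs_L2 (\<lambda>x. c * g x + h x))"
proof -
  obtain y where y: "AC_on UNIV y g" "AE x in lborel. u x = y x"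
    using w(1) is_weak_deriv_iff_AC[OF sq(1,2)] by blast
  obtain z where z: "AC_on UNIV z h" "AE x in lborel. v x = z x"
    using w(2) is_weak_deriv_iff_AC[OF sq(3,4)] by blast
  have s: "sq_integrable (\<lambda>x. c * u x + v x)" "sq_integrable (\<lambda>x. c * g x + h x)"
    by (intro sq_integrable_add sq_integrable_cmult sq)+
  have "AC_on UNIV (\<lambda>x. c * y x + z x) (\<lambda>x. c * g x + h x)"
    by (intro AC_on_add AC_on_cmult y(1) z(1))
  moreover have "AE x in lborel. c * u x + v x = c * y x + z x"
    using y(2) z(2) by eventually_elim simp
  ultimately show ?thesis
    using is_weak_deriv_iff_AC[OF s] by blast
qed

section \<open>The pencil on representatives\<close>

text \<open>The action of L - z on representatives. The derivatives g2 and g3 are separate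
  arguments, since a representative that is only fixed almost everywhere has no derivative to refer
  to.\<close>

definition op_L_repr ::
    "(complex \<Rightarrow> complex) \<Rightarrow> (complex \<Rightarrow> complex) \<Rightarrow> real \<Rightarrow> complex \<Rightarrow> complex \<Rightarrow>
      (real \<Rightarrow> complex^3) \<Rightarrow> (real \<Rightarrow> complex) \<Rightarrow> (real \<Rightarrow> complex) \<Rightarrow> real \<Rightarrow> complex^3" where
  "op_L_repr Vp Vm k \<omega> z U g2 g3 x = vector
     [\<i> * of_real k * U x $ 3 - (\<i> * V_layers Vp Vm x \<omega> + z) * U x $ 1,
      - g3 x - (\<i> * V_layers Vp Vm x \<omega> + z) * U x $ 2,
      - (\<i> * of_real k) * U x $ 1 + g2 x - (\<i> * \<omega> + z) * U x $ 3]"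

definition dom_repr :: "(real \<Rightarrow> complex^3) \<Rightarrow> (real \<Rightarrow> complex) \<Rightarrow> (real \<Rightarrow> complex) \<Rightarrow> bool" where
  "dom_repr U g2 g3 \<longleftrightarrow> sq_integrable U \<and> sq_integrable g2 \<and> sq_integrable g3 \<and>
     is_weak_deriv (abs_L2 (\<lambda>x. U x $ 2)) (abs_L2 g2) \<and> is_weak_deriv (abs_L2 (\<lambda>x. U x $ 3)) (abs_L2 g3)"

lemma component_abs_L2: "sq_integrable U \<Longrightarrow> abs_L2 U $\<^sub>L i = abs_L2 (\<lambda>x. U x $ i)"
  by (simp add: component.abs_eq)

lemma dom_A_repr:
  assumes "u \<in> dom_A"
  obtains U g2 g3 where "dom_repr U g2 g3" "u = abs_L2 U"
proof -
  obtain U where U: "sq_integrable U" "u = abs_L2 U" by (rule abs_L2_cases)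
  obtain G2 G3 where G: "is_weak_deriv (u $\<^sub>L 2) G2" "is_weak_deriv (u $\<^sub>L 3) G3"
    using assms by (auto simp: dom_A_def H1_def)
  obtain g2 where g2: "sq_integrable g2" "G2 = abs_L2 g2" by (rule abs_L2_cases)
  obtain g3 where g3: "sq_integrable g3" "G3 = abs_L2 g3" by (rule abs_L2_cases)
  have "dom_repr U g2 g3"
    using U g2 g3 G by (simp add: dom_repr_def component_abs_L2)
  then show ?thesis using that U(2) by blast
qed

lemma dom_repr_dom_A: "dom_repr U g2 g3 \<Longrightarrow> abs_L2 U \<in> dom_A"
  by (auto simp: dom_repr_def dom_A_def H1_def component_abs_L2)

lemma mat_B_mult:
  "mat_B Vp Vm x \<omega> *v u =
     vector [\<i> * V_layers Vp Vm x \<omega> * u $ 1, \<i> * V_layers Vp Vm x \<omega> * u $ 2, \<i> * \<omega> * u $ 3]"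
  by (simp add: vec_eq_iff forall_3 mat_B_def matrix_vector_mult_def sum_3)

lemma op_L_abs_L2:
  assumes d: "dom_repr U g2 g3"
  shows "sq_integrable (op_L_repr Vp Vm k \<omega> z U g2 g3)"
    and "op_L Vp Vm k \<omega> (abs_L2 U) - z *\<^sub>n abs_L2 U = abs_L2 (op_L_repr Vp Vm k \<omega> z U g2 g3)"
proof -
  have U: "sq_integrable U" "sq_integrable g2" "sq_integrable g3"
    and wd: "weak_deriv (abs_L2 (\<lambda>x. U x $ 2)) = abs_L2 g2" "weak_deriv (abs_L2 (\<lambda>x. U x $ 3)) = abs_L2 g3"
    using d by (auto simp: dom_repr_def intro: weak_deriv_eq)
  note Un = sq_integrable_nth[OF U(1)]
  define a where "a x = (vector [\<i> * of_real k * U x $ 3, - g3 x, - (\<i> * of_real k) * U x $ 1 + g2 x] :: complex^3)"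
    for x :: real
  have sa: "sq_integrable a"
    unfolding a_def by (intro sq_integrable_vector3 sq_integrable_add sq_integrable_cmult sq_integrable_uminus Un U)
  have A: "op_A k (abs_L2 U) = abs_L2 a"
    unfolding op_A_def component_abs_L2[OF U(1)] wd a_def
    by (simp only: abs_L2_arith Un U sq_integrable_add sq_integrable_cmult sq_integrable_uminus)
  define b where "b x = mat_B Vp Vm x \<omega> *v U x" for x
  have sV: "sq_integrable (\<lambda>x. \<i> * V_layers Vp Vm x \<omega> * U x $ i)" for i
  proof -
    have "(\<lambda>x. \<i> * V_layers Vp Vm x \<omega> * U x $ i) =
        (\<lambda>x. if 0 < x then (\<i> * Vp \<omega>) * U x $ i else (\<i> * Vm \<omega>) * U x $ i)"
      by (auto simp: V_layers_def)
    then show ?thesis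
      by (simp only:) (intro sq_integrable_If sq_integrable_cmult Un)
  qed
  have sb: "sq_integrable b"
    unfolding b_def mat_B_mult by (intro sq_integrable_vector3 sV sq_integrable_cmult Un)
  have B: "op_B Vp Vm \<omega> (abs_L2 U) = abs_L2 b"
    using U by (simp add: op_B.abs_eq b_def[abs_def])
  define c where "c x = z *s U x" for x
  have sc: "sq_integrable c"
    unfolding c_def by (rule sq_integrable_bounded_linear[OF bounded_linear_cmult_vec U(1)])
  have C: "z *\<^sub>n abs_L2 U = abs_L2 c"
    using U by (simp add: cmul_vec.abs_eq c_def[abs_def])
  have eq: "op_L_repr Vp Vm k \<omega> z U g2 g3 = (\<lambda>x. a x - b x - c x)"
    by (simp add: fun_eq_iff op_L_repr_def a_def b_def c_def mat_B_mult vec_eq_iff forall_3 algebra_simps)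
  show "sq_integrable (op_L_repr Vp Vm k \<omega> z U g2 g3)"
    unfolding eq by (intro sq_integrable_diff sa sb sc)
  show "op_L Vp Vm k \<omega> (abs_L2 U) - z *\<^sub>n abs_L2 U = abs_L2 (op_L_repr Vp Vm k \<omega> z U g2 g3)"
    unfolding eq op_L_def A B C using sa sb sc by (simp add: minus_L2.abs_eq sq_integrable_diff)
qed

lemma op_L_lincomb:
  fixes c :: real
  assumes "u \<in> dom_A" "v \<in> dom_A"
  shows "c *\<^sub>R u + v \<in> dom_A"
    and "op_L Vp Vm k \<omega> (c *\<^sub>R u + v) - z *\<^sub>n (c *\<^sub>R u + v) =
      c *\<^sub>R (op_L Vp Vm k \<omega> u - z *\<^sub>n u) + (op_L Vp Vm k \<omega> v - z *\<^sub>n v)"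
proof -
  obtain U g2 g3 where U: "dom_repr U g2 g3" "u = abs_L2 U" using dom_A_repr[OF assms(1)] .
  obtain V h2 h3 where V: "dom_repr V h2 h3" "v = abs_L2 V" using dom_A_repr[OF assms(2)] .
  have sq: "sq_integrable U" "sq_integrable g2" "sq_integrable g3" "sq_integrable V" "sq_integrable h2" "sq_integrable h3"
    using U V by (auto simp: dom_repr_def)
  define W where "W x = c *\<^sub>R U x + V x" for x
  have sW: "sq_integrable W"
    unfolding W_def by (intro sq_integrable_add sq_integrable_bounded_linear[OF bounded_linear_scaleR_right] sq)
  have Wi: "(\<lambda>x. W x $ i) = (\<lambda>x. complex_of_real c * U x $ i + V x $ i)" for i
    by (simp add: W_def fun_eq_iff scaleR_conv_of_real[where 'a = complex])
  have W: "dom_repr W (\<lambda>x. complex_of_real c * g2 x + h2 x) (\<lambda>x. complex_of_real c * g3 x + h3 x)"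
    unfolding dom_repr_def Wi using U(1) V(1) sW
    by (auto simp: dom_repr_def intro!: is_weak_deriv_lincomb sq_integrable_add sq_integrable_cmult
        sq_integrable_nth)
  have uv: "c *\<^sub>R u + v = abs_L2 W"
    using sq by (simp add: U V scaleR_L2.abs_eq plus_L2.abs_eq W_def[abs_def]
        sq_integrable_bounded_linear[OF bounded_linear_scaleR_right])
  show "c *\<^sub>R u + v \<in> dom_A"
    unfolding uv by (rule dom_repr_dom_A[OF W])
  have "op_L_repr Vp Vm k \<omega> z W (\<lambda>x. complex_of_real c * g2 x + h2 x) (\<lambda>x. complex_of_real c * g3 x + h3 x) =
      (\<lambda>x. c *\<^sub>R op_L_repr Vp Vm k \<omega> z U g2 g3 x + op_L_repr Vp Vm k \<omega> z V h2 h3 x)"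
    by (simp add: fun_eq_iff op_L_repr_def W_def vec_eq_iff forall_3 scaleR_conv_of_real[where 'a = complex] algebra_simps)
  then show "op_L Vp Vm k \<omega> (c *\<^sub>R u + v) - z *\<^sub>n (c *\<^sub>R u + v) =
      c *\<^sub>R (op_L Vp Vm k \<omega> u - z *\<^sub>n u) + (op_L Vp Vm k \<omega> v - z *\<^sub>n v)"
    unfolding uv unfolding op_L_abs_L2(2)[OF W] U(2) V(2) op_L_abs_L2(2)[OF U(1)] op_L_abs_L2(2)[OF V(1)]
    using op_L_abs_L2(1)[OF U(1)] op_L_abs_L2(1)[OF V(1)]
    by (simp add: scaleR_L2.abs_eq plus_L2.abs_eq
        sq_integrable_bounded_linear[OF bounded_linear_scaleR_right])
qed

text \<open>The norm bound is asked of just one preimage of each f; injectivity identifies that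
  preimage with the value of the inverse, which is therefore bounded. Real linearity of the inverse
  is inherited from the operator.\<close>

lemma resolvent_setI:
  assumes lin: "\<And>u v c. u \<in> D \<Longrightarrow> v \<in> D \<Longrightarrow> c *\<^sub>R u + v \<in> D \<and>
      T (c *\<^sub>R u + v) - z *\<^sub>n (c *\<^sub>R u + v) = c *\<^sub>R (T u - z *\<^sub>n u) + (T v - z *\<^sub>n v)"
    and inj: "\<And>u. u \<in> D \<Longrightarrow> T u - z *\<^sub>n u = 0 \<Longrightarrow> u = 0"
    and surj: "\<And>f. \<exists>u\<in>D. T u - z *\<^sub>n u = f \<and> norm u \<le> C * norm f"
  shows "z \<in> resolvent_set D T"
proof -
  define S where "S = (\<lambda>u. T u - z *\<^sub>n u)"
  have S: "c *\<^sub>R u + v \<in> D" "S (c *\<^sub>R u + v) = c *\<^sub>R S u + S v" if "u \<in> D" "v \<in> D" for u v c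
    using lin[OF that] by (auto simp: S_def)
  have injS: "inj_on S D"
  proof (rule inj_onI)
    fix u v assume uv: "u \<in> D" "v \<in> D" "S u = S v"
    then have "(-1) *\<^sub>R u + v \<in> D" "S ((-1) *\<^sub>R u + v) = 0"
      using S[of u v "-1"] by auto
    then have "(-1) *\<^sub>R u + v = 0"
      unfolding S_def by (rule inj)
    then show "u = v" by simp
  qed
  define R where "R = inv_into D S"
  have R: "R f \<in> D" "S (R f) = f" "norm (R f) \<le> norm f * C" for f
  proof -
    obtain u where u: "u \<in> D" "S u = f" "norm u \<le> C * norm f"
      using surj[of f] by (auto simp: S_def)
    then have "R f = u" using injS by (auto simp: R_def)
    then show "R f \<in> D" "S (R f) = f" "norm (R f) \<le> norm f * C"
      using u by (simp_all add: mult.commute)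
  qed
  have Rlin: "R (c *\<^sub>R f + g) = c *\<^sub>R R f + R g" for c f g
  proof -
    have *: "S (c *\<^sub>R R f + R g) = c *\<^sub>R f + g" "c *\<^sub>R R f + R g \<in> D"
      using S[of "R f" "R g" c] R(1,2) by simp_all
    show ?thesis
      by (rule inj_onD[OF injS]) (simp_all only: * R(1,2))
  qed
  have R0: "R 0 = 0" using Rlin[of "-1" 0 0] by simp
  have "bounded_linear R"
  proof (rule bounded_linear_intro)
    show "R (f + g) = R f + R g" for f g using Rlin[of 1 f g] by simp
    show "R (c *\<^sub>R f) = c *\<^sub>R R f" for c f using Rlin[of c f 0] R0 by simp
    show "norm (R f) \<le> norm f * C" for f by (rule R)
  qed
  moreover have "bij_betw S D UNIV"
    using injS R by (auto simp: bij_betw_def image_iff) (metis R(1,2))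
  ultimately show ?thesis
    by (simp add: resolvent_set_def S_def R_def)
qed

text \<open>The minus half line is turned into a plus half line by \<open>(u\<^sub>2, u\<^sub>3)(x) \<mapsto> (- u\<^sub>2, u\<^sub>3)(- x)\<close>.\<close>

lemma kernel_half_line_solutions:
  assumes u: "u \<in> dom_A" "op_L Vp Vm k \<omega> u - z *\<^sub>n u = 0"
    and ap: "ap = \<i> * Vp \<omega> + z" "ap \<noteq> 0" and am: "am = \<i> * Vm \<omega> + z" "am \<noteq> 0"
    and mp: "mp\<^sup>2 = (of_real k)\<^sup>2 - ap * (\<i> * \<omega> + z)" and mm: "mm\<^sup>2 = (of_real k)\<^sup>2 - am * (\<i> * \<omega> + z)"
  obtains v w where "half_line_solution ap mp v w"
    "half_line_solution am mm (\<lambda>x. - v (- x)) (\<lambda>x. w (- x))"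
    "v 0 = 0 \<Longrightarrow> w 0 = 0 \<Longrightarrow> u = 0"
proof -
  obtain U g2 g3 where U: "dom_repr U g2 g3" "u = abs_L2 U" using dom_A_repr[OF u(1)] .
  have sq: "sq_integrable U" "sq_integrable g2" "sq_integrable g3"
    using U by (auto simp: dom_repr_def)
  obtain v where v: "AC_on UNIV v g2" "AE x in lborel. U x $ 2 = v x"
    using U(1) is_weak_deriv_iff_AC[OF sq_integrable_nth[OF sq(1)] sq(2)] by (auto simp: dom_repr_def)
  obtain w where w: "AC_on UNIV w g3" "AE x in lborel. U x $ 3 = w x"
    using U(1) is_weak_deriv_iff_AC[OF sq_integrable_nth[OF sq(1)] sq(3)] by (auto simp: dom_repr_def)
  have cv: "continuous_on UNIV v" and cw: "continuous_on UNIV w"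
    using v w by (auto intro: AC_on_UNIV_continuous)
  have sv: "sq_integrable v" and sw: "sq_integrable w"
    using v(2) w(2) by (auto intro!: sq_integrable_cong_AE[OF sq_integrable_nth[OF sq(1)]]
        borel_measurable_continuous_onI cv cw)
  define a where "a x = \<i> * V_layers Vp Vm x \<omega> + z" for x
  have a_eq: "a x = (if 0 < x then ap else am)" for x
    by (simp add: a_def V_layers_def ap am)
  define b where "b = \<i> * \<omega> + z"
  have "abs_L2 (op_L_repr Vp Vm k \<omega> z U g2 g3) = abs_L2 (\<lambda>x. 0)"
    using u(2) unfolding U(2) op_L_abs_L2(2)[OF U(1)] zero_L2_abs .
  then have "AE x in lborel. op_L_repr Vp Vm k \<omega> z U g2 g3 x = 0"
    using op_L_abs_L2(1)[OF U(1)] by (simp add: abs_L2_eq_iff sq_integrable_zero)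
  \<comment> \<open>The first component is solved for \<open>U x $ 1\<close>, which needs a nonzero
    coefficient \<open>a x\<close>. Inserting the result into the third component produces k^2 - a
    b, that is, the square of the exponent.\<close>
  then have eqs: "AE x in lborel. U x $ 1 = \<i> * of_real k * w x / a x \<and> U x $ 2 = v x \<and> U x $ 3 = w x \<and>
      g2 x = - (((of_real k)\<^sup>2 - a x * b) / a x) * w x \<and> g3 x = - a x * v x"
    using v(2) w(2)
  proof eventually_elim
    case (elim x)
    have ax: "a x \<noteq> 0" using ap am by (simp add: a_eq)
    have e: "\<i> * of_real k * w x - a x * U x $ 1 = 0" "- g3 x - a x * v x = 0"
      "- (\<i> * of_real k) * U x $ 1 + g2 x - b * w x = 0"
      using elim by (auto simp: op_L_repr_def vec_eq_iff forall_3 a_def b_def)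
    have u1: "U x $ 1 = \<i> * of_real k * w x / a x"
      using e(1) ax by (simp add: field_simps)
    have "g2 x = b * w x + (\<i> * of_real k) * (\<i> * of_real k * w x / a x)"
      using e(3) unfolding u1 by (simp add: algebra_simps)
    also have "\<dots> = - (((of_real k)\<^sup>2 - a x * b) / a x) * w x"
      using ax by (simp add: field_simps power2_eq_square)
    finally have "g2 x = - (((of_real k)\<^sup>2 - a x * b) / a x) * w x" .
    moreover have "g3 x = - a x * v x"
      using arg_cong[OF e(2), of uminus] by (simp add: eq_neg_iff_add_eq_0 add.commute)
    ultimately show ?case using u1 elim by blast
  qed
  \<comment> \<open>At x = 0 the coefficient takes its left value \<open>am\<close>, so the point 0
    is discarded as a null set here; on the left half line the equations hold with the right
    coefficient up to 0.\<close>
  have "AC_on {0..} v (\<lambda>x. - (mp\<^sup>2 / ap) * w x)"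
  proof (rule AC_on_cong_AE[OF AC_on_subset[OF v(1)] is_interval_ci])
    show "AE x in lborel. x \<in> {0..} \<longrightarrow> g2 x = - (mp\<^sup>2 / ap) * w x"
      using eqs AE_lborel_singleton[of 0] by eventually_elim (auto simp: a_eq mp b_def)
  qed simp
  moreover have "AC_on {0..} w (\<lambda>x. - ap * v x)"
  proof (rule AC_on_cong_AE[OF AC_on_subset[OF w(1)] is_interval_ci])
    show "AE x in lborel. x \<in> {0..} \<longrightarrow> g3 x = - ap * v x"
      using eqs AE_lborel_singleton[of 0] by eventually_elim (auto simp: a_eq)
  qed simp
  ultimately have plus: "half_line_solution ap mp v w"
    using ap sv sw cv cw by (simp add: half_line_solution_def)
  have ref: "uminus ` {..0} = {0::real..}" by simp
  have "AC_on {..0} v (\<lambda>x. - (mm\<^sup>2 / am) * w x)"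
  proof (rule AC_on_cong_AE[OF AC_on_subset[OF v(1)] is_interval_ic])
    show "AE x in lborel. x \<in> {..0} \<longrightarrow> g2 x = - (mm\<^sup>2 / am) * w x"
      using eqs by eventually_elim (auto simp: a_eq mm b_def)
  qed simp
  from AC_on_cmult[OF AC_on_reflect[OF this], of "-1"]
  have "AC_on {0..} (\<lambda>x. - v (- x)) (\<lambda>x. - (mm\<^sup>2 / am) * w (- x))"
    unfolding ref by simp
  moreover have "AC_on {..0} w (\<lambda>x. - am * v x)"
  proof (rule AC_on_cong_AE[OF AC_on_subset[OF w(1)] is_interval_ic])
    show "AE x in lborel. x \<in> {..0} \<longrightarrow> g3 x = - am * v x"
      using eqs by eventually_elim (auto simp: a_eq)
  qed simp
  from AC_on_reflect[OF this]
  have "AC_on {0..} (\<lambda>x. w (- x)) (\<lambda>x. - am * - v (- x))"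
    unfolding ref by simp
  moreover have "continuous_on UNIV (\<lambda>x. - v (- x))" "continuous_on UNIV (\<lambda>x. w (- x))"
    by (auto intro!: continuous_intros continuous_on_compose2[OF cv] continuous_on_compose2[OF cw])
  ultimately have minus: "half_line_solution am mm (\<lambda>x. - v (- x)) (\<lambda>x. w (- x))"
    using am sv sw by (simp add: half_line_solution_def sq_integrable_reflect sq_integrable_uminus)
  have "u = 0" if 0: "v 0 = 0" "w 0 = 0"
  proof -
    have vw: "v x = 0 \<and> w x = 0" for x
    proof (cases "0 \<le> x")
      case True
      then show ?thesis using half_line_solution.zero_if_vanishes_at_0[OF plus 0] by simp
    next
      case False
      then show ?thesis
        using half_line_solution.zero_if_vanishes_at_0[OF minus, of "- x"] 0 by simp
    qed
    have "AE x in lborel. U x = 0"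
      using eqs by eventually_elim (simp add: vec_eq_iff forall_3 vw)
    then show ?thesis
      using sq(1) unfolding U(2) zero_L2_abs by (simp add: abs_L2_eq_iff sq_integrable_zero)
  qed
  with plus minus show ?thesis using that by blast
qed

section \<open>Solving the resolvent equation\<close>

lemma norm_combination_le:
  fixes c d x y :: complex
  assumes "norm x \<le> X" "norm y \<le> Y"
  shows "norm (c * x + d * y) \<le> norm c * X + norm d * Y"
  using assms by (intro norm_triangle_le add_mono) (simp_all add: norm_mult mult_left_mono)

text \<open>The combinations p = a v + \<mu> w and q = a v - \<mu> w decouple the system into one
  decaying and one growing scalar equation, with sources a h2 + \<mu> h3 and a h2 - \<mu> h3. The
  values at 0 are estimated too, because they control the later correction at the interface.\<close>

lemma solve_system:
  assumes a: "a \<noteq> 0" and \<mu>: "Re \<mu> > 0"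
  obtains C where "C \<ge> 0"
    "\<And>h2 h3. sq_integrable h2 \<Longrightarrow> sq_integrable h3 \<Longrightarrow> \<exists>v w. sq_integrable v \<and> sq_integrable w \<and>
      AC_on UNIV v (\<lambda>x. - (\<mu>\<^sup>2 / a) * w x + h2 x) \<and> AC_on UNIV w (\<lambda>x. - a * v x + h3 x) \<and>
      norm (abs_L2 v) \<le> C * (norm (abs_L2 h2) + norm (abs_L2 h3)) \<and>
      norm (abs_L2 w) \<le> C * (norm (abs_L2 h2) + norm (abs_L2 h3)) \<and>
      norm (v 0) \<le> C * (norm (abs_L2 h2) + norm (abs_L2 h3)) \<and>
      norm (w 0) \<le> C * (norm (abs_L2 h2) + norm (abs_L2 h3))"
proof -
  have \<mu>0: "\<mu> \<noteq> 0" using \<mu> by auto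
  define K where "K = norm a + norm \<mu>"
  \<comment> \<open>Sum of the constants in the L^2 bound and in the bound at 0 of the scalar
    equations, so that one constant serves both.\<close>
  define c1 where "c1 = 1 / Re \<mu> + sqrt (1 / Re \<mu>)"
  define L where "L = norm (1 / (2 * a)) + norm (1 / (2 * \<mu>))"
  define C where "C = 2 * L * (c1 * K)"
  have pos: "0 \<le> K" "0 \<le> c1" "0 \<le> L" using \<mu> by (auto simp: K_def c1_def L_def)
  have "\<exists>v w. sq_integrable v \<and> sq_integrable w \<and>
      AC_on UNIV v (\<lambda>x. - (\<mu>\<^sup>2 / a) * w x + h2 x) \<and> AC_on UNIV w (\<lambda>x. - a * v x + h3 x) \<and>
      norm (abs_L2 v) \<le> C * S \<and> norm (abs_L2 w) \<le> C * S \<and> norm (v 0) \<le> C * S \<and> norm (w 0) \<le> C * S"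
    if h: "sq_integrable h2" "sq_integrable h3" and S_def: "S = norm (abs_L2 h2) + norm (abs_L2 h3)"
    for h2 h3 :: "real \<Rightarrow> complex" and S
  proof -
    have solve: "\<exists>y. sq_integrable y \<and> AC_on UNIV y (\<lambda>x. s * \<mu> * y x + (a * h2 x + t * \<mu> * h3 x)) \<and>
        norm (abs_L2 y) \<le> c1 * K * S \<and> norm (y 0) \<le> c1 * K * S"
      if st: "s = -1 \<and> t = 1 \<or> s = 1 \<and> t = -1" for s t :: complex
    proof -
      define f where "f x = a * h2 x + t * \<mu> * h3 x" for x
      have f: "sq_integrable f"
        unfolding f_def by (intro sq_integrable_add sq_integrable_cmult h)
      have "norm (f x) \<le> norm a * norm (h2 x) + norm \<mu> * norm (h3 x)" for x
        using norm_triangle_ineq[of "a * h2 x" "t * \<mu> * h3 x"] st by (auto simp: f_def norm_mult)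
      then have "norm (abs_L2 f) \<le> norm a * norm (abs_L2 h2) + norm \<mu> * norm (abs_L2 h3)"
        by (intro norm_abs_L2_le_sum2 f h) auto
      also have "\<dots> \<le> K * S"
        by (simp add: K_def S_def algebra_simps)
      finally have fK: "norm (abs_L2 f) \<le> K * S" .
      obtain y where y: "sq_integrable y" "AC_on UNIV y (\<lambda>x. s * \<mu> * y x + f x)"
        "norm (abs_L2 y) \<le> 1 / Re \<mu> * norm (abs_L2 f)"
        "norm (y 0) \<le> sqrt (1 / Re \<mu>) * norm (abs_L2 f)"
        using st
      proof
        assume "s = -1 \<and> t = 1"
        then show ?thesis using solve_decaying[OF \<mu> f] that by auto
      next
        assume "s = 1 \<and> t = -1"
        then show ?thesis using solve_growing[OF \<mu> f] that by auto
      qed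
      have "r * norm (abs_L2 f) \<le> c1 * (K * S)" if "r \<le> c1" for r
        using that pos by (intro mult_mono fK) auto
      from this[of "1 / Re \<mu>"] this[of "sqrt (1 / Re \<mu>)"]
      have "1 / Re \<mu> * norm (abs_L2 f) \<le> c1 * (K * S)" "sqrt (1 / Re \<mu>) * norm (abs_L2 f) \<le> c1 * (K * S)"
        using \<mu> by (simp_all only: c1_def) simp_all
      then have "norm (abs_L2 y) \<le> c1 * K * S" "norm (y 0) \<le> c1 * K * S"
        using y(3,4) by (simp_all add: mult.assoc)
      then show ?thesis using y(1,2) unfolding f_def by blast
    qed
    obtain p where p: "sq_integrable p" "AC_on UNIV p (\<lambda>x. (-1) * \<mu> * p x + (a * h2 x + 1 * \<mu> * h3 x))"
      "norm (abs_L2 p) \<le> c1 * K * S" "norm (p 0) \<le> c1 * K * S"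
      using solve[of "-1" 1] by blast
    obtain q where q: "sq_integrable q" "AC_on UNIV q (\<lambda>x. 1 * \<mu> * q x + (a * h2 x + (-1) * \<mu> * h3 x))"
      "norm (abs_L2 q) \<le> c1 * K * S" "norm (q 0) \<le> c1 * K * S"
      using solve[of 1 "-1"] by blast
    define v where "v x = 1 / (2 * a) * p x + 1 / (2 * a) * q x" for x
    define w where "w x = 1 / (2 * \<mu>) * p x + (- (1 / (2 * \<mu>))) * q x" for x
    have sq: "sq_integrable v" "sq_integrable w"
      unfolding v_def w_def by (intro sq_integrable_add sq_integrable_cmult p q)+
    have ACv: "AC_on UNIV v (\<lambda>x. - (\<mu>\<^sup>2 / a) * w x + h2 x)"
      by (rule AC_on_cong[OF AC_on_lincomb[OF p(2) q(2), of "1 / (2 * a)" "1 / (2 * a)"] is_interval_univ])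
         (use a \<mu>0 in \<open>simp_all add: v_def w_def field_simps power2_eq_square\<close>)
    have ACw: "AC_on UNIV w (\<lambda>x. - a * v x + h3 x)"
      by (rule AC_on_cong[OF AC_on_lincomb[OF p(2) q(2), of "1 / (2 * \<mu>)" "- (1 / (2 * \<mu>))"] is_interval_univ])
         (use a \<mu>0 in \<open>simp_all add: v_def w_def field_simps power2_eq_square\<close>)
    have nv: "norm (abs_L2 v) \<le> norm (1 / (2 * a)) * norm (abs_L2 p) + norm (1 / (2 * a)) * norm (abs_L2 q)"
      unfolding v_def by (intro norm_abs_L2_le_sum2 sq[unfolded v_def] p q norm_combination_le) auto
    have nw: "norm (abs_L2 w) \<le> norm (1 / (2 * \<mu>)) * norm (abs_L2 p) + norm (- (1 / (2 * \<mu>))) * norm (abs_L2 q)"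
      unfolding w_def by (intro norm_abs_L2_le_sum2 sq[unfolded w_def] p q norm_combination_le) auto
    have v0: "norm (v 0) \<le> norm (1 / (2 * a)) * norm (p 0) + norm (1 / (2 * a)) * norm (q 0)"
      unfolding v_def by (intro norm_combination_le) auto
    have w0: "norm (w 0) \<le> norm (1 / (2 * \<mu>)) * norm (p 0) + norm (- (1 / (2 * \<mu>))) * norm (q 0)"
      unfolding w_def by (intro norm_combination_le) auto
    have est: "l * P + l * Q \<le> C * S"
      if "0 \<le> l" "l \<le> L" "P \<le> c1 * K * S" "Q \<le> c1 * K * S" for l P Q :: real
    proof -
      have "0 \<le> c1 * K * S" using pos by (simp add: S_def)
      have "l * P \<le> l * (c1 * K * S)" "l * Q \<le> l * (c1 * K * S)"
        using that by (auto intro: mult_left_mono)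
      moreover have "l * (c1 * K * S) \<le> L * (c1 * K * S)"
        using that \<open>0 \<le> c1 * K * S\<close> by (intro mult_right_mono) auto
      ultimately show ?thesis by (simp add: C_def algebra_simps)
    qed
    have L: "norm (1 / (2 * a)) \<le> L" "norm (1 / (2 * \<mu>)) \<le> L"
      by (auto simp: L_def simp del: norm_divide norm_mult)
    have "norm (abs_L2 v) \<le> C * S" "norm (v 0) \<le> C * S"
      by (rule order_trans[OF nv est[OF norm_ge_zero L(1) p(3) q(3)]]
          order_trans[OF v0 est[OF norm_ge_zero L(1) p(4) q(4)]])+
    moreover have "norm (abs_L2 w) \<le> C * S" "norm (w 0) \<le> C * S"
      using order_trans[OF nw[unfolded norm_minus_cancel] est[OF norm_ge_zero L(2) p(3) q(3)]]
        order_trans[OF w0[unfolded norm_minus_cancel] est[OF norm_ge_zero L(2) p(4) q(4)]]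
      by blast+
    ultimately show ?thesis using sq ACv ACw by blast
  qed
  moreover have "0 \<le> C" using pos by (simp add: C_def)
  ultimately show ?thesis using that by blast
qed

section \<open>Matching the two layers\<close>

lemma sq_integrable_exp_half_line:
  assumes "Re \<mu> > 0"
  shows "sq_integrable (\<lambda>x. if 0 < x then exp (- \<mu> * of_real x) else 0)"
proof -
  let ?e = "\<lambda>x. if 0 < x then exp (- \<mu> * complex_of_real x) else 0"
  have [measurable]: "?e \<in> borel_measurable borel"
    by (intro measurable_If borel_measurable_continuous_onI continuous_intros) auto
  have "(\<integral>\<^sup>+x. ennreal ((norm (?e x))\<^sup>2) \<partial>lborel) \<le>
      (\<integral>\<^sup>+x. ennreal (indicator {..x} 0 * exp (- (2 * Re \<mu>) * (x - 0))) \<partial>lborel)"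
    by (intro nn_integral_mono ennreal_leI)
       (auto simp: power2_eq_square simp flip: exp_add)
  also have "\<dots> < \<infinity>"
    using decay_kernel_integral(1)[of "2 * Re \<mu>" 0] assms by simp
  finally have "integrable lborel (\<lambda>x. (norm (?e x))\<^sup>2)"
    by (intro integrableI_bounded) auto
  then show ?thesis by (simp add: sq_integrable_def)
qed

lemma AC_on_exp: "AC_on S (\<lambda>x. exp (l * of_real x)) (\<lambda>x. l * exp (l * of_real x))"
  unfolding AC_on_def
proof (intro ballI impI)
  fix a b :: real assume "a \<le> b"
  have "((\<lambda>x. exp (l * of_real x)) has_vector_derivative l * exp (l * of_real x)) (at x within {a..b})" for x :: real
    by (rule has_vector_derivative_real_field) (auto intro!: derivative_eq_intros)
  then show "((\<lambda>x. l * exp (l * of_real x)) has_integral exp (l * of_real b) - exp (l * of_real a)) {a..b}"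
    using \<open>a \<le> b\<close> by (intro fundamental_theorem_of_calculus)
qed

text \<open>Whole-line solutions of the two constant-coefficient systems are corrected by decaying
  exponentials so that they match at \<open>0\<close>; the matching determinant is \<open>mp * am + mm * ap\<close>.\<close>

lemma solve_layered_system:
  assumes a: "ap \<noteq> 0" "am \<noteq> 0" and m: "Re mp > 0" "Re mm > 0" and D: "mp * am + mm * ap \<noteq> 0"
  obtains C where "C \<ge> 0"
    "\<And>h2 h3. sq_integrable h2 \<Longrightarrow> sq_integrable h3 \<Longrightarrow> \<exists>v w. sq_integrable v \<and> sq_integrable w \<and>
      AC_on UNIV v (\<lambda>x. if 0 < x then - (mp\<^sup>2 / ap) * w x + h2 x else - (mm\<^sup>2 / am) * w x + h2 x) \<and>
      AC_on UNIV w (\<lambda>x. if 0 < x then - ap * v x + h3 x else - am * v x + h3 x) \<and>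
      norm (abs_L2 v) \<le> C * (norm (abs_L2 h2) + norm (abs_L2 h3)) \<and>
      norm (abs_L2 w) \<le> C * (norm (abs_L2 h2) + norm (abs_L2 h3))"
proof -
  obtain Cp where Cp: "Cp \<ge> 0" "\<And>h2 h3. sq_integrable h2 \<Longrightarrow> sq_integrable h3 \<Longrightarrow>
      \<exists>v w. sq_integrable v \<and> sq_integrable w \<and>
      AC_on UNIV v (\<lambda>x. - (mp\<^sup>2 / ap) * w x + h2 x) \<and> AC_on UNIV w (\<lambda>x. - ap * v x + h3 x) \<and>
      norm (abs_L2 v) \<le> Cp * (norm (abs_L2 h2) + norm (abs_L2 h3)) \<and>
      norm (abs_L2 w) \<le> Cp * (norm (abs_L2 h2) + norm (abs_L2 h3)) \<and>
      norm (v 0) \<le> Cp * (norm (abs_L2 h2) + norm (abs_L2 h3)) \<and>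
      norm (w 0) \<le> Cp * (norm (abs_L2 h2) + norm (abs_L2 h3))"
    using solve_system[OF a(1) m(1)] by blast
  obtain Cm where Cm: "Cm \<ge> 0" "\<And>h2 h3. sq_integrable h2 \<Longrightarrow> sq_integrable h3 \<Longrightarrow>
      \<exists>v w. sq_integrable v \<and> sq_integrable w \<and>
      AC_on UNIV v (\<lambda>x. - (mm\<^sup>2 / am) * w x + h2 x) \<and> AC_on UNIV w (\<lambda>x. - am * v x + h3 x) \<and>
      norm (abs_L2 v) \<le> Cm * (norm (abs_L2 h2) + norm (abs_L2 h3)) \<and>
      norm (abs_L2 w) \<le> Cm * (norm (abs_L2 h2) + norm (abs_L2 h3)) \<and>
      norm (v 0) \<le> Cm * (norm (abs_L2 h2) + norm (abs_L2 h3)) \<and>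
      norm (w 0) \<le> Cm * (norm (abs_L2 h2) + norm (abs_L2 h3))"
    using solve_system[OF a(2) m(2)] by blast
  define Dt where "Dt = mp * am + mm * ap"
  have Dt: "Dt \<noteq> 0" using D by (simp add: Dt_def)
  define Ep where "Ep x = (if 0 < x then exp (- mp * of_real x) else 0)" for x :: real
  define Em where "Em x = (if 0 < - x then exp (- mm * of_real (- x)) else 0)" for x :: real
  have sE: "sq_integrable Ep" "sq_integrable Em"
    using sq_integrable_exp_half_line[OF m(1)] sq_integrable_reflect(1)[OF sq_integrable_exp_half_line[OF m(2)]]
    unfolding Ep_def Em_def by simp_all
  define Cc where "Cc = (norm am + norm mm + norm mp + norm ap) * (Cp + Cm) / norm Dt"
  define R where "R = (norm ap + norm am + norm mp + norm mm) * (norm (abs_L2 Ep) + norm (abs_L2 Em))"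
  define C where "C = Cp + Cm + Cc * R"
  have pos: "0 \<le> Cc" "0 \<le> R" using Cp(1) Cm(1) by (auto simp: Cc_def R_def)
  have "\<exists>v w. sq_integrable v \<and> sq_integrable w \<and>
      AC_on UNIV v (\<lambda>x. if 0 < x then - (mp\<^sup>2 / ap) * w x + h2 x else - (mm\<^sup>2 / am) * w x + h2 x) \<and>
      AC_on UNIV w (\<lambda>x. if 0 < x then - ap * v x + h3 x else - am * v x + h3 x) \<and>
      norm (abs_L2 v) \<le> C * S \<and> norm (abs_L2 w) \<le> C * S"
    if h: "sq_integrable h2" "sq_integrable h3" and S_def: "S = norm (abs_L2 h2) + norm (abs_L2 h3)"
    for h2 h3 :: "real \<Rightarrow> complex" and S
  proof -
    obtain vp wp where p: "sq_integrable vp" "sq_integrable wp"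
      "AC_on UNIV vp (\<lambda>x. - (mp\<^sup>2 / ap) * wp x + h2 x)" "AC_on UNIV wp (\<lambda>x. - ap * vp x + h3 x)"
      "norm (abs_L2 vp) \<le> Cp * S" "norm (abs_L2 wp) \<le> Cp * S" "norm (vp 0) \<le> Cp * S" "norm (wp 0) \<le> Cp * S"
      using Cp(2)[OF h] unfolding S_def by blast
    obtain vm wm where n: "sq_integrable vm" "sq_integrable wm"
      "AC_on UNIV vm (\<lambda>x. - (mm\<^sup>2 / am) * wm x + h2 x)" "AC_on UNIV wm (\<lambda>x. - am * vm x + h3 x)"
      "norm (abs_L2 vm) \<le> Cm * S" "norm (abs_L2 wm) \<le> Cm * S" "norm (vm 0) \<le> Cm * S" "norm (wm 0) \<le> Cm * S"
      using Cm(2)[OF h] unfolding S_def by blast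
    have S0: "0 \<le> S" by (simp add: S_def)
    define d2 d3 where "d2 = vm 0 - vp 0" and "d3 = wm 0 - wp 0"
    \<comment> \<open>Cramer's rule for \<open>c1 * mp - c2 * mm = d2\<close> and
      \<open>c1 * ap + c2 * am = d3\<close>. The initial values of the decaying homogeneous
      solutions are (mp, ap) on the right and (mm, -am) on the left; d2 and d3 are the jumps to be
      removed.\<close>
    define c1 c2 where "c1 = (am * d2 + mm * d3) / Dt" and "c2 = ((- ap) * d2 + mp * d3) / Dt"
    have match: "vp 0 + c1 * mp = vm 0 + c2 * mm" "wp 0 + c1 * ap = wm 0 - c2 * am"
    proof -
      have "Dt * (c1 * mp - c2 * mm) = Dt * d2" "Dt * (c1 * ap + c2 * am) = Dt * d3"
        using Dt by (simp_all add: c1_def c2_def right_diff_distrib distrib_left)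
          (simp_all add: Dt_def algebra_simps)
      then have "c1 * mp - c2 * mm = d2" "c1 * ap + c2 * am = d3" using Dt by simp_all
      then show "vp 0 + c1 * mp = vm 0 + c2 * mm" "wp 0 + c1 * ap = wm 0 - c2 * am"
        by (auto simp: d2_def d3_def algebra_simps)
    qed
    have d: "norm d2 \<le> (Cp + Cm) * S" "norm d3 \<le> (Cp + Cm) * S"
      using p(7,8) n(7,8) norm_triangle_ineq4[of "vm 0" "vp 0"] norm_triangle_ineq4[of "wm 0" "wp 0"]
      by (simp_all add: d2_def d3_def algebra_simps)
    have c: "norm c1 \<le> Cc * S" "norm c2 \<le> Cc * S"
    proof -
      have K: "norm x * ((Cp + Cm) * S) + norm y * ((Cp + Cm) * S) \<le>
          (norm am + norm mm + norm mp + norm ap) * ((Cp + Cm) * S)"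
        if "norm x + norm y \<le> norm am + norm mm + norm mp + norm ap" for x y :: complex
        using mult_right_mono[OF that, of "(Cp + Cm) * S"] Cp(1) Cm(1) S0 by (simp add: distrib_right)
      have "norm (am * d2 + mm * d3) \<le> (norm am + norm mm + norm mp + norm ap) * ((Cp + Cm) * S)"
        by (rule order_trans[OF norm_combination_le[OF d] K]) simp
      moreover have "norm ((- ap) * d2 + mp * d3) \<le> (norm am + norm mm + norm mp + norm ap) * ((Cp + Cm) * S)"
        by (rule order_trans[OF norm_combination_le[OF d] K]) simp
      ultimately show "norm c1 \<le> Cc * S" "norm c2 \<le> Cc * S"
        unfolding c1_def c2_def Cc_def norm_divide
        by (simp_all only: times_divide_eq_left mult.assoc divide_right_mono norm_ge_zero)
    qed
    define v where "v x = (if 0 < x then vp x + c1 * mp * exp (- mp * of_real x)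
        else vm x + c2 * mm * exp (mm * of_real x))" for x :: real
    define w where "w x = (if 0 < x then wp x + c1 * ap * exp (- mp * of_real x)
        else wm x + (- c2 * am) * exp (mm * of_real x))" for x :: real
    \<comment> \<open>At 0 the definitions use the left branch; the matching conditions make the
      right formula valid there as well.\<close>
    have vw_plus: "v x = vp x + c1 * mp * exp (- mp * of_real x)" "w x = wp x + c1 * ap * exp (- mp * of_real x)"
      if "0 \<le> x" for x
      using that match by (cases "x = 0"; simp add: v_def w_def)+
    have vw_minus: "v x = vm x + c2 * mm * exp (mm * of_real x)" "w x = wm x + (- c2 * am) * exp (mm * of_real x)"
      if "x \<le> 0" for x
      using that by (simp_all add: v_def w_def)
    have ACp: "AC_on {0..} v (\<lambda>x. - (mp\<^sup>2 / ap) * w x + h2 x)" "AC_on {0..} w (\<lambda>x. - ap * v x + h3 x)"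
    proof -
      have "AC_on {0..} (\<lambda>x. vp x + c1 * mp * exp (- mp * of_real x))
          (\<lambda>x. (- (mp\<^sup>2 / ap) * wp x + h2 x) + c1 * mp * (- mp * exp (- mp * of_real x)))"
        by (intro AC_on_add AC_on_cmult AC_on_exp AC_on_subset[OF p(3)]) simp
      then show "AC_on {0..} v (\<lambda>x. - (mp\<^sup>2 / ap) * w x + h2 x)"
        by (rule AC_on_cong[OF _ is_interval_ci])
           (use a in \<open>simp_all add: vw_plus field_simps power2_eq_square\<close>)
      have "AC_on {0..} (\<lambda>x. wp x + c1 * ap * exp (- mp * of_real x))
          (\<lambda>x. (- ap * vp x + h3 x) + c1 * ap * (- mp * exp (- mp * of_real x)))"
        by (intro AC_on_add AC_on_cmult AC_on_exp AC_on_subset[OF p(4)]) simp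
      then show "AC_on {0..} w (\<lambda>x. - ap * v x + h3 x)"
        by (rule AC_on_cong[OF _ is_interval_ci]) (simp_all add: vw_plus algebra_simps)
    qed
    have ACm: "AC_on {..0} v (\<lambda>x. - (mm\<^sup>2 / am) * w x + h2 x)" "AC_on {..0} w (\<lambda>x. - am * v x + h3 x)"
    proof -
      have "AC_on {..0} (\<lambda>x. vm x + c2 * mm * exp (mm * of_real x))
          (\<lambda>x. (- (mm\<^sup>2 / am) * wm x + h2 x) + c2 * mm * (mm * exp (mm * of_real x)))"
        by (intro AC_on_add AC_on_cmult AC_on_exp AC_on_subset[OF n(3)]) simp
      then show "AC_on {..0} v (\<lambda>x. - (mm\<^sup>2 / am) * w x + h2 x)"
        by (rule AC_on_cong[OF _ is_interval_ic])
           (use a in \<open>simp_all add: vw_minus field_simps power2_eq_square\<close>)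
      have "AC_on {..0} (\<lambda>x. wm x + (- c2 * am) * exp (mm * of_real x))
          (\<lambda>x. (- am * vm x + h3 x) + (- c2 * am) * (mm * exp (mm * of_real x)))"
        by (intro AC_on_add AC_on_cmult AC_on_exp AC_on_subset[OF n(4)]) simp
      then show "AC_on {..0} w (\<lambda>x. - am * v x + h3 x)"
        by (rule AC_on_cong[OF _ is_interval_ic]) (simp_all add: vw_minus algebra_simps)
    qed
    have glue: "AC_on UNIV y (\<lambda>x. if 0 < x then f x else g x)"
      if "AC_on {0..} y f" "AC_on {..0} y g" for y f g
    proof (rule AC_on_glue)
      show "AC_on {0..} y (\<lambda>x. if 0 < x then f x else g x)"
      proof (rule AC_on_cong_AE[OF that(1) is_interval_ci])
        show "AE x in lborel. x \<in> {0..} \<longrightarrow> f x = (if 0 < x then f x else g x)"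
          using AE_lborel_singleton[of 0] by eventually_elim auto
      qed
      show "AC_on {..0} y (\<lambda>x. if 0 < x then f x else g x)"
        by (rule AC_on_cong[OF that(2) is_interval_ic]) auto
    qed
    \<comment> \<open>One estimate serves v and w. The decomposition is claimed only off 0, since
      \<open>Ep\<close> and \<open>Em\<close> both vanish at 0 whereas the correction in v and w
      need not.\<close>
    have split: "norm (abs_L2 f) \<le> C * S \<and> sq_integrable f"
      if f: "\<And>x. x \<noteq> 0 \<Longrightarrow> f x = (if 0 < x then fp x else fm x) + e1 * Ep x + e2 * Em x"
        "f \<in> borel_measurable borel"
        and sf: "sq_integrable fp" "sq_integrable fm"
        and b: "norm (abs_L2 fp) \<le> Cp * S" "norm (abs_L2 fm) \<le> Cm * S"
          "norm e1 \<le> Cc * S * (norm ap + norm am + norm mp + norm mm)"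
          "norm e2 \<le> Cc * S * (norm ap + norm am + norm mp + norm mm)"
      for f fp fm e1 e2
    proof -
      define h where "h x = (if 0 < x then fp x else fm x)" for x
      have sh: "sq_integrable h" unfolding h_def by (rule sq_integrable_If[OF sf])
      define g where "g x = h x + e1 * Ep x + e2 * Em x" for x
      have sg: "sq_integrable g"
        unfolding g_def by (intro sq_integrable_add sq_integrable_cmult sh sE)
      have ae: "AE x in lborel. g x = f x"
        using AE_lborel_singleton[of 0]
        by eventually_elim (use f(1) in \<open>auto simp: g_def h_def\<close>)
      then have sqf: "sq_integrable f" using sq_integrable_cong_AE[OF sg f(2)] by blast
      have "norm (abs_L2 h) \<le> 1 * norm (abs_L2 fp) + 1 * norm (abs_L2 fm)"
        by (rule norm_abs_L2_le_sum2[OF sf sh]) (auto simp: h_def)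
      also have "\<dots> \<le> (Cp + Cm) * S" using b(1,2) by (simp add: algebra_simps)
      finally have nh: "norm (abs_L2 h) \<le> (Cp + Cm) * S" .
      have "norm (abs_L2 f) = norm (abs_L2 g)"
        using ae sqf sg by (metis abs_L2_eq_iff)
      also have "\<dots> \<le> 1 * norm (abs_L2 h) + norm e1 * norm (abs_L2 Ep) + norm e2 * norm (abs_L2 Em)"
      proof (rule norm_abs_L2_le_sum[OF sh sE sg])
        show "norm (g x) \<le> 1 * norm (h x) + norm e1 * norm (Ep x) + norm e2 * norm (Em x)" for x
          unfolding g_def by (intro norm_triangle_le add_mono) (auto simp: norm_mult)
      qed auto
      also have "\<dots> \<le> (Cp + Cm) * S +
          Cc * S * (norm ap + norm am + norm mp + norm mm) * norm (abs_L2 Ep) +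
          Cc * S * (norm ap + norm am + norm mp + norm mm) * norm (abs_L2 Em)"
        using nh b(3,4) by (intro add_mono mult_right_mono) auto
      also have "\<dots> = C * S"
        by (simp add: C_def R_def algebra_simps)
      finally show ?thesis using sqf by blast
    qed
    have le4: "norm (x * y) \<le> Cc * S * (norm ap + norm am + norm mp + norm mm)"
      if "norm x \<le> Cc * S" "norm y \<le> norm ap + norm am + norm mp + norm mm" for x y :: complex
      unfolding norm_mult using that pos S0 by (intro mult_mono) auto
    have ACv: "AC_on UNIV v (\<lambda>x. if 0 < x then - (mp\<^sup>2 / ap) * w x + h2 x else - (mm\<^sup>2 / am) * w x + h2 x)"
      by (rule glue[OF ACp(1) ACm(1)])
    have ACw: "AC_on UNIV w (\<lambda>x. if 0 < x then - ap * v x + h3 x else - am * v x + h3 x)"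
      by (rule glue[OF ACp(2) ACm(2)])
    have "norm (abs_L2 v) \<le> C * S \<and> sq_integrable v"
    proof (rule split[OF _ _ p(1) n(1) p(5) n(5)])
      show "v x = (if 0 < x then vp x else vm x) + (c1 * mp) * Ep x + (c2 * mm) * Em x" if "x \<noteq> 0" for x
        using that by (simp add: v_def Ep_def Em_def)
      show "norm (c1 * mp) \<le> Cc * S * (norm ap + norm am + norm mp + norm mm)"
        "norm (c2 * mm) \<le> Cc * S * (norm ap + norm am + norm mp + norm mm)"
        by (intro le4 c; simp)+
    qed (intro borel_measurable_continuous_onI AC_on_UNIV_continuous[OF ACv])
    moreover have "norm (abs_L2 w) \<le> C * S \<and> sq_integrable w"
    proof (rule split[OF _ _ p(2) n(2) p(6) n(6)])
      show "w x = (if 0 < x then wp x else wm x) + (c1 * ap) * Ep x + (c2 * (- am)) * Em x" if "x \<noteq> 0" for x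
        using that by (simp add: w_def Ep_def Em_def)
      show "norm (c1 * ap) \<le> Cc * S * (norm ap + norm am + norm mp + norm mm)"
        "norm (c2 * (- am)) \<le> Cc * S * (norm ap + norm am + norm mp + norm mm)"
        by (intro le4 c; simp)+
    qed (intro borel_measurable_continuous_onI AC_on_UNIV_continuous[OF ACw])
    ultimately show ?thesis using ACv ACw by blast
  qed
  moreover have "0 \<le> C" using pos Cp(1) Cm(1) by (simp add: C_def)
  ultimately show ?thesis using that by blast
qed

lemma norm_vec3_le:
  fixes x :: "complex^3"
  shows "norm x \<le> norm (x $ 1) + norm (x $ 2) + norm (x $ 3)"
proof -
  have "norm x \<le> (\<Sum>i\<in>UNIV. norm (x $ i))"
    unfolding norm_vec_def by (rule L2_set_le_sum) simp
  then show ?thesis by (simp add: sum_3)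
qed

text \<open>Injectivity: initial values of a kernel element lie on the decaying lines spanned by
  (mp, ap) and (mm, -am), which meet only in 0 when the determinant is nonzero. Surjectivity: after
  eliminating the first component, the equation is a layered first-order system with modified
  sources.\<close>

lemma resolvent_if_matching_determinant_nonzero:
  assumes ap: "ap = \<i> * Vp \<omega> + z" "ap \<noteq> 0" and am: "am = \<i> * Vm \<omega> + z" "am \<noteq> 0"
    and mp: "mp\<^sup>2 = (of_real k)\<^sup>2 - ap * (\<i> * \<omega> + z)" "Re mp > 0"
    and mm: "mm\<^sup>2 = (of_real k)\<^sup>2 - am * (\<i> * \<omega> + z)" "Re mm > 0"
    and D: "mp * am + mm * ap \<noteq> 0"
  shows "z \<in> resolvent_set dom_A (op_L Vp Vm k \<omega>)"
proof -
  define K where "K = norm (1 / ap) + norm (1 / am)"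
  have K0: "0 \<le> K" by (simp add: K_def)
  obtain C where C: "C \<ge> 0"
    "\<And>h2 h3. sq_integrable h2 \<Longrightarrow> sq_integrable h3 \<Longrightarrow> \<exists>v w. sq_integrable v \<and> sq_integrable w \<and>
      AC_on UNIV v (\<lambda>x. if 0 < x then - (mp\<^sup>2 / ap) * w x + h2 x else - (mm\<^sup>2 / am) * w x + h2 x) \<and>
      AC_on UNIV w (\<lambda>x. if 0 < x then - ap * v x + h3 x else - am * v x + h3 x) \<and>
      norm (abs_L2 v) \<le> C * (norm (abs_L2 h2) + norm (abs_L2 h3)) \<and>
      norm (abs_L2 w) \<le> C * (norm (abs_L2 h2) + norm (abs_L2 h3))"
    using solve_layered_system[OF ap(2) am(2) mp(2) mm(2) D] by blast
  \<comment> \<open>The sources satisfy |h2| + |h3| \<le> (2 + |k| K) |F|: one unit each from the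
    second and third component of F, and |k| K from the eliminated first one.\<close>
  define B where "B = C * (2 + \<bar>k\<bar> * K)"
  show ?thesis
  proof (rule resolvent_setI)
    show "c *\<^sub>R u + v \<in> dom_A \<and> op_L Vp Vm k \<omega> (c *\<^sub>R u + v) - z *\<^sub>n (c *\<^sub>R u + v) =
        c *\<^sub>R (op_L Vp Vm k \<omega> u - z *\<^sub>n u) + (op_L Vp Vm k \<omega> v - z *\<^sub>n v)"
      if "u \<in> dom_A" "v \<in> dom_A" for u v c
      using op_L_lincomb[OF that] by blast
  next
    fix u assume u: "u \<in> dom_A" "op_L Vp Vm k \<omega> u - z *\<^sub>n u = 0"
    obtain v w where vw: "half_line_solution ap mp v w"
      "half_line_solution am mm (\<lambda>x. - v (- x)) (\<lambda>x. w (- x))" "v 0 = 0 \<Longrightarrow> w 0 = 0 \<Longrightarrow> u = 0"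
      using kernel_half_line_solutions[OF u ap am mp(1) mm(1)] by blast
    have e1: "ap * v 0 = mp * w 0" and "- (am * v 0) = mm * w 0"
      using half_line_solution.decay[OF vw(1)] half_line_solution.decay[OF vw(2)] mp mm by auto
    then have e: "ap * v 0 = mp * w 0" "am * v 0 = - (mm * w 0)"
      by (metis minus_equation_iff)+
    have "(mp * am + mm * ap) * v 0 = mp * (am * v 0) + mm * (ap * v 0)"
      by (simp add: algebra_simps)
    also have "\<dots> = 0" unfolding e by (simp add: algebra_simps)
    finally have "v 0 = 0" using D by simp
    moreover have "mp \<noteq> 0" using mp(2) by auto
    ultimately show "u = 0" using e(1) vw(3) by simp
  next
    fix f :: "(complex^3) L2"
    obtain F where F: "sq_integrable F" "f = abs_L2 F" by (rule abs_L2_cases)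
    note Fi = sq_integrable_nth[OF F(1)]
    \<comment> \<open>Solving the first component gives u1 = (i k w - F1)/a, whose F1 part reappears
      as a source in the equation for v. The sign in \<open>h3\<close> comes from the entry -d/dx of
      A.\<close>
    define h2 where "h2 x = F x $ 3 + (if 0 < x then (- (\<i> * of_real k / ap)) * F x $ 1
        else (- (\<i> * of_real k / am)) * F x $ 1)" for x
    define h3 where "h3 x = - F x $ 2" for x
    have h: "sq_integrable h2" "sq_integrable h3"
      unfolding h2_def h3_def
      by (intro sq_integrable_add sq_integrable_If sq_integrable_cmult sq_integrable_uminus Fi)+
    obtain v w where vw: "sq_integrable v" "sq_integrable w"
      "AC_on UNIV v (\<lambda>x. if 0 < x then - (mp\<^sup>2 / ap) * w x + h2 x else - (mm\<^sup>2 / am) * w x + h2 x)"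
      "AC_on UNIV w (\<lambda>x. if 0 < x then - ap * v x + h3 x else - am * v x + h3 x)"
      "norm (abs_L2 v) \<le> C * (norm (abs_L2 h2) + norm (abs_L2 h3))"
      "norm (abs_L2 w) \<le> C * (norm (abs_L2 h2) + norm (abs_L2 h3))"
      using C(2)[OF h] by blast
    define g2 where "g2 x = (if 0 < x then - (mp\<^sup>2 / ap) * w x + h2 x else - (mm\<^sup>2 / am) * w x + h2 x)" for x
    define g3 where "g3 x = (if 0 < x then - ap * v x + h3 x else - am * v x + h3 x)" for x
    have g: "sq_integrable g2" "sq_integrable g3"
      unfolding g2_def g3_def by (intro sq_integrable_If sq_integrable_add sq_integrable_cmult vw h)+
    define u1 where "u1 x = (if 0 < x then 1 / ap * (\<i> * of_real k * w x + (-1) * F x $ 1)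
        else 1 / am * (\<i> * of_real k * w x + (-1) * F x $ 1))" for x
    have u1: "sq_integrable u1"
      unfolding u1_def by (intro sq_integrable_If sq_integrable_add sq_integrable_cmult vw Fi)
    define U where "U x = (vector [u1 x, v x, w x] :: complex^3)" for x
    have U: "sq_integrable U"
      unfolding U_def by (intro sq_integrable_vector3 u1 vw)
    have "is_weak_deriv (abs_L2 v) (abs_L2 g2)" "is_weak_deriv (abs_L2 w) (abs_L2 g3)"
      using is_weak_deriv_iff_AC[OF vw(1) g(1)] is_weak_deriv_iff_AC[OF vw(2) g(2)] vw(3,4)
      unfolding g2_def[symmetric] g3_def[symmetric] by auto
    then have dom: "dom_repr U g2 g3"
      using U g by (simp add: dom_repr_def U_def)
    have "op_L_repr Vp Vm k \<omega> z U g2 g3 x = F x" for x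
    proof -
      define a where "a = (if 0 < x then ap else am)"
      define m where "m = (if 0 < x then mp else mm)"
      have a: "a \<noteq> 0" "\<i> * V_layers Vp Vm x \<omega> + z = a"
        using ap am by (auto simp: a_def V_layers_def)
      have m: "m\<^sup>2 = (of_real k)\<^sup>2 - a * (\<i> * \<omega> + z)"
        using mp mm by (simp add: m_def a_def)
      have eqs: "u1 x = (\<i> * of_real k * w x - F x $ 1) / a"
        "g2 x = - (((of_real k)\<^sup>2 - a * (\<i> * \<omega> + z)) / a) * w x + (F x $ 3 - \<i> * of_real k / a * F x $ 1)"
        "g3 x = - a * v x - F x $ 2"
        unfolding m[symmetric] by (simp_all add: u1_def g2_def g3_def h2_def h3_def a_def m_def)
      have "\<i> * of_real k * w x - a * u1 x = F x $ 1" "- g3 x - a * v x = F x $ 2"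
        "- (\<i> * of_real k) * u1 x + g2 x - (\<i> * \<omega> + z) * w x = F x $ 3"
        unfolding eqs using a(1) by (simp_all add: field_simps power2_eq_square)
      then show ?thesis
        by (simp add: op_L_repr_def U_def a vec_eq_iff forall_3)
    qed
    then have "op_L_repr Vp Vm k \<omega> z U g2 g3 = F" by (rule ext)
    then have "op_L Vp Vm k \<omega> (abs_L2 U) - z *\<^sub>n abs_L2 U = f"
      unfolding op_L_abs_L2(2)[OF dom] F(2) by simp
    moreover have "norm (abs_L2 U) \<le> (B + (\<bar>k\<bar> * K + 1) * B + K) * norm f"
    proof -
      have K: "norm (1 / ap) \<le> K" "norm (1 / am) \<le> K"
        by (auto simp: K_def simp del: norm_divide)
      have hn: "norm (h2 x) \<le> 1 * norm (F x) + (\<bar>k\<bar> * K) * norm (F x)" for x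
      proof -
        have *: "norm ((- (\<i> * of_real k / c)) * F x $ 1) \<le> \<bar>k\<bar> * K * norm (F x)" if "norm (1 / c) \<le> K" for c
        proof -
          have "norm ((- (\<i> * of_real k / c)) * F x $ 1) = \<bar>k\<bar> * norm (1 / c) * norm (F x $ 1)"
            by (simp add: norm_mult norm_divide)
          also have "\<dots> \<le> \<bar>k\<bar> * K * norm (F x)"
            using that K0 by (intro mult_mono Finite_Cartesian_Product.norm_nth_le) auto
          finally show ?thesis .
        qed
        have "norm (if 0 < x then (- (\<i> * of_real k / ap)) * F x $ 1 else (- (\<i> * of_real k / am)) * F x $ 1)
            \<le> \<bar>k\<bar> * K * norm (F x)"
          using *[OF K(1)] *[OF K(2)] by (cases "0 < x") (simp_all only: if_True if_False)
        then show ?thesis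
          unfolding h2_def by (intro norm_triangle_le add_mono) (simp_all add: Finite_Cartesian_Product.norm_nth_le)
      qed
      have "norm (abs_L2 h2) \<le> 1 * norm (abs_L2 F) + (\<bar>k\<bar> * K) * norm (abs_L2 F)"
        using K0 by (intro norm_abs_L2_le_sum2 F h hn) auto
      moreover have "norm (abs_L2 h3) \<le> 1 * norm (abs_L2 F) + 0 * norm (abs_L2 F)"
        by (intro norm_abs_L2_le_sum2 F h) (auto simp: h3_def Finite_Cartesian_Product.norm_nth_le)
      ultimately have "norm (abs_L2 h2) + norm (abs_L2 h3) \<le> (2 + \<bar>k\<bar> * K) * norm f"
        by (simp add: F(2) algebra_simps)
      from mult_left_mono[OF this C(1)] vw(5,6)
      have n: "norm (abs_L2 v) \<le> B * norm f" "norm (abs_L2 w) \<le> B * norm f"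
        by (simp_all add: B_def mult.assoc)
      have "norm (abs_L2 U) \<le> 1 * norm (abs_L2 v) + (\<bar>k\<bar> * K + 1) * norm (abs_L2 w) + K * norm (abs_L2 F)"
      proof (rule norm_abs_L2_le_sum[OF vw(1,2) F(1) U])
        fix x
        have *: "norm (1 / c * (\<i> * of_real k * w x + (-1) * F x $ 1)) \<le> K * (\<bar>k\<bar> * norm (w x) + norm (F x))"
          if "norm (1 / c) \<le> K" for c
          unfolding norm_mult[of "1 / c"]
        proof (intro mult_mono that)
          show "norm (\<i> * of_real k * w x + (-1) * F x $ 1) \<le> \<bar>k\<bar> * norm (w x) + norm (F x)"
            by (intro norm_triangle_le add_mono) (simp_all add: norm_mult Finite_Cartesian_Product.norm_nth_le)
        qed (use K0 in auto)
        have "norm (u1 x) \<le> K * (\<bar>k\<bar> * norm (w x) + norm (F x))"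
          unfolding u1_def using *[OF K(1)] *[OF K(2)] by (cases "0 < x") (simp_all only: if_True if_False)
        moreover have "norm (U x) \<le> norm (u1 x) + norm (v x) + norm (w x)"
          using norm_vec3_le[of "U x"] by (simp add: U_def)
        ultimately show "norm (U x) \<le> 1 * norm (v x) + (\<bar>k\<bar> * K + 1) * norm (w x) + K * norm (F x)"
          by (simp add: algebra_simps)
      qed (use K0 in auto)
      also have "\<dots> \<le> 1 * (B * norm f) + (\<bar>k\<bar> * K + 1) * (B * norm f) + K * norm f"
        using n K0 by (intro add_mono mult_left_mono) (auto simp: F(2))
      finally show ?thesis by (simp add: algebra_simps)
    qed
    ultimately show "\<exists>u\<in>dom_A. op_L Vp Vm k \<omega> u - z *\<^sub>n u = f \<and>
        norm u \<le> (B + (\<bar>k\<bar> * K + 1) * B + K) * norm f"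
      using dom_repr_dom_A[OF dom] by blast
  qed
qed

section \<open>Isolation of the eigenvalue\<close>

text \<open>If the determinant vanishes, then \<open>mp\<^sup>2 am\<^sup>2 = mm\<^sup>2 ap\<^sup>2\<close>; this factors into
  \<open>am - ap\<close>, which does not depend on \<open>z\<close>, and a cubic in \<open>z\<close>.\<close>

lemma finite_zeros_of_determinant:
  fixes k \<alpha> \<beta> \<gamma> :: complex
  assumes "\<alpha> \<noteq> \<beta>"
  shows "finite {z. \<exists>mp mm. mp\<^sup>2 = k\<^sup>2 - (\<alpha> + z) * (\<gamma> + z) \<and> mm\<^sup>2 = k\<^sup>2 - (\<beta> + z) * (\<gamma> + z) \<and>
    mp * (\<beta> + z) + mm * (\<alpha> + z) = 0}"
proof -
  define p where "p = [:\<alpha>, 1:] * [:\<beta>, 1:] * [:\<gamma>, 1:] - smult (k\<^sup>2) [:\<alpha> + \<beta>, 2:]"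
  have "coeff p 3 = 1"
    by (simp add: p_def numeral_3_eq_3)
  then have "p \<noteq> 0" by auto
  then have "finite {z. poly p z = 0}" by (rule poly_roots_finite)
  then show ?thesis
  proof (rule finite_subset[rotated], intro subsetI CollectI)
    fix z
    assume "z \<in> {z. \<exists>mp mm. mp\<^sup>2 = k\<^sup>2 - (\<alpha> + z) * (\<gamma> + z) \<and> mm\<^sup>2 = k\<^sup>2 - (\<beta> + z) * (\<gamma> + z) \<and>
      mp * (\<beta> + z) + mm * (\<alpha> + z) = 0}"
    then obtain mp mm where m: "mp\<^sup>2 = k\<^sup>2 - (\<alpha> + z) * (\<gamma> + z)" "mm\<^sup>2 = k\<^sup>2 - (\<beta> + z) * (\<gamma> + z)"
      and "mp * (\<beta> + z) + mm * (\<alpha> + z) = 0" by blast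
    then have "mp * (\<beta> + z) = - (mm * (\<alpha> + z))" by (simp add: eq_neg_iff_add_eq_0)
    \<comment> \<open>Squaring removes the dependence on the branches of mp and mm, which is why the
      statement can quantify over all square roots.\<close>
    then have "(mp * (\<beta> + z))\<^sup>2 = (mm * (\<alpha> + z))\<^sup>2" by simp
    then have "(k\<^sup>2 - (\<alpha> + z) * (\<gamma> + z)) * (\<beta> + z)\<^sup>2 - (k\<^sup>2 - (\<beta> + z) * (\<gamma> + z)) * (\<alpha> + z)\<^sup>2 = 0"
      by (simp add: power_mult_distrib m)
    also have "(k\<^sup>2 - (\<alpha> + z) * (\<gamma> + z)) * (\<beta> + z)\<^sup>2 - (k\<^sup>2 - (\<beta> + z) * (\<gamma> + z)) * (\<alpha> + z)\<^sup>2 =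
        (\<alpha> - \<beta>) * poly p z"
      by (simp add: p_def algebra_simps power2_eq_square)
    finally show "poly p z = 0" using assms by simp
  qed
qed

theorem proposition2p5:
  fixes k :: real and \<Omega> :: "complex set" and Vp Vm :: "complex \<Rightarrow> complex"
  shows "\<forall>\<omega> \<in> pencil_point_spectrum \<Omega> Vp Vm k - Omega0 \<Omega> Vp Vm.
           isolated_eigenvalue \<Omega> Vp Vm k \<omega>"
proof
  fix \<omega> assume \<omega>: "\<omega> \<in> pencil_point_spectrum \<Omega> Vp Vm k - Omega0 \<Omega> Vp Vm"
  then have V: "Vp \<omega> \<noteq> 0" "Vm \<omega> \<noteq> 0"
    by (auto simp: pencil_point_spectrum_def Omega0_def)
  obtain u where u: "u \<in> dom_A" "u \<noteq> 0" "op_L Vp Vm k \<omega> u = 0"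
    using \<omega> by (auto simp: pencil_point_spectrum_def)
  define a where "a V z = \<i> * V + z" for V z :: complex
  \<comment> \<open>The principal root has nonnegative real part, so a nonzero real part is already
    positive.\<close>
  define m where "m V z = csqrt ((of_real k)\<^sup>2 - a V z * (\<i> * \<omega> + z))" for V z
  have m2: "(m V z)\<^sup>2 = (of_real k)\<^sup>2 - a V z * (\<i> * \<omega> + z)" for V z
    by (simp add: m_def)
  have "0 *\<^sub>n u = 0"
  proof -
    obtain U where U: "sq_integrable U" "u = abs_L2 U" by (rule abs_L2_cases)
    then show ?thesis by (simp add: cmul_vec.abs_eq zero_L2_abs)
  qed
  then have ker: "op_L Vp Vm k \<omega> u - 0 *\<^sub>n u = 0" using u(3) by simp
  have a0: "a (Vp \<omega>) 0 \<noteq> 0" "a (Vm \<omega>) 0 \<noteq> 0" using V by (auto simp: a_def)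
  obtain v w where vw: "half_line_solution (a (Vp \<omega>) 0) (m (Vp \<omega>) 0) v w"
    "half_line_solution (a (Vm \<omega>) 0) (m (Vm \<omega>) 0) (\<lambda>x. - v (- x)) (\<lambda>x. w (- x))"
    "v 0 = 0 \<Longrightarrow> w 0 = 0 \<Longrightarrow> u = 0"
    using kernel_half_line_solutions[OF u(1) ker a_def a0(1) a_def a0(2) m2 m2] by blast
  have "Re (m (Vp \<omega>) 0) \<noteq> 0"
    using half_line_solution.zero_if_Re_eq_0[OF vw(1)] vw(3) u(2) by blast
  moreover have "Re (m (Vm \<omega>) 0) \<noteq> 0"
    using half_line_solution.zero_if_Re_eq_0[OF vw(2)] vw(3) u(2) by auto
  moreover have "0 \<le> Re (m V 0)" for V
    unfolding m_def by (rule Re_csqrt)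
  ultimately have Re0: "0 < Re (m (Vp \<omega>) 0)" "0 < Re (m (Vm \<omega>) 0)"
    by (auto simp: order_less_le)
  have ev: "\<forall>\<^sub>F z in nhds 0. a V z \<noteq> 0 \<and> 0 < Re (m V z)" if "V \<noteq> 0" "0 < Re (m V 0)" for V
  proof -
    \<comment> \<open>The root is continuous off its branch cut, the nonpositive reals. On the cut
      it is purely imaginary, which the positive real part at z = 0 excludes.\<close>
    have "(of_real k)\<^sup>2 - a V 0 * (\<i> * \<omega> + 0) \<notin> \<real>\<^sub>\<le>\<^sub>0"
    proof
      assume "(of_real k)\<^sup>2 - a V 0 * (\<i> * \<omega> + 0) \<in> \<real>\<^sub>\<le>\<^sub>0"
      then have "Re (m V 0) = 0"
        unfolding m_def by (subst csqrt_of_real_nonpos) (auto simp: complex_nonpos_Reals_iff)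
      then show False using that(2) by simp
    qed
    then have "isCont (m V) 0"
      unfolding m_def a_def by (intro continuous_intros isCont_o2[OF _ continuous_at_csqrt]) auto
    then have "(m V \<longlongrightarrow> m V 0) (nhds 0)"
      by (simp add: isCont_def tendsto_at_iff_tendsto_nhds)
    then have "((\<lambda>z. Re (m V z)) \<longlongrightarrow> Re (m V 0)) (nhds 0)"
      by (rule tendsto_Re)
    then have "\<forall>\<^sub>F z in nhds 0. 0 < Re (m V z)"
      using that(2) by (rule order_tendstoD(1))
    moreover have "\<forall>\<^sub>F z in nhds 0. a V z \<noteq> 0"
    proof -
      have "open {z. a V z \<noteq> 0}"
        unfolding a_def by (intro open_Collect_neq continuous_intros)
      then show ?thesis
        using that(1) eventually_nhds_in_open[of "{z. a V z \<noteq> 0}" 0] by (simp add: a_def)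
    qed
    ultimately show ?thesis by eventually_elim simp
  qed
  obtain r1 where r1: "r1 > 0" "\<And>z. cmod z < r1 \<Longrightarrow> a (Vp \<omega>) z \<noteq> 0 \<and> 0 < Re (m (Vp \<omega>) z) \<and>
      a (Vm \<omega>) z \<noteq> 0 \<and> 0 < Re (m (Vm \<omega>) z)"
    using eventually_conj[OF ev[OF V(1) Re0(1)] ev[OF V(2) Re0(2)]]
    by (auto simp: eventually_nhds_metric)
  obtain r2 where r2: "r2 > 0" "\<And>z. 0 < cmod z \<Longrightarrow> cmod z < r2 \<Longrightarrow> cmod z < r1 \<Longrightarrow>
      m (Vp \<omega>) z * a (Vm \<omega>) z + m (Vm \<omega>) z * a (Vp \<omega>) z \<noteq> 0"
  proof (cases "Vp \<omega> = Vm \<omega>")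
    case True
    \<comment> \<open>Here the determinant is 2 m a, nonzero on the whole disc of radius r1; the
      value 1 for r2 is arbitrary.\<close>
    have "m (Vp \<omega>) z * a (Vm \<omega>) z + m (Vm \<omega>) z * a (Vp \<omega>) z \<noteq> 0" if "cmod z < r1" for z
    proof -
      have "m (Vp \<omega>) z \<noteq> 0" "a (Vp \<omega>) z \<noteq> 0" using r1(2)[OF that] by auto
      then show ?thesis by (simp add: True)
    qed
    then show ?thesis using that[of 1] by simp
  next
    case False
    let ?Z = "{z. \<exists>mp mm. mp\<^sup>2 = (of_real k)\<^sup>2 - a (Vp \<omega>) z * (\<i> * \<omega> + z) \<and>
      mm\<^sup>2 = (of_real k)\<^sup>2 - a (Vm \<omega>) z * (\<i> * \<omega> + z) \<and> mp * a (Vm \<omega>) z + mm * a (Vp \<omega>) z = 0}"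
    have "finite ?Z"
      unfolding a_def by (rule finite_zeros_of_determinant) (use False in simp)
    \<comment> \<open>Because \<omega> is an eigenvalue, 0 belongs to the finite set; only its other
      points can be kept at a distance.\<close>
    from finite_set_avoid[OF this, of 0]
    obtain d where d: "d > 0" "\<forall>z\<in>?Z. z \<noteq> 0 \<longrightarrow> d \<le> dist 0 z" by blast
    have "m (Vp \<omega>) z * a (Vm \<omega>) z + m (Vm \<omega>) z * a (Vp \<omega>) z \<noteq> 0" if "0 < cmod z" "cmod z < d" for z
    proof
      assume "m (Vp \<omega>) z * a (Vm \<omega>) z + m (Vm \<omega>) z * a (Vp \<omega>) z = 0"
      then have "z \<in> ?Z" using m2 by blast
      with d(2) have "z \<noteq> 0 \<longrightarrow> d \<le> dist 0 z" by (rule bspec)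
      then show False using that by simp
    qed
    then show ?thesis using that[of d] d(1) by blast
  qed
  have "z \<in> resolvent_set dom_A (op_L Vp Vm k \<omega>)" if "0 < cmod z" "cmod z < min r1 r2" for z
    by (rule resolvent_if_matching_determinant_nonzero[OF a_def _ a_def _ m2 _ m2])
       (use r1(2)[of z] r2(2)[of z] that in simp_all)
  then show "isolated_eigenvalue \<Omega> Vp Vm k \<omega>"
    using \<omega> r1(1) r2(1) unfolding isolated_eigenvalue_def by (intro conjI exI[of _ "min r1 r2"]) auto
qed

end
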